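(* Let $n\in\mathbb N$. Any two complex Hadamard matrices $H,H'\in M_n(\mathbb C)$ of size $n$ are weakly quantum equivalent; that is, there exist a non-zero unital $C^*$-algebra $\mathcal A$ and free quantum reflection matrices $p,q\in M_n(\mathcal A)$ such that $H'q=pH$.
   Context: A (complex) Hadamard matrix of size $n$ is a matrix $H\in M_n(\mathbb C)$ all of whose entries have modulus one and which satisfies $HH^\dagger=nI=H^\dagger H$, where $\dagger$ is the conjugate transpose. For a unital $*$-algebra $\mathcal A$, a matrix $u=(u_{ij})\in M_n(\mathcal A)$ is called a free quantum reflection matrix if both $u$ and $\bar u=(u_{ij}^* )$ are unitary in $M_n(\mathcal A)$ and $u_{ik}u_{il}^*\delta_{ij}=u_{ik}u_{jk}^*\delta_{kl}$ for all $i,j,k,l\in\{1,\dots,n\}$. The universal unital $*$-algebra generated by the entries of a free quantum reflection matrix is the coordinate algebra $\mathcal O(K_n^+)$ of the compact quantum group $K_n^+$ (the free complexification of the hyperoctahedral quantum group $H_n^+$). Two Hadamard matrices $H,H'$ of size $n$ are weakly quantum equivalent (i.e. $K_n^+$-quantum equivalent) if there are a non-zero unital $C^*$-algebra $\mathcal A$ and two free quantum reflection matrices $p,q\in M_n(\mathcal A)$ (entries in the same algebra) with $H'q=pH$, where scalars are identified with multiples of the unit of $\mathcal A$. *)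

theory Defs
  imports "Jordan_Normal_Form.Schur_Decomposition"
begin

section \<open>Unital star-algebras and C*-algebras\<close>

record 'a star_alg = "(complex, 'a) module" +
  star :: "'a \<Rightarrow> 'a"

record 'a cstar_alg = "'a star_alg" +
  cnorm :: "'a \<Rightarrow> real"

locale unital_star_algebra =
  R?: ring A + M?: Module.module "class_ring :: complex ring" A
  for A :: "('a, 'm) star_alg_scheme" (structure) +
  assumes smult_mult_left: "x \<in> carrier A \<Longrightarrow> y \<in> carrier A \<Longrightarrow> (c \<odot> x) \<otimes> y = c \<odot> (x \<otimes> y)"
    and smult_mult_right: "x \<in> carrier A \<Longrightarrow> y \<in> carrier A \<Longrightarrow> x \<otimes> (c \<odot> y) = c \<odot> (x \<otimes> y)"
    and star_closed: "x \<in> carrier A \<Longrightarrow> star A x \<in> carrier A"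
    and star_star: "x \<in> carrier A \<Longrightarrow> star A (star A x) = x"
    and star_add: "x \<in> carrier A \<Longrightarrow> y \<in> carrier A \<Longrightarrow> star A (x \<oplus> y) = star A x \<oplus> star A y"
    and star_smult: "x \<in> carrier A \<Longrightarrow> star A (c \<odot> x) = cnj c \<odot> star A x"
    and star_mult: "x \<in> carrier A \<Longrightarrow> y \<in> carrier A \<Longrightarrow> star A (x \<otimes> y) = star A y \<otimes> star A x"

locale unital_cstar_algebra = unital_star_algebra A
  for A :: "('a, 'm) cstar_alg_scheme" (structure) +
  assumes cnorm_nonneg: "x \<in> carrier A \<Longrightarrow> 0 \<le> cnorm A x"
    and cnorm_eq_0_iff: "x \<in> carrier A \<Longrightarrow> cnorm A x = 0 \<longleftrightarrow> x = \<zero>"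
    and cnorm_add: "x \<in> carrier A \<Longrightarrow> y \<in> carrier A \<Longrightarrow> cnorm A (x \<oplus> y) \<le> cnorm A x + cnorm A y"
    and cnorm_smult: "x \<in> carrier A \<Longrightarrow> cnorm A (c \<odot> x) = cmod c * cnorm A x"
    and cnorm_mult: "x \<in> carrier A \<Longrightarrow> y \<in> carrier A \<Longrightarrow> cnorm A (x \<otimes> y) \<le> cnorm A x * cnorm A y"
    and cstar_identity: "x \<in> carrier A \<Longrightarrow> cnorm A (star A x \<otimes> x) = (cnorm A x)\<^sup>2"
    and complete:
      "(\<And>k. s k \<in> carrier A) \<Longrightarrow>
       (\<And>e. 0 < e \<Longrightarrow> \<exists>N. \<forall>k\<ge>N. \<forall>l\<ge>N. cnorm A (s k \<ominus> s l) < e) \<Longrightarrow>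
       \<exists>x\<in>carrier A. (\<lambda>k. cnorm A (s k \<ominus> x)) \<longlonglongrightarrow> 0"


section \<open>Square matrices over a star-algebra\<close>

text \<open>The matrix operations of the imported library take their entries from a whole type with
  type-class arithmetic. Here the entries lie in the carrier of an algebra, so only the
  type of matrices and the indexing (from 0 to n - 1) are taken from there.\<close>

definition alg_mats :: "('a, 'm) star_alg_scheme \<Rightarrow> nat \<Rightarrow> 'a mat set" where
  "alg_mats A n = {u \<in> carrier_mat n n. \<forall>i<n. \<forall>j<n. u $$ (i, j) \<in> carrier A}"

definition mat_mult :: "('a, 'm) star_alg_scheme \<Rightarrow> nat \<Rightarrow> 'a mat \<Rightarrow> 'a mat \<Rightarrow> 'a mat" where
  "mat_mult A n u v =
     mat n n (\<lambda>(i, j). \<Oplus>\<^bsub>A\<^esub>k\<in>{..<n}. u $$ (i, k) \<otimes>\<^bsub>A\<^esub> v $$ (k, j))"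

definition scalar_mat :: "('a, 'm) star_alg_scheme \<Rightarrow> nat \<Rightarrow> complex mat \<Rightarrow> 'a mat" where
  "scalar_mat A n H = mat n n (\<lambda>(i, j). H $$ (i, j) \<odot>\<^bsub>A\<^esub> \<one>\<^bsub>A\<^esub>)"

definition mat_star :: "('a, 'm) star_alg_scheme \<Rightarrow> nat \<Rightarrow> 'a mat \<Rightarrow> 'a mat" where
  "mat_star A n u = mat n n (\<lambda>(i, j). star A (u $$ (j, i)))"

definition mat_bar :: "('a, 'm) star_alg_scheme \<Rightarrow> nat \<Rightarrow> 'a mat \<Rightarrow> 'a mat" where
  "mat_bar A n u = mat n n (\<lambda>(i, j). star A (u $$ (i, j)))"

definition unitary_mat :: "('a, 'm) star_alg_scheme \<Rightarrow> nat \<Rightarrow> 'a mat \<Rightarrow> bool" where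
  "unitary_mat A n u \<longleftrightarrow>
     u \<in> alg_mats A n \<and>
     mat_mult A n u (mat_star A n u) = scalar_mat A n (1\<^sub>m n) \<and>
     mat_mult A n (mat_star A n u) u = scalar_mat A n (1\<^sub>m n)"

definition free_quantum_reflection ::
    "('a, 'm) star_alg_scheme \<Rightarrow> nat \<Rightarrow> 'a mat \<Rightarrow> bool" where
  "free_quantum_reflection A n u \<longleftrightarrow>
     unitary_mat A n u \<and> unitary_mat A n (mat_bar A n u) \<and>
     (\<forall>i<n. \<forall>j<n. \<forall>k<n. \<forall>l<n.
        (if i = j then u $$ (i, k) \<otimes>\<^bsub>A\<^esub> star A (u $$ (i, l)) else \<zero>\<^bsub>A\<^esub>) =
        (if k = l then u $$ (i, k) \<otimes>\<^bsub>A\<^esub> star A (u $$ (j, k)) else \<zero>\<^bsub>A\<^esub>))"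


section \<open>Hadamard matrices and weak quantum equivalence\<close>

definition hadamard :: "nat \<Rightarrow> complex mat \<Rightarrow> bool" where
  "hadamard n H \<longleftrightarrow>
     H \<in> carrier_mat n n \<and> (\<forall>i<n. \<forall>j<n. cmod (H $$ (i, j)) = 1) \<and>
     H * mat_adjoint H = of_nat n \<cdot>\<^sub>m 1\<^sub>m n \<and> mat_adjoint H * H = of_nat n \<cdot>\<^sub>m 1\<^sub>m n"

text \<open>HOL cannot quantify existentially over types, so the carrier of the algebra is a subset of
  one fixed type with continuum many elements. This loses no generality: given \<open>p\<close> and \<open>q\<close> over an
  arbitrary C*-algebra, the unital C*-subalgebra generated by their finitely many entries
  is separable, hence has at most continuum many elements and can be transported to a subset of
  this type (for instance as infinite matrices of operators on \<open>\<ell>\<^sup>2\<close>).\<close>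

type_synonym cstar_universe = "nat \<Rightarrow> nat \<Rightarrow> complex"

definition weakly_quantum_equivalent :: "nat \<Rightarrow> complex mat \<Rightarrow> complex mat \<Rightarrow> bool" where
  "weakly_quantum_equivalent n H H' \<longleftrightarrow>
     (\<exists>(A :: cstar_universe cstar_alg) p q.
        unital_cstar_algebra A \<and> \<one>\<^bsub>A\<^esub> \<noteq> \<zero>\<^bsub>A\<^esub> \<and>
        free_quantum_reflection A n p \<and> free_quantum_reflection A n q \<and>
        mat_mult A n (scalar_mat A n H') q = mat_mult A n p (scalar_mat A n H))"

end

theory Submission
  imports Defs "HOL-Analysis.Analysis"
begin

text \<open>Up to size 3, any two Hadamard matrices agree after permuting the columns and scaling rows and columns by
  phases, so scalar monomial matrices \<open>p\<close> and \<open>q\<close> suffice.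

  For \<open>n \<ge> 4\<close>, suppose that four partitions of unity \<open>e, f, e', f'\<close> of one projection are given such that \<open>e\<close> commutes
  with \<open>e'\<close> and \<open>f\<close> with \<open>f'\<close>, that the pairs \<open>e\<^sub>k, f'\<^sub>i\<close> and \<open>e'\<^sub>i, f\<^sub>k\<close> are unbiased (\<open>x y x = x / n\<close> and
  \<open>y x y = y / n\<close>), and that with \<open>u\<^sub>l = \<Sum>\<^sub>k H\<^sub>l\<^sub>k e\<^sub>k\<close> and \<open>u'\<^sub>j = \<Sum>\<^sub>i H'\<^sub>j\<^sub>i e'\<^sub>i\<close> neither \<open>W = u\<^sub>l f\<^sub>l u\<^sub>l\<^sup>*\<close> nor
  \<open>Y = u'\<^sub>j f'\<^sub>j u'\<^sub>j\<^sup>*\<close> depends on the index. Then \<open>q\<^sub>i\<^sub>k = n\<^sup>2 e\<^sub>0 Y e'\<^sub>i e\<^sub>k W e\<^sub>0\<close> and \<open>p\<^sub>j\<^sub>l = n e\<^sub>0 Y u'\<^sub>j u\<^sub>l\<^sup>* W e\<^sub>0\<close>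
  are free quantum reflection matrices over the corner given by \<open>e\<^sub>0\<close>, and \<open>H' q = p H\<close>.

  Such families live on a product of two Fock spaces. For the creation operators \<open>c\<^sub>k\<close> of either factor one finds,
  level by level, a partition of unity \<open>F\<close> such that \<open>c\<^sub>k = U\<^sub>k\<^sup>* Z U\<^sub>k\<close> for \<open>U\<^sub>k = \<Sum>\<^sub>l h\<^sub>l\<^sub>k F\<^sub>l\<close> and a fixed \<open>Z\<close>. Whatever is
  built from the \<open>c\<^sub>k\<close> uniformly in \<open>k\<close> is covariant in the same sense, for instance projections \<open>Q\<close> and \<open>P\<^sub>k\<close> with
  \<open>c\<^sub>k\<^sup>* Q c\<^sub>m = \<delta>\<^sub>k\<^sub>m P\<^sub>k - \<iota> P\<^sub>k P\<^sub>m\<close>, where the number \<open>\<iota>\<close> depends on the level only. The parameters \<open>x\<^sub>j\<close> and \<open>y\<^sub>j\<close> of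
  the two factors can be interlaced by \<open>n x\<^sub>j (1 - y\<^sub>j) = 1 = n y\<^sub>j\<^sub>+\<^sub>1 (1 - x\<^sub>j)\<close> and \<open>y\<^sub>0 = 0\<close>; they stay between 0 and
  1/2 because \<open>n \<ge> 4\<close>. These equations make the projections \<open>e\<^sub>k = X\<^sub>k X\<^sub>k\<^sup>*\<close>, obtained from
  \<open>X\<^sub>k = (\<surd>x + Q c\<^sub>k) P\<^sub>k\<close> by restricting to suitable pairs of levels, unbiased to their analogues \<open>f'\<^sub>i\<close> for the other
  factor; \<open>f\<close> and \<open>e'\<close> are the partitions \<open>F\<close> of the two factors.\<close>

section \<open>Square-summable families\<close>

text \<open>The pairs of levels form a staircase (0,0), (0,1), (1,1), (1,2), ...: \<open>d\<close>
  leads from (j,j) to (j,j+1) and \<open>c\<close> from (j,j+1) to (j+1,j+1). Each e_k mixes the two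
  cells of a step made by \<open>c\<close>, each f'_i those of a step made by \<open>d\<close>.
  Every cell after the first thus belongs to two steps, and unbiasedness there ties the parameter of
  one step to that of the next; this is the origin of the two equations between x and y. The cell
  (0,0) drops out of both families because y_0 = 0. No later parameter vanishes, so the staircase
  goes on for ever and the space is infinite-dimensional. Read as y_0, x_0, y_1, x_1, ..., the
  parameters are the orbit of 0 under t -> 1 / (n (1 - t)), whose fixed points, t (1 - t) = 1 / n,
  are real exactly if n >= 4. That p is a free quantum reflection matrix along with q is due to Y
  e'_0 f'_j being a multiple of Y u'_j: it turns p into a product of the same shape as q, with f', f
  in place of e', e.\<close>

typedef 'a ell2 = "{f :: 'a \<Rightarrow> complex. (\<lambda>i. (cmod (f i))\<^sup>2) summable_on UNIV}"
  by (intro exI[of _ "\<lambda>_. 0"]) simp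

setup_lifting type_definition_ell2

lemma summable_square_add:
  fixes f g :: "'a \<Rightarrow> complex"
  assumes "(\<lambda>i. (cmod (f i))\<^sup>2) summable_on UNIV" "(\<lambda>i. (cmod (g i))\<^sup>2) summable_on UNIV"
  shows "(\<lambda>i. (cmod (f i + g i))\<^sup>2) summable_on UNIV"
proof (rule summable_on_comparison_test)
  show "(\<lambda>i. 2 * (cmod (f i))\<^sup>2 + 2 * (cmod (g i))\<^sup>2) summable_on UNIV"
    by (intro summable_on_add summable_on_cmult_right assms)
  fix i
  have "(cmod (f i + g i))\<^sup>2 \<le> (cmod (f i) + cmod (g i))\<^sup>2"
    by (intro power_mono norm_triangle_ineq) auto
  also have "\<dots> \<le> 2 * (cmod (f i))\<^sup>2 + 2 * (cmod (g i))\<^sup>2"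
    using sum_squares_bound[of "cmod (f i)" "cmod (g i)"] by (simp add: power2_sum)
  finally show "(cmod (f i + g i))\<^sup>2 \<le> 2 * (cmod (f i))\<^sup>2 + 2 * (cmod (g i))\<^sup>2" .
qed auto

lemma summable_square_mult:
  fixes f :: "'a \<Rightarrow> complex"
  assumes "(\<lambda>i. (cmod (f i))\<^sup>2) summable_on UNIV"
  shows "(\<lambda>i. (cmod (c * f i))\<^sup>2) summable_on UNIV"
  using summable_on_cmult_right[OF assms, of "(cmod c)\<^sup>2"] by (simp add: norm_mult power_mult_distrib)

lift_definition ell2_scale :: "complex \<Rightarrow> 'a ell2 \<Rightarrow> 'a ell2" is "\<lambda>c f i. c * f i"
  by (rule summable_square_mult)

lift_definition cinner :: "'a ell2 \<Rightarrow> 'a ell2 \<Rightarrow> complex" is "\<lambda>f g. \<Sum>\<^sub>\<infinity>i. cnj (f i) * g i" .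

instantiation ell2 :: (type) real_vector
begin
lift_definition zero_ell2 :: "'a ell2" is "\<lambda>_. 0" by simp
lift_definition plus_ell2 :: "'a ell2 \<Rightarrow> 'a ell2 \<Rightarrow> 'a ell2" is "\<lambda>f g i. f i + g i"
  by (rule summable_square_add)
lift_definition uminus_ell2 :: "'a ell2 \<Rightarrow> 'a ell2" is "\<lambda>f i. - f i" by simp
lift_definition minus_ell2 :: "'a ell2 \<Rightarrow> 'a ell2 \<Rightarrow> 'a ell2" is "\<lambda>f g i. f i - g i"
proof -
  fix f g :: "'a \<Rightarrow> complex"
  assume "(\<lambda>i. (cmod (f i))\<^sup>2) summable_on UNIV" "(\<lambda>i. (cmod (g i))\<^sup>2) summable_on UNIV"
  then show "(\<lambda>i. (cmod (f i - g i))\<^sup>2) summable_on UNIV"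
    using summable_square_add[of f "\<lambda>i. - g i"] by simp
qed
lift_definition scaleR_ell2 :: "real \<Rightarrow> 'a ell2 \<Rightarrow> 'a ell2" is "\<lambda>r f i. of_real r * f i"
  by (rule summable_square_mult)
instance by standard (transfer; auto simp: algebra_simps)+
end

lemma Rep_ell2_simps [simp]:
  "Rep_ell2 0 i = 0" "Rep_ell2 (x + y) i = Rep_ell2 x i + Rep_ell2 y i"
  "Rep_ell2 (- x) i = - Rep_ell2 x i" "Rep_ell2 (x - y) i = Rep_ell2 x i - Rep_ell2 y i"
  "Rep_ell2 (r *\<^sub>R x) i = of_real r * Rep_ell2 x i"
  "Rep_ell2 (ell2_scale c x) i = c * Rep_ell2 x i"
  by (transfer; simp)+

lemma ell2_eqI: "(\<And>i. Rep_ell2 x i = Rep_ell2 y i) \<Longrightarrow> x = y"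
  by (simp add: Rep_ell2_inject[symmetric] fun_eq_iff)

lemma square_summable: "(\<lambda>i. (cmod (Rep_ell2 x i))\<^sup>2) summable_on UNIV"
  using Rep_ell2[of x] by simp

lemma mult_le_sum_squares: "a * b \<le> a\<^sup>2 + (b::real)\<^sup>2" if "0 \<le> a" "0 \<le> b"
proof -
  have "2 * (a * b) \<le> a\<^sup>2 + b\<^sup>2"
    using sum_squares_bound[of a b] by (simp only: mult.assoc)
  moreover have "0 \<le> a * b"
    using that by simp
  ultimately show ?thesis by linarith
qed

lemma prod_summable: "(\<lambda>i. cnj (Rep_ell2 x i) * Rep_ell2 y i) summable_on UNIV"
proof -
  have "(\<lambda>i. norm (cnj (Rep_ell2 x i) * Rep_ell2 y i)) summable_on UNIV"
  proof (rule summable_on_comparison_test)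
    show "(\<lambda>i. (cmod (Rep_ell2 x i))\<^sup>2 + (cmod (Rep_ell2 y i))\<^sup>2) summable_on UNIV"
      by (rule summable_on_add[OF square_summable square_summable])
    fix i
    show "norm (cnj (Rep_ell2 x i) * Rep_ell2 y i) \<le> (cmod (Rep_ell2 x i))\<^sup>2 + (cmod (Rep_ell2 y i))\<^sup>2"
      by (simp only: norm_mult complex_mod_cnj mult_le_sum_squares norm_ge_zero)
  qed (rule norm_ge_zero)
  then show ?thesis by (rule abs_summable_summable)
qed

lemma cinner_def': "cinner x y = (\<Sum>\<^sub>\<infinity>i. cnj (Rep_ell2 x i) * Rep_ell2 y i)"
  by (rule cinner.rep_eq)

lemma cinner_add_right: "cinner x (y + z) = cinner x y + cinner x z"
  by (simp add: cinner_def' distrib_left infsum_add prod_summable)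

lemma cinner_commute: "cinner y x = cnj (cinner x y)"
  by (simp add: cinner_def' infsum_cnj[symmetric] mult.commute)

lemma cinner_add_left: "cinner (x + y) z = cinner x z + cinner y z"
  by (metis cinner_commute cinner_add_right complex_cnj_add)

lemma cinner_scale_right [simp]: "cinner x (ell2_scale c y) = c * cinner x y"
proof -
  have "cinner x (ell2_scale c y) = (\<Sum>\<^sub>\<infinity>i. c * (cnj (Rep_ell2 x i) * Rep_ell2 y i))"
    by (simp add: cinner_def' mult.left_commute)
  also have "\<dots> = c * cinner x y"
    by (simp add: cinner_def' infsum_cmult_right')
  finally show ?thesis .
qed

lemma cinner_scale_left [simp]: "cinner (ell2_scale c x) y = cnj c * cinner x y"
  by (metis cinner_commute cinner_scale_right complex_cnj_mult)

lemma scaleR_ell2_eq: "r *\<^sub>R x = ell2_scale (of_real r) x"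
  by (rule ell2_eqI) simp

lemma cinner_self: "cinner x x = of_real (\<Sum>\<^sub>\<infinity>i. (cmod (Rep_ell2 x i))\<^sup>2)"
proof -
  have "cinner x x = (\<Sum>\<^sub>\<infinity>i. of_real ((cmod (Rep_ell2 x i))\<^sup>2))"
    unfolding cinner_def' by (rule infsum_cong) (simp add: complex_norm_square mult.commute del: of_real_power)
  also have "\<dots> = of_real (\<Sum>\<^sub>\<infinity>i. (cmod (Rep_ell2 x i))\<^sup>2)"
    by (rule infsumI[OF has_sum_of_real[OF has_sum_infsum[OF square_summable]]])
  finally show ?thesis .
qed

lemma sum_square_le: "finite F \<Longrightarrow> (\<Sum>i\<in>F. (cmod (Rep_ell2 x i))\<^sup>2) \<le> (\<Sum>\<^sub>\<infinity>i. (cmod (Rep_ell2 x i))\<^sup>2)"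
  by (rule finite_sum_le_infsum[OF square_summable]) auto

lemma cinner_self_eq_0: "cinner x x = 0 \<longleftrightarrow> x = 0"
proof
  assume "cinner x x = 0"
  then have z: "(\<Sum>\<^sub>\<infinity>i. (cmod (Rep_ell2 x i))\<^sup>2) = 0"
    unfolding cinner_self by (simp only: of_real_eq_0_iff)
  show "x = 0"
  proof (rule ell2_eqI)
    fix i
    show "Rep_ell2 x i = Rep_ell2 0 i"
      using sum_square_le[of "{i}" x] z by simp
  qed
qed (simp add: cinner_def')

instantiation ell2 :: (type) real_inner
begin
definition inner_ell2 :: "'a ell2 \<Rightarrow> 'a ell2 \<Rightarrow> real" where "inner_ell2 x y = Re (cinner x y)"
definition norm_ell2 :: "'a ell2 \<Rightarrow> real" where "norm_ell2 x = sqrt (inner x x)"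
definition sgn_ell2 :: "'a ell2 \<Rightarrow> 'a ell2" where "sgn_ell2 x = x /\<^sub>R norm x"
definition dist_ell2 :: "'a ell2 \<Rightarrow> 'a ell2 \<Rightarrow> real" where "dist_ell2 x y = norm (x - y)"
definition uniformity_ell2 :: "('a ell2 \<times> 'a ell2) filter" where
  "uniformity_ell2 = (INF e\<in>{0 <..}. principal {(x, y). dist x y < e})"
definition open_ell2 :: "'a ell2 set \<Rightarrow> bool" where
  "open_ell2 U \<longleftrightarrow> (\<forall>x\<in>U. \<forall>\<^sub>F (x', y) in uniformity. x' = x \<longrightarrow> y \<in> U)"
instance
proof
  fix x y z :: "'a ell2" and r :: real
  show "inner x y = inner y x"
    unfolding inner_ell2_def by (subst cinner_commute) simp
  show "inner (x + y) z = inner x z + inner y z"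
    by (simp add: inner_ell2_def cinner_add_left)
  show "inner (r *\<^sub>R x) y = r * inner x y"
    by (simp add: inner_ell2_def scaleR_ell2_eq)
  show "0 \<le> inner x x"
    by (simp add: inner_ell2_def cinner_self infsum_nonneg)
  show "(inner x x = 0) = (x = 0)"
    using cinner_self_eq_0[of x] by (simp add: inner_ell2_def cinner_self)
qed (simp_all add: norm_ell2_def sgn_ell2_def dist_ell2_def uniformity_ell2_def open_ell2_def)
end

lemma norm_square_ell2: "(norm x)\<^sup>2 = (\<Sum>\<^sub>\<infinity>i. (cmod (Rep_ell2 x i))\<^sup>2)"
  by (simp add: power2_norm_eq_inner inner_ell2_def cinner_self)

lemma cinner_self_norm: "cinner x x = of_real ((norm x)\<^sup>2)"
  by (simp add: norm_square_ell2 cinner_self)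

lemma sum_square_le_norm: "finite F \<Longrightarrow> (\<Sum>i\<in>F. (cmod (Rep_ell2 x i))\<^sup>2) \<le> (norm x)\<^sup>2"
  by (simp add: norm_square_ell2 sum_square_le)

lemma cmod_Rep_le_norm: "cmod (Rep_ell2 x i) \<le> norm x"
  using sum_square_le_norm[of "{i}" x] by (intro power2_le_imp_le[OF _ norm_ge_zero]) simp

text \<open>A bound on the finite partial sums yields membership and norm at once; vectors given by
  explicit coordinates are constructed through this lemma.\<close>

lemma ell2_boundedI:
  assumes "\<And>F. finite F \<Longrightarrow> (\<Sum>i\<in>F. (cmod (f i))\<^sup>2) \<le> C\<^sup>2" "0 \<le> C"
  shows "Rep_ell2 (Abs_ell2 f) = f" "norm (Abs_ell2 f) \<le> C"
proof -
  have "bdd_above (sum (\<lambda>i. (cmod (f i))\<^sup>2) ` {F. F \<subseteq> UNIV \<and> finite F})"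
    using assms(1) by (intro bdd_aboveI2[of _ _ "C\<^sup>2"]) simp
  then have s: "(\<lambda>i. (cmod (f i))\<^sup>2) summable_on UNIV"
    by (intro nonneg_bdd_above_summable_on) simp_all
  then show 1: "Rep_ell2 (Abs_ell2 f) = f"
    by (simp add: Abs_ell2_inverse)
  have "(norm (Abs_ell2 f))\<^sup>2 \<le> C\<^sup>2"
    unfolding norm_square_ell2 1 by (rule infsum_le_finite_sums[OF s]) (simp add: assms(1))
  then show "norm (Abs_ell2 f) \<le> C"
    using assms(2) by (rule power2_le_imp_le)
qed

lemma norm_ell2_scale: "norm (ell2_scale c x) = cmod c * norm x"
proof -
  have "complex_of_real ((norm (ell2_scale c x))\<^sup>2) = c * cnj c * complex_of_real ((norm x)\<^sup>2)"
    unfolding cinner_self_norm[symmetric] by simp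
  also have "\<dots> = of_real ((cmod c * norm x)\<^sup>2)"
    unfolding complex_norm_square[symmetric] power_mult_distrib by (simp only: of_real_mult)
  finally have "(norm (ell2_scale c x))\<^sup>2 = (cmod c * norm x)\<^sup>2"
    by (simp only: of_real_eq_iff)
  then show ?thesis by (simp add: power2_eq_iff_nonneg)
qed

lemma cinner_bound: "cmod (cinner x y) \<le> norm x * norm y"
proof (cases "cinner x y = 0")
  case False
  \<comment> \<open>The phase \<open>c\<close> makes the complex inner product real and nonnegative,
    so that the Cauchy-Schwarz inequality for its real part suffices.\<close>
  define c where "c = cnj (cinner x y) / cmod (cinner x y)"
  have c: "cmod c = 1" using False by (simp add: c_def norm_divide)
  have "cinner x (ell2_scale c y) = of_real ((cmod (cinner x y))\<^sup>2) / of_real (cmod (cinner x y))"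
    unfolding complex_norm_square by (simp add: c_def mult.commute)
  also have "\<dots> = of_real (cmod (cinner x y))"
    by (simp add: power2_eq_square)
  finally have "cinner x (ell2_scale c y) = of_real (cmod (cinner x y))" .
  then have "cmod (cinner x y) = inner x (ell2_scale c y)"
    by (simp add: inner_ell2_def)
  also have "\<dots> \<le> norm x * norm (ell2_scale c y)"
    by (rule norm_cauchy_schwarz)
  finally show ?thesis by (simp add: norm_ell2_scale c)
qed simp

text \<open>Coordinates converge because each is bounded by the norm; the Cauchy estimate on finite
  partial sums survives the limit in the second index.\<close>

instance ell2 :: (type) banach
proof
  fix X :: "nat \<Rightarrow> 'a ell2"
  assume X: "Cauchy X"
  have co: "Cauchy (\<lambda>m. Rep_ell2 (X m) i)" for i
  proof (rule metric_CauchyI)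
    fix e :: real assume "e > 0"
    then obtain M where M: "\<And>m n. m \<ge> M \<Longrightarrow> n \<ge> M \<Longrightarrow> dist (X m) (X n) < e"
      using X unfolding Cauchy_def by meson
    show "\<exists>M. \<forall>m\<ge>M. \<forall>n\<ge>M. dist (Rep_ell2 (X m) i) (Rep_ell2 (X n) i) < e"
    proof (intro exI allI impI)
      fix m n assume "m \<ge> M" "n \<ge> M"
      then have "dist (X m) (X n) < e" by (rule M)
      then show "dist (Rep_ell2 (X m) i) (Rep_ell2 (X n) i) < e"
        using cmod_Rep_le_norm[of "X m - X n" i] by (simp add: dist_norm)
    qed
  qed
  define f where "f i = lim (\<lambda>m. Rep_ell2 (X m) i)" for i
  have lim: "(\<lambda>m. Rep_ell2 (X m) i) \<longlonglongrightarrow> f i" for i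
    using co[of i] unfolding f_def by (simp add: Cauchy_convergent_iff convergent_LIMSEQ_iff)
  have key: "\<exists>M. \<forall>m\<ge>M. Rep_ell2 (Abs_ell2 (\<lambda>i. Rep_ell2 (X m) i - f i)) = (\<lambda>i. Rep_ell2 (X m) i - f i) \<and>
      norm (Abs_ell2 (\<lambda>i. Rep_ell2 (X m) i - f i)) \<le> e" if pos: "e > 0" for e
  proof -
    obtain M where M: "\<And>m n. m \<ge> M \<Longrightarrow> n \<ge> M \<Longrightarrow> dist (X m) (X n) < e"
      using X pos unfolding Cauchy_def by meson
    have "(\<Sum>i\<in>F. (cmod (Rep_ell2 (X m) i - f i))\<^sup>2) \<le> e\<^sup>2" if "finite F" "m \<ge> M" for F m
    proof (rule tendsto_upperbound)
      show "(\<lambda>k. \<Sum>i\<in>F. (cmod (Rep_ell2 (X m) i - Rep_ell2 (X k) i))\<^sup>2) \<longlonglongrightarrow> (\<Sum>i\<in>F. (cmod (Rep_ell2 (X m) i - f i))\<^sup>2)"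
        by (intro tendsto_intros lim)
      have "(\<Sum>i\<in>F. (cmod (Rep_ell2 (X m) i - Rep_ell2 (X k) i))\<^sup>2) \<le> e\<^sup>2" if "k \<ge> M" for k
      proof -
        have "(\<Sum>i\<in>F. (cmod (Rep_ell2 (X m) i - Rep_ell2 (X k) i))\<^sup>2) \<le> (norm (X m - X k))\<^sup>2"
          using sum_square_le_norm[OF \<open>finite F\<close>, of "X m - X k"] by simp
        also have "\<dots> \<le> e\<^sup>2"
          using M[OF \<open>m \<ge> M\<close> that] by (intro power_mono) (auto simp: dist_norm)
        finally show ?thesis .
      qed
      then show "\<forall>\<^sub>F k in sequentially. (\<Sum>i\<in>F. (cmod (Rep_ell2 (X m) i - Rep_ell2 (X k) i))\<^sup>2) \<le> e\<^sup>2"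
        by (auto simp: eventually_sequentially)
    qed auto
    then show ?thesis
      using pos by (intro exI[of _ M] allI impI conjI ell2_boundedI) auto
  qed
  obtain M where M: "Rep_ell2 (Abs_ell2 (\<lambda>i. Rep_ell2 (X M) i - f i)) = (\<lambda>i. Rep_ell2 (X M) i - f i)"
    using key[of 1] by auto
  \<comment> \<open>Square-summability is known for the difference \<open>X M - f\<close>, not yet
    for \<open>f\<close>; the limit is therefore recovered by subtraction.\<close>
  define L where "L = X M - Abs_ell2 (\<lambda>i. Rep_ell2 (X M) i - f i)"
  have L: "Rep_ell2 L = f" by (auto simp: L_def M fun_eq_iff)
  have "X \<longlonglongrightarrow> L"
  proof (rule metric_LIMSEQ_I)
    fix e :: real assume "e > 0"
    obtain N where N: "\<forall>m\<ge>N. Rep_ell2 (Abs_ell2 (\<lambda>i. Rep_ell2 (X m) i - f i)) = (\<lambda>i. Rep_ell2 (X m) i - f i) \<and>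
      norm (Abs_ell2 (\<lambda>i. Rep_ell2 (X m) i - f i)) \<le> e / 2"
      using key[of "e / 2"] \<open>e > 0\<close> by auto
    have "dist (X m) L < e" if "m \<ge> N" for m
    proof -
      have "X m - L = Abs_ell2 (\<lambda>i. Rep_ell2 (X m) i - f i)"
        using N that by (intro ell2_eqI) (simp add: L)
      then show ?thesis using N[rule_format, OF that] \<open>e > 0\<close> by (simp add: dist_norm)
    qed
    then show "\<exists>no. \<forall>m\<ge>no. dist (X m) L < e" by blast
  qed
  then show "convergent X" by (auto simp: convergent_def)
qed

section \<open>Bounded operators with an adjoint\<close>

text \<open>Asking for an adjoint in the type replaces the Riesz representation theorem. The price
  is that limits have to be shown to be adjointable, see \<open>bop_complete\<close>.\<close>

typedef 'a bop = "{T :: 'a ell2 \<Rightarrow>\<^sub>L 'a ell2. \<exists>S. \<forall>x y. cinner (T x) y = cinner x (S y)}"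
  by (intro exI[of _ 0]) (auto intro!: exI[of _ "\<lambda>_. 0"] simp: cinner_def')

definition app :: "'a bop \<Rightarrow> 'a ell2 \<Rightarrow> 'a ell2" where "app A = blinfun_apply (Rep_bop A)"

lemma bop_eqI: "(\<And>x. app A x = app B x) \<Longrightarrow> A = B"
  by (simp add: app_def Rep_bop_inject[symmetric] blinfun_eqI)

lemma cinner_0 [simp]: "cinner 0 x = 0" "cinner x 0 = 0"
  by (simp_all add: cinner_def')

lemma cinner_minus_left: "cinner (- x) y = - cinner x y"
  and cinner_minus_right: "cinner x (- y) = - cinner x y"
  by (simp_all add: cinner_def' infsum_uminus)

lemma cinner_diff_left: "cinner (x - y) z = cinner x z - cinner y z"
  and cinner_diff_right: "cinner z (x - y) = cinner z x - cinner z y"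
  using cinner_add_left[of x "- y" z] cinner_add_right[of z x "- y"]
  by (simp_all add: cinner_minus_left cinner_minus_right)

lemma cinner_ext: "(\<And>z. cinner z x = cinner z y) \<Longrightarrow> x = y"
  using cinner_self_eq_0[of "x - y"] by (simp add: cinner_diff_right)

text \<open>Moving the map across the inner product shows that anything which is an adjoint is
  linear. Operators can therefore be given by bare functions together with an adjoint and a norm
  bound.\<close>

lemma adjoint_additive:
  assumes "\<And>x y. cinner (T x) y = cinner x (S y)"
  shows "S (x + y) = S x + S y" "S (ell2_scale c x) = ell2_scale c (S x)"
  by (rule cinner_ext; simp add: assms[symmetric] cinner_add_right)+

lemma bop_exists:
  assumes adj: "\<And>x y. cinner (T x) y = cinner x (S y)" and bd: "\<And>x. norm (T x) \<le> C * norm x"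
  shows "\<exists>A. app A = T"
proof -
  have adj': "cinner (S x) y = cinner x (T y)" for x y
    by (metis adj cinner_commute)
  have "bounded_linear T"
    using adjoint_additive[of S T, OF adj'] bd
    by (intro bounded_linear_intro[of T C]) (simp_all add: scaleR_ell2_eq mult.commute)
  then have "Rep_bop (Abs_bop (Blinfun T)) = Blinfun T" "blinfun_apply (Blinfun T) = T"
    using adj by (auto simp: bounded_linear_Blinfun_apply intro!: Abs_bop_inverse)
  then show ?thesis
    by (intro exI[of _ "Abs_bop (Blinfun T)"]) (simp add: app_def)
qed

definition bop_of :: "('a ell2 \<Rightarrow> 'a ell2) \<Rightarrow> 'a bop" where "bop_of T = (SOME A. app A = T)"

lemma app_bop_of:
  assumes "\<And>x y. cinner (T x) y = cinner x (S y)" "\<And>x. norm (T x) \<le> C * norm x"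
  shows "app (bop_of T) = T"
  unfolding bop_of_def by (rule someI_ex[OF bop_exists[OF assms]])

definition bnorm :: "'a bop \<Rightarrow> real" where "bnorm A = norm (Rep_bop A)"

definition adj :: "'a bop \<Rightarrow> 'a bop" where
  "adj A = bop_of (SOME S. \<forall>x y. cinner (app A x) y = cinner x (S y))"

lemma norm_app: "norm (app A x) \<le> bnorm A * norm x"
  by (simp add: app_def bnorm_def norm_blinfun)

lemma bnorm_nonneg [simp]: "0 \<le> bnorm A"
  by (simp add: bnorm_def)

lemma bnorm_le: "(\<And>x. norm (app A x) \<le> C * norm x) \<Longrightarrow> 0 \<le> C \<Longrightarrow> bnorm A \<le> C"
  unfolding bnorm_def app_def by (rule norm_blinfun_bound) auto

lemma le_mult_norm_cancel:
  assumes "(norm x)\<^sup>2 \<le> C * norm x" "0 \<le> C"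
  shows "norm (x :: 'b :: real_normed_vector) \<le> C"
  using assms by (cases "x = 0") (auto simp: power2_eq_square)

text \<open>The chosen adjoint \<open>S\<close> is itself an operator: the square of
  \<open>norm (S y)\<close> is the inner product of \<open>A (S y)\<close> and \<open>y\<close>,
  which bounds \<open>S\<close> by the norm of \<open>A\<close>.\<close>

lemma app_adj: "cinner (app A x) y = cinner x (app (adj A) y)"
proof -
  define S where "S = (SOME S. \<forall>x y. cinner (app A x) y = cinner x (S y))"
  have S: "cinner (app A x) y = cinner x (S y)" for x y
    using someI_ex[of "\<lambda>S. \<forall>x y. cinner (app A x) y = cinner x (S y)"] Rep_bop[of A]
    unfolding S_def app_def by blast
  have S': "cinner (S x) y = cinner x (app A y)" for x y
    by (metis S cinner_commute)
  have "norm (S y) \<le> bnorm A * norm y" for y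
  proof (rule le_mult_norm_cancel)
    have "(norm (S y))\<^sup>2 = cmod (cinner (app A (S y)) y)"
      unfolding S cinner_self_norm norm_of_real by simp
    also have "\<dots> \<le> norm (app A (S y)) * norm y"
      by (rule cinner_bound)
    also have "\<dots> \<le> bnorm A * norm (S y) * norm y"
      by (intro mult_right_mono norm_app) auto
    finally show "(norm (S y))\<^sup>2 \<le> bnorm A * norm y * norm (S y)"
      by (simp only: mult.assoc mult.commute[of "norm y"])
  qed auto
  then have "app (adj A) = S"
    unfolding adj_def S_def[symmetric] using S' by (intro app_bop_of) auto
  then show ?thesis by (simp add: S)
qed

lemma app_adj': "cinner (app (adj A) x) y = cinner x (app A y)"
  by (metis app_adj cinner_commute)

lemma adj_eqI: "(\<And>x y. cinner (app A x) y = cinner x (app B y)) \<Longrightarrow> adj A = B"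
  by (rule bop_eqI, rule cinner_ext) (simp add: app_adj[symmetric])

lemma app_add: "app A (x + y) = app A x + app A y"
  and app_scale: "app A (ell2_scale c x) = ell2_scale c (app A x)"
  using adjoint_additive[OF app_adj', of A] by blast+

definition csc :: "complex \<Rightarrow> 'a bop \<Rightarrow> 'a bop" (infixr "*\<^sub>C" 75) where
  "c *\<^sub>C A = bop_of (\<lambda>x. ell2_scale c (app A x))"

lemma app_csc [simp]: "app (c *\<^sub>C A) x = ell2_scale c (app A x)"
proof -
  have "norm (ell2_scale c (app A x)) \<le> cmod c * bnorm A * norm x" for x
    by (simp add: norm_ell2_scale mult.assoc mult_left_mono norm_app)
  then have "app (c *\<^sub>C A) = (\<lambda>x. ell2_scale c (app A x))"
    unfolding csc_def
    by (intro app_bop_of[where S = "\<lambda>x. ell2_scale (cnj c) (app (adj A) x)"]) (simp_all add: app_adj)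
  then show ?thesis by simp
qed

instantiation bop :: (type) ring_1
begin
definition zero_bop :: "'a bop" where "0 = bop_of (\<lambda>_. 0)"
definition one_bop :: "'a bop" where "1 = bop_of (\<lambda>x. x)"
definition plus_bop :: "'a bop \<Rightarrow> 'a bop \<Rightarrow> 'a bop" where "A + B = bop_of (\<lambda>x. app A x + app B x)"
definition uminus_bop :: "'a bop \<Rightarrow> 'a bop" where "- A = bop_of (\<lambda>x. - app A x)"
definition minus_bop :: "'a bop \<Rightarrow> 'a bop \<Rightarrow> 'a bop" where "A - B = bop_of (\<lambda>x. app A x - app B x)"
definition times_bop :: "'a bop \<Rightarrow> 'a bop \<Rightarrow> 'a bop" where "A * B = bop_of (\<lambda>x. app A (app B x))"

lemma app_0: "app 0 x = 0"
proof -
  have "app 0 = (\<lambda>_ :: 'a ell2. 0)"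
    unfolding zero_bop_def by (rule app_bop_of[where S = "\<lambda>_. 0" and C = 0]) auto
  then show ?thesis by simp
qed

lemma app_1: "app 1 x = x"
proof -
  have "app 1 = (\<lambda>x :: 'a ell2. x)"
    unfolding one_bop_def by (rule app_bop_of[where S = "\<lambda>x. x" and C = 1]) auto
  then show ?thesis by simp
qed

lemma app_plus: "app (A + B) x = app A x + app B x"
proof -
  have "norm (app A x + app B x) \<le> (bnorm A + bnorm B) * norm x" for x
    using norm_triangle_ineq[of "app A x" "app B x"] norm_app[of A x] norm_app[of B x]
    by (simp add: distrib_right)
  then have "app (A + B) = (\<lambda>x. app A x + app B x)"
    unfolding plus_bop_def
    by (intro app_bop_of[where S = "\<lambda>x. app (adj A) x + app (adj B) x"])
       (simp_all add: cinner_add_left cinner_add_right app_adj)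
  then show ?thesis by simp
qed

lemma app_uminus: "app (- A) x = - app A x"
proof -
  have "app (- A) = (\<lambda>x. - app A x)"
    unfolding uminus_bop_def
    by (rule app_bop_of[where S = "\<lambda>x. - app (adj A) x" and C = "bnorm A"])
       (simp_all add: cinner_minus_left cinner_minus_right app_adj norm_app)
  then show ?thesis by simp
qed

lemma app_minus: "app (A - B) x = app A x - app B x"
proof -
  have "app A x - app B x = app (A + - B) x" for x
    by (simp add: app_plus app_uminus)
  then have "A - B = bop_of (app (A + - B))"
    unfolding minus_bop_def by simp
  also have "app \<dots> = app (A + - B)"
    by (rule app_bop_of[OF app_adj norm_app])
  finally show ?thesis by (simp add: app_plus app_uminus)
qed

lemma app_times: "app (A * B) x = app A (app B x)"
proof -
  have "norm (app A (app B x)) \<le> (bnorm A * bnorm B) * norm x" for x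
    using order_trans[OF norm_app mult_left_mono[OF norm_app]] by (simp add: mult.assoc)
  then have "app (A * B) = (\<lambda>x. app A (app B x))"
    unfolding times_bop_def
    by (intro app_bop_of[where S = "\<lambda>x. app (adj B) (app (adj A) x)"]) (simp_all add: app_adj)
  then show ?thesis by simp
qed

instance
proof
  have "app 1 \<noteq> (app 0 :: 'a ell2 \<Rightarrow> 'a ell2)"
  proof
    assume *: "app 1 = (app 0 :: 'a ell2 \<Rightarrow> 'a ell2)"
    \<comment> \<open>\<open>undefined\<close> serves as some index of the basis, types being
      nonempty; the unit vector there tells 1 from 0.\<close>
    define f :: "'a \<Rightarrow> complex" where "f i = (if i = undefined then 1 else 0)" for i
    have "(\<Sum>i\<in>F. (cmod (f i))\<^sup>2) \<le> 1\<^sup>2" if "finite F" for F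
    proof -
      have "(\<Sum>i\<in>F. (cmod (f i))\<^sup>2) = (\<Sum>i\<in>F. if i = undefined then 1 else 0)"
        by (intro sum.cong) (auto simp: f_def)
      then show ?thesis using that by simp
    qed
    then have "Rep_ell2 (Abs_ell2 f) = f"
      by (rule ell2_boundedI[where C = 1]) simp_all
    moreover have "Abs_ell2 f = 0"
      using fun_cong[OF *, of "Abs_ell2 f"] by (simp add: app_1 app_0)
    ultimately have "f undefined = 0"
      by (metis Rep_ell2_simps(1))
    then show False by (simp add: f_def)
  qed
  then show "(0 :: 'a bop) \<noteq> 1" by metis
qed (rule bop_eqI; simp add: app_0 app_1 app_plus app_uminus app_minus app_times app_add)+
end

lemmas app_simps [simp] = app_0 app_1 app_plus app_uminus app_minus app_times

lemma bop_vector_space: "vector_space (csc :: complex \<Rightarrow> 'a bop \<Rightarrow> 'a bop)"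
  by standard (rule bop_eqI; rule ell2_eqI; simp add: algebra_simps)+

interpretation csc: vector_space "csc :: complex \<Rightarrow> 'a bop \<Rightarrow> 'a bop"
  by (rule bop_vector_space)

lemma csc_mult_left [simp]: "(c *\<^sub>C A) * B = c *\<^sub>C (A * B)"
  by (rule bop_eqI) simp

lemma csc_mult_right [simp]: "A * (c *\<^sub>C B) = c *\<^sub>C (A * B)"
  by (rule bop_eqI) (simp add: app_scale)

lemma adj_0 [simp]: "adj 0 = 0" and adj_1 [simp]: "adj 1 = 1"
  and adj_plus [simp]: "adj (A + B) = adj A + adj B"
  and adj_minus [simp]: "adj (A - B) = adj A - adj B"
  and adj_uminus [simp]: "adj (- A) = - adj A"
  and adj_times [simp]: "adj (A * B) = adj B * adj A"
  and adj_csc [simp]: "adj (c *\<^sub>C A) = cnj c *\<^sub>C adj A"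
  by (rule adj_eqI; simp add: app_adj cinner_add_left cinner_add_right cinner_diff_left
      cinner_diff_right cinner_minus_left cinner_minus_right)+

lemma adj_adj [simp]: "adj (adj A) = A"
  by (rule adj_eqI) (rule app_adj')

lemma adj_sum [simp]: "adj (\<Sum>i\<in>I. f i) = (\<Sum>i\<in>I. adj (f i))"
  by (induction I rule: infinite_finite_induct) auto

section \<open>The C*-identity and completeness\<close>

lemma norm_app_square: "complex_of_real ((norm (app A x))\<^sup>2) = cinner x (app (adj A * A) x)"
  by (simp only: cinner_self_norm[symmetric] app_adj app_times)

lemma bnorm_adj_le: "bnorm (adj A) \<le> bnorm A"
proof (rule bnorm_le[OF le_mult_norm_cancel])
  fix x
  have "(norm (app (adj A) x))\<^sup>2 = cmod (cinner x (app A (app (adj A) x)))"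
    using norm_app_square[of "adj A" x] by (metis adj_adj app_times norm_of_real abs_of_nonneg zero_le_power2)
  also have "\<dots> \<le> norm x * norm (app A (app (adj A) x))"
    by (rule cinner_bound)
  also have "\<dots> \<le> norm x * (bnorm A * norm (app (adj A) x))"
    by (intro mult_left_mono norm_app) auto
  finally show "(norm (app (adj A) x))\<^sup>2 \<le> bnorm A * norm x * norm (app (adj A) x)"
    by (simp only: mult.assoc mult.left_commute)
qed auto

lemma bnorm_adj [simp]: "bnorm (adj A) = bnorm A"
  using bnorm_adj_le[of A] bnorm_adj_le[of "adj A"] by simp

lemma bnorm_times: "bnorm (A * B) \<le> bnorm A * bnorm B"
proof (rule bnorm_le)
  fix x
  have "norm (app A (app B x)) \<le> bnorm A * (bnorm B * norm x)"
    by (rule order_trans[OF norm_app mult_left_mono[OF norm_app]]) simp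
  then show "norm (app (A * B) x) \<le> bnorm A * bnorm B * norm x"
    by (simp add: mult.assoc)
qed simp

lemma bnorm_cstar: "bnorm (adj A * A) = (bnorm A)\<^sup>2"
proof (rule antisym)
  show "bnorm (adj A * A) \<le> (bnorm A)\<^sup>2"
    using bnorm_times[of "adj A" A] by (simp add: power2_eq_square)
  have "norm (app A x) \<le> sqrt (bnorm (adj A * A)) * norm x" for x
  proof (rule power2_le_imp_le)
    have "(norm (app A x))\<^sup>2 = cmod (cinner x (app (adj A * A) x))"
      using norm_app_square[of A x] by (metis norm_of_real abs_of_nonneg zero_le_power2)
    also have "\<dots> \<le> norm x * norm (app (adj A * A) x)"
      by (rule cinner_bound)
    also have "\<dots> \<le> norm x * (bnorm (adj A * A) * norm x)"
      by (intro mult_left_mono norm_app) auto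
    finally show "(norm (app A x))\<^sup>2 \<le> (sqrt (bnorm (adj A * A)) * norm x)\<^sup>2"
      by (simp add: power_mult_distrib power2_eq_square mult_ac)
  qed simp
  then have "bnorm A \<le> sqrt (bnorm (adj A * A))"
    by (rule bnorm_le) simp
  then have "(bnorm A)\<^sup>2 \<le> (sqrt (bnorm (adj A * A)))\<^sup>2"
    by (intro power_mono) auto
  then show "(bnorm A)\<^sup>2 \<le> bnorm (adj A * A)" by simp
qed

lemma Rep_bop_simps:
  "Rep_bop (A + B) = Rep_bop A + Rep_bop B" "Rep_bop (A - B) = Rep_bop A - Rep_bop B"
  "Rep_bop 0 = 0"
  by (rule blinfun_eqI; simp add: app_def[symmetric] blinfun.add_left blinfun.diff_left)+

lemma bnorm_triangle: "bnorm (A + B) \<le> bnorm A + bnorm B"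
  by (simp add: bnorm_def Rep_bop_simps norm_triangle_ineq)

lemma bnorm_eq_0: "bnorm A = 0 \<longleftrightarrow> A = 0"
  by (simp add: bnorm_def) (metis Rep_bop_inject Rep_bop_simps(3))

lemma bnorm_csc_le: "bnorm (c *\<^sub>C A) \<le> cmod c * bnorm A"
  by (rule bnorm_le) (simp_all add: norm_ell2_scale mult.assoc mult_left_mono norm_app)

lemma bnorm_csc: "bnorm (c *\<^sub>C A) = cmod c * bnorm A"
proof (cases "c = 0")
  case False
  have "bnorm A = bnorm (inverse c *\<^sub>C c *\<^sub>C A)"
    using False by simp
  also have "\<dots> \<le> inverse (cmod c) * bnorm (c *\<^sub>C A)"
    using bnorm_csc_le[of "inverse c" "c *\<^sub>C A"] by (simp add: norm_inverse)
  finally have "cmod c * bnorm A \<le> bnorm (c *\<^sub>C A)"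
    using False by (simp add: field_simps)
  then show ?thesis using bnorm_csc_le[of c A] by simp
qed (simp add: bnorm_eq_0)

text \<open>The adjoint is isometric, so the adjoints of a Cauchy sequence converge too, and the two
  limits are adjoint to each other by continuity of the inner product.\<close>

lemma bop_complete:
  fixes X :: "nat \<Rightarrow> 'a bop"
  assumes X: "\<And>e. 0 < e \<Longrightarrow> \<exists>N. \<forall>k\<ge>N. \<forall>l\<ge>N. bnorm (X k - X l) < e"
  shows "\<exists>A. (\<lambda>k. bnorm (X k - A)) \<longlonglongrightarrow> 0"
proof -
  have "convergent (\<lambda>k. Rep_bop (Y k))"
    if "\<And>e. 0 < e \<Longrightarrow> \<exists>N. \<forall>k\<ge>N. \<forall>l\<ge>N. bnorm (Y k - Y l) < e" for Y :: "nat \<Rightarrow> 'a bop"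
    using that by (intro Cauchy_convergent) (simp add: Cauchy_def dist_norm bnorm_def Rep_bop_simps)
  moreover have "bnorm (adj (X k) - adj (X l)) = bnorm (X k - X l)" for k l
    by (simp flip: adj_minus)
  ultimately obtain T S where T: "(\<lambda>k. Rep_bop (X k)) \<longlonglongrightarrow> T" and S: "(\<lambda>k. Rep_bop (adj (X k))) \<longlonglongrightarrow> S"
    using X unfolding convergent_def by metis
  have ev: "(\<lambda>k. blinfun_apply (F k) x) \<longlonglongrightarrow> blinfun_apply G x"
    if "F \<longlonglongrightarrow> G" for F :: "nat \<Rightarrow> 'a ell2 \<Rightarrow>\<^sub>L 'a ell2" and G x
    using that by (intro blinfun.tendsto) auto
  have bl: "bounded_linear (\<lambda>x. cinner y x)" for y :: "'a ell2"
    by (rule bounded_linear_intro[where K = "norm y"])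
      (use cinner_bound[of y] in \<open>simp_all add: cinner_add_right scaleR_ell2_eq scaleR_conv_of_real mult.commute\<close>)
  have "cinner (T x) y = cinner x (S y)" for x y
  proof (rule LIMSEQ_unique)
    have "(\<lambda>k. cnj (cinner y (app (X k) x))) \<longlonglongrightarrow> cnj (cinner y (T x))"
      unfolding app_def by (intro tendsto_intros bounded_linear.tendsto[OF bl] ev T)
    then show "(\<lambda>k. cinner (app (X k) x) y) \<longlonglongrightarrow> cinner (T x) y"
      by (simp only: cinner_commute[symmetric])
    have "(\<lambda>k. cinner x (app (adj (X k)) y)) \<longlonglongrightarrow> cinner x (S y)"
      unfolding app_def by (intro bounded_linear.tendsto[OF bl] ev S)
    then show "(\<lambda>k. cinner (app (X k) x) y) \<longlonglongrightarrow> cinner x (S y)"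
      by (simp only: app_adj)
  qed
  then have "Rep_bop (Abs_bop T) = T"
    by (intro Abs_bop_inverse) auto
  then have "(\<lambda>k. bnorm (X k - Abs_bop T)) \<longlonglongrightarrow> 0"
    using tendsto_norm_zero[OF LIM_zero[OF T]] by (simp add: bnorm_def Rep_bop_simps)
  then show ?thesis by blast
qed

section \<open>Corners of the operator algebra\<close>

definition ket :: "'a \<Rightarrow> 'a ell2" where "ket k = Abs_ell2 (\<lambda>i. if i = k then 1 else 0)"

lemma Rep_ket [simp]: "Rep_ell2 (ket k) i = (if i = k then 1 else 0)"
proof -
  have "(\<Sum>i\<in>F. (cmod (if i = k then 1 else 0))\<^sup>2) \<le> 1\<^sup>2" if "finite F" for F
  proof -
    have "(\<Sum>i\<in>F. (cmod (if i = k then 1 else 0))\<^sup>2) = (\<Sum>i\<in>F. if i = k then 1 else 0)"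
      by (intro sum.cong) auto
    then show ?thesis using that by simp
  qed
  then have "Rep_ell2 (ket k) = (\<lambda>i. if i = k then 1 else 0)"
    unfolding ket_def by (rule ell2_boundedI[where C = 1]) simp_all
  then show ?thesis by simp
qed

lemma cinner_ket [simp]: "cinner (ket k) x = Rep_ell2 x k"
proof -
  have "cinner (ket k) x = (\<Sum>\<^sub>\<infinity>i\<in>{k}. Rep_ell2 x i)"
    unfolding cinner_def' by (rule infsum_cong_neutral) auto
  then show ?thesis by simp
qed

text \<open>The matrix coefficients of an operator, reindexed by \<open>from_nat\<close> so that
  operators over every countable index type land in the one universe. For a finite index type
  entries are repeated, which does not affect injectivity.\<close>

definition ent :: "'a :: countable bop \<Rightarrow> cstar_universe" where
  "ent A = (\<lambda>i j. Rep_ell2 (app A (ket (from_nat j))) (from_nat i))"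

text \<open>Equal coefficients make the adjoints agree on basis vectors, coordinate by coordinate;
  moving them back across the inner product then reaches arbitrary vectors without a density
  argument.\<close>

lemma inj_ent: "inj ent"
proof (rule injI)
  fix A B :: "'a bop"
  assume *: "ent A = ent B"
  have "Rep_ell2 (app A (ket j)) i = Rep_ell2 (app B (ket j)) i" for i j
    using fun_cong[OF fun_cong[OF *], of "to_nat i" "to_nat j"] by (simp add: ent_def)
  then have "cinner (app (adj A) (ket i)) (ket j) = cinner (app (adj B) (ket i)) (ket j)" for i j
    by (simp add: app_adj')
  then have "cinner (ket j) (app (adj A) (ket i)) = cinner (ket j) (app (adj B) (ket i))" for i j
    by (metis cinner_commute)
  then have k: "app (adj A) (ket i) = app (adj B) (ket i)" for i
    by (intro ell2_eqI) simp
  have "cinner (ket i) (app A x) = cinner (ket i) (app B x)" for i x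
    by (simp only: app_adj'[symmetric] k)
  then show "A = B"
    by (intro bop_eqI ell2_eqI) simp
qed

definition dec :: "cstar_universe \<Rightarrow> 'a :: countable bop" where "dec = inv_into UNIV ent"

lemma dec_ent [simp]: "dec (ent A) = A"
  unfolding dec_def by (rule inv_f_f[OF inj_ent])

text \<open>The corner of the operator algebra cut out by a projection, with that projection as
  unit. Operators are kept in encoded form, and every operation decodes, computes and encodes
  again.\<close>

definition corner :: "'a :: countable bop \<Rightarrow> cstar_universe cstar_alg" where
  "corner z = \<lparr>carrier = ent ` {A. z * A = A \<and> A * z = A},
     monoid.mult = (\<lambda>a b. ent (dec a * dec b :: 'a bop)), one = ent z,
     ring.zero = ent (0 :: 'a bop), add = (\<lambda>a b. ent (dec a + dec b :: 'a bop)),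
     module.smult = (\<lambda>c a. ent (c *\<^sub>C dec a :: 'a bop)),
     star = (\<lambda>a. ent (adj (dec a) :: 'a bop)), cnorm = (\<lambda>a. bnorm (dec a :: 'a bop))\<rparr>"

locale proj =
  fixes z :: "'a :: countable bop"
  assumes z_adj [simp]: "adj z = z" and z_idem [simp]: "z * z = z"
begin

definition sub :: "'a bop set" where "sub = {A. z * A = A \<and> A * z = A}"

lemma carrier_corner: "carrier (corner z) = ent ` sub"
  by (simp add: corner_def sub_def)

lemma corner_simps:
  "ent A \<otimes>\<^bsub>corner z\<^esub> ent B = ent (A * B)" "\<one>\<^bsub>corner z\<^esub> = ent z" "\<zero>\<^bsub>corner z\<^esub> = ent (0 :: 'a bop)"
  "ent A \<oplus>\<^bsub>corner z\<^esub> ent B = ent (A + B)" "c \<odot>\<^bsub>corner z\<^esub> ent A = ent (c *\<^sub>C A)"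
  "star (corner z) (ent A) = ent (adj A)" "cnorm (corner z) (ent A) = bnorm A"
  for A B :: "'a bop"
  by (simp_all add: corner_def)

lemma sub_closed:
  "0 \<in> sub" "z \<in> sub" "A \<in> sub \<Longrightarrow> B \<in> sub \<Longrightarrow> A * B \<in> sub"
  "A \<in> sub \<Longrightarrow> B \<in> sub \<Longrightarrow> A + B \<in> sub" "A \<in> sub \<Longrightarrow> c *\<^sub>C A \<in> sub" "A \<in> sub \<Longrightarrow> adj A \<in> sub"
  "A \<in> sub \<Longrightarrow> - A \<in> sub" "A \<in> sub \<Longrightarrow> B \<in> sub \<Longrightarrow> A - B \<in> sub"
proof -
  show "A * B \<in> sub" if "A \<in> sub" "B \<in> sub"
    using that by (simp add: sub_def mult.assoc) (metis mult.assoc)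
  show "adj A \<in> sub" if "A \<in> sub"
    using that by (auto simp: sub_def) (metis adj_times z_adj)+
qed (auto simp: sub_def algebra_simps)

lemma z_mult: "A \<in> sub \<Longrightarrow> z * A = A" "A \<in> sub \<Longrightarrow> A * z = A"
  by (simp_all add: sub_def)

lemma ring_corner: "ring (corner z)"
proof (rule ringI)
  show "abelian_group (corner z)"
  proof (rule abelian_groupI)
    fix x assume "x \<in> carrier (corner z)"
    then obtain A where "x = ent A" "A \<in> sub" by (auto simp: carrier_corner)
    then show "\<exists>y\<in>carrier (corner z). y \<oplus>\<^bsub>corner z\<^esub> x = \<zero>\<^bsub>corner z\<^esub>"
      by (intro bexI[of _ "ent (- A)"]) (auto simp: corner_simps carrier_corner sub_closed)
  qed (auto simp: carrier_corner corner_simps sub_closed ac_simps)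
  show "monoid (corner z)"
    by (rule monoidI) (auto simp: carrier_corner corner_simps sub_closed mult.assoc z_mult)
qed (auto simp: carrier_corner corner_simps algebra_simps)

lemma corner_minus:
  assumes "A \<in> sub" "B \<in> sub"
  shows "ent A \<ominus>\<^bsub>corner z\<^esub> ent B = ent (A - B)"
proof -
  interpret R: ring "corner z" by (rule ring_corner)
  have "\<ominus>\<^bsub>corner z\<^esub> ent B = ent (- B)"
    by (rule R.minus_equality) (use assms in \<open>auto simp: corner_simps carrier_corner sub_closed\<close>)
  then show ?thesis by (simp add: a_minus_def corner_simps)
qed

lemma sub_limit:
  assumes "\<And>k. X k \<in> sub" "(\<lambda>k. bnorm (X k - A)) \<longlonglongrightarrow> 0"
  shows "A \<in> sub"
proof -
  \<comment> \<open>A candidate \<open>B\<close> that \<open>X k\<close> approaches as fast as it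
    approaches \<open>A\<close>, up to a constant, must be \<open>A\<close>; the candidates are
    \<open>z * A\<close> and \<open>A * z\<close>.\<close>
  have *: "B = A" if "\<And>k. bnorm (X k - B) \<le> C * bnorm (X k - A)" for B C
  proof -
    have "bnorm (B - A) \<le> C * bnorm (X k - A) + bnorm (X k - A)" for k
    proof -
      have "bnorm (B - A) \<le> bnorm (- 1 *\<^sub>C (X k - B)) + bnorm (X k - A)"
        using bnorm_triangle[of "- 1 *\<^sub>C (X k - B)" "X k - A"] by (simp add: algebra_simps)
      then show ?thesis using that[of k] unfolding bnorm_csc by simp
    qed
    moreover have "(\<lambda>k. C * bnorm (X k - A) + bnorm (X k - A)) \<longlonglongrightarrow> C * 0 + 0"
      by (intro tendsto_intros assms(2))
    ultimately have "bnorm (B - A) \<le> 0"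
      by (intro LIMSEQ_le_const[of _ "C * 0 + 0", simplified]) auto
    then show ?thesis using bnorm_eq_0[of "B - A"] bnorm_nonneg[of "B - A"] by simp
  qed
  have "X k - z * A = z * (X k - A)" "X k - A * z = (X k - A) * z" for k
    using assms(1)[of k] by (simp_all add: algebra_simps z_mult)
  then have "z * A = A" "A * z = A"
    using bnorm_times[of z "X _ - A"] bnorm_times[of "X _ - A" z]
    by (intro *[of _ "bnorm z"]; simp add: mult.commute)+
  then show ?thesis by (simp add: sub_def)
qed

lemma unital_cstar_algebra_corner: "unital_cstar_algebra (corner z)"
proof -
  interpret R: ring "corner z" by (rule ring_corner)
  have m: "Module.module (class_ring :: complex ring) (corner z)"
  proof (rule Module.moduleI)
    show "cring (class_ring :: complex ring)"
      using class_field field.axioms domain.axioms by blast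
  qed (auto simp: R.is_abelian_group carrier_corner corner_simps sub_closed class_ring_simps
         csc.scale_left_distrib csc.scale_right_distrib)
  show ?thesis
  proof (intro unital_cstar_algebra.intro unital_star_algebra.intro R.ring_axioms m
      unital_star_algebra_axioms.intro unital_cstar_algebra_axioms.intro)
    fix s :: "nat \<Rightarrow> cstar_universe"
    assume s: "\<And>k. s k \<in> carrier (corner z)"
      and c: "\<And>e. 0 < e \<Longrightarrow> \<exists>N. \<forall>k\<ge>N. \<forall>l\<ge>N. cnorm (corner z) (s k \<ominus>\<^bsub>corner z\<^esub> s l) < e"
    from s have "\<forall>k. \<exists>A. s k = ent A \<and> A \<in> sub" by (auto simp: carrier_corner)
    then obtain X where X: "\<And>k. s k = ent (X k)" "\<And>k. X k \<in> sub" by metis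
    obtain A where A: "(\<lambda>k. bnorm (X k - A)) \<longlonglongrightarrow> 0"
      using bop_complete[of X] c by (auto simp: X corner_minus corner_simps)
    moreover have "A \<in> sub" by (rule sub_limit[OF X(2) A])
    ultimately show "\<exists>x\<in>carrier (corner z). (\<lambda>k. cnorm (corner z) (s k \<ominus>\<^bsub>corner z\<^esub> x)) \<longlonglongrightarrow> 0"
      by (intro bexI[of _ "ent A"]) (auto simp: X corner_minus corner_simps carrier_corner)
  qed (auto simp: carrier_corner corner_simps sub_closed bnorm_eq_0 bnorm_triangle bnorm_csc
        bnorm_times bnorm_cstar inj_eq[OF inj_ent])
qed

lemma corner_finsum:
  assumes "finite K" "\<And>k. k \<in> K \<Longrightarrow> g k = ent (f k) \<and> f k \<in> sub"
  shows "(\<Oplus>\<^bsub>corner z\<^esub>k\<in>K. g k) = ent (\<Sum>k\<in>K. f k)"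
  using assms
proof (induction K)
  case empty
  interpret R: ring "corner z" by (rule ring_corner)
  show ?case by (simp add: corner_simps)
next
  case (insert k K)
  interpret R: ring "corner z" by (rule ring_corner)
  show ?case
    using insert by (subst R.finsum_insert) (auto simp: carrier_corner corner_simps)
qed

section \<open>Matrices with entries in a corner\<close>

definition emb :: "nat \<Rightarrow> (nat \<Rightarrow> nat \<Rightarrow> 'a bop) \<Rightarrow> cstar_universe mat" where
  "emb n U = Matrix.mat n n (\<lambda>(i, j). ent (U i j))"

lemma emb_cong: "(\<And>i j. i < n \<Longrightarrow> j < n \<Longrightarrow> U i j = V i j) \<Longrightarrow> emb n U = emb n V"
  by (auto simp: emb_def intro!: eq_matI)

lemma mat_mult_emb:
  assumes "\<And>i j. i < n \<Longrightarrow> j < n \<Longrightarrow> U i j \<in> sub" "\<And>i j. i < n \<Longrightarrow> j < n \<Longrightarrow> V i j \<in> sub"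
  shows "mat_mult (corner z) n (emb n U) (emb n V) = emb n (\<lambda>i j. \<Sum>k<n. U i k * V k j)"
  unfolding mat_mult_def
proof (rule eq_matI)
  fix i j assume "i < dim_row (emb n (\<lambda>i j. \<Sum>k<n. U i k * V k j))" "j < dim_col (emb n (\<lambda>i j. \<Sum>k<n. U i k * V k j))"
  then have ij: "i < n" "j < n" by (auto simp: emb_def)
  have "(\<Oplus>\<^bsub>corner z\<^esub>k\<in>{..<n}. emb n U $$ (i, k) \<otimes>\<^bsub>corner z\<^esub> emb n V $$ (k, j)) = ent (\<Sum>k<n. U i k * V k j)"
    by (rule corner_finsum) (use ij assms in \<open>auto simp: emb_def corner_simps intro: sub_closed\<close>)
  then show "Matrix.mat n n (\<lambda>(i, j). \<Oplus>\<^bsub>corner z\<^esub>k\<in>{..<n}. emb n U $$ (i, k) \<otimes>\<^bsub>corner z\<^esub> emb n V $$ (k, j)) $$ (i, j) =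
      emb n (\<lambda>i j. \<Sum>k<n. U i k * V k j) $$ (i, j)"
    using ij by (simp add: emb_def)
qed (auto simp: emb_def)

lemma mat_star_emb: "mat_star (corner z) n (emb n U) = emb n (\<lambda>i j. adj (U j i))"
  and mat_bar_emb: "mat_bar (corner z) n (emb n U) = emb n (\<lambda>i j. adj (U i j))"
  and scalar_mat_emb: "scalar_mat (corner z) n G = emb n (\<lambda>i j. G $$ (i, j) *\<^sub>C z)"
  unfolding mat_star_def mat_bar_def scalar_mat_def
  by (rule eq_matI; simp add: emb_def corner_simps)+

lemma emb_alg_mats: "(\<And>i j. i < n \<Longrightarrow> j < n \<Longrightarrow> U i j \<in> sub) \<Longrightarrow> emb n U \<in> alg_mats (corner z) n"
  by (auto simp: alg_mats_def emb_def carrier_corner)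

text \<open>The reflection relation has content only if exactly one of \<open>i = j\<close> and
  \<open>k = l\<close> holds, and then it says that two different entries of a row or of a column
  satisfy \<open>u * adj v = 0\<close>. This is the last conjunct of \<open>fqr\<close>.\<close>

lemma weakly_quantum_equivalentI:
  assumes z0: "z \<noteq> 0"
    and P: "\<And>i j. i < n \<Longrightarrow> j < n \<Longrightarrow> P i j \<in> sub" and Q: "\<And>i j. i < n \<Longrightarrow> j < n \<Longrightarrow> Q i j \<in> sub"
    and fqr: "\<And>U. U = P \<or> U = Q \<Longrightarrow> (\<forall>i<n. \<forall>j<n.
        (\<Sum>k<n. U i k * adj (U j k)) = (if i = j then z else 0) \<and>
        (\<Sum>k<n. adj (U k i) * U k j) = (if i = j then z else 0) \<and>
        (\<Sum>k<n. adj (U i k) * U j k) = (if i = j then z else 0) \<and>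
        (\<Sum>k<n. U k i * adj (U k j)) = (if i = j then z else 0) \<and>
        (\<forall>k<n. i \<noteq> j \<longrightarrow> U i k * adj (U j k) = 0 \<and> U k i * adj (U k j) = 0))"
    and int: "\<And>i j. i < n \<Longrightarrow> j < n \<Longrightarrow> (\<Sum>k<n. H' $$ (i, k) *\<^sub>C Q k j) = (\<Sum>k<n. H $$ (k, j) *\<^sub>C P i k)"
  shows "weakly_quantum_equivalent n H H'"
proof -
  have M: "free_quantum_reflection (corner z) n (emb n U)"
    if U: "\<And>i j. i < n \<Longrightarrow> j < n \<Longrightarrow> U i j \<in> sub" "U = P \<or> U = Q" for U
  proof -
    have "1\<^sub>m n $$ (i, j) *\<^sub>C z = (if i = j then z else 0)" if "i < n" "j < n" for i j
      using that by simp
    then show ?thesis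
      using fqr[OF U(2)] U(1)
      by (auto simp: free_quantum_reflection_def unitary_mat_def emb_alg_mats mat_mult_emb mat_star_emb
          mat_bar_emb scalar_mat_emb sub_closed intro!: emb_cong)
        (auto simp: emb_def corner_simps)
  qed
  show ?thesis
    unfolding weakly_quantum_equivalent_def
  proof (intro exI conjI)
    show "unital_cstar_algebra (corner z)" by (rule unital_cstar_algebra_corner)
    show "\<one>\<^bsub>corner z\<^esub> \<noteq> \<zero>\<^bsub>corner z\<^esub>"
      using z0 by (simp add: corner_simps inj_eq[OF inj_ent])
    show "free_quantum_reflection (corner z) n (emb n P)" "free_quantum_reflection (corner z) n (emb n Q)"
      using M P Q by auto
    have "z * Q k j = Q k j" "P k j * z = P k j" if "k < n" "j < n" for k j
      using P[OF that] Q[OF that] by (auto simp: z_mult)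
    then show "mat_mult (corner z) n (scalar_mat (corner z) n H') (emb n Q) =
        mat_mult (corner z) n (emb n P) (scalar_mat (corner z) n H)"
      using P Q int
      by (auto simp: scalar_mat_emb mat_mult_emb sub_closed intro!: emb_cong)
  qed
qed

end

section \<open>From partitions of unity to a weak quantum equivalence\<close>

text \<open>Once products are nested to the right, an equation \<open>a * b = c\<close> no longer
  matches in front of a further factor, but this form does. Most computations below consist of
  \<open>mult.assoc\<close> and such instances.\<close>

lemma amul: "a * b = c \<Longrightarrow> a * (b * x) = c * (x :: 'b :: semigroup_mult)"
  by (simp flip: mult.assoc)

lemma amul3: "a * b * c = d \<Longrightarrow> a * (b * (c * x)) = d * (x :: 'b :: semigroup_mult)"
  by (simp flip: mult.assoc)

definition pou :: "nat \<Rightarrow> 'a bop \<Rightarrow> (nat \<Rightarrow> 'a bop) \<Rightarrow> bool" where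
  "pou n E a \<longleftrightarrow> (\<forall>i<n. adj (a i) = a i \<and> (\<forall>j<n. a i * a j = (if i = j then a i else 0))) \<and>
     (\<Sum>i<n. a i) = E"

text \<open>For rank-one projections on unit vectors v and w this says that the squared modulus of
  their inner product is \<open>t\<close>: with \<open>t = 1 / n\<close>, the vectors of two
  mutually unbiased bases.\<close>

definition unbiased :: "complex \<Rightarrow> 'a bop \<Rightarrow> 'a bop \<Rightarrow> bool" where
  "unbiased t x y \<longleftrightarrow> x * y * x = t *\<^sub>C x \<and> y * x * y = t *\<^sub>C y"

lemma pouD:
  assumes "pou n E a" "i < n"
  shows "adj (a i) = a i" "a i * a i = a i" "j < n \<Longrightarrow> i \<noteq> j \<Longrightarrow> a i * a j = 0" "a i * E = a i" "E * a i = a i"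
    "(\<Sum>i<n. a i) = E"
proof -
  have "a i * E = (\<Sum>j<n. if j = i then a i else 0)"
    using assms unfolding pou_def by (auto simp: sum_distrib_left intro!: sum.cong)
  then show "a i * E = a i" using assms by simp
  have "E * a i = (\<Sum>j<n. if j = i then a i else 0)"
    using assms unfolding pou_def by (auto simp: sum_distrib_right intro!: sum.cong)
  then show "E * a i = a i" using assms by simp
qed (use assms in \<open>auto simp: pou_def\<close>)

text \<open>The sandwich \<open>L a\<^sub>i b\<^sub>k W b\<^sub>m a\<^sub>j L\<^sup>*\<close> collapses whenever \<open>i = j\<close> or \<open>k = m\<close>.\<close>

locale sandwich =
  fixes n :: nat and E :: "'a bop" and a b :: "nat \<Rightarrow> 'a bop" and L Y W z :: "'a bop"
  assumes a: "pou n E a" and b: "pou n E b" and comm: "\<And>i k. i < n \<Longrightarrow> k < n \<Longrightarrow> a i * b k = b k * a i"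
    and Ya: "\<And>i. i < n \<Longrightarrow> unbiased (1 / of_nat n) (a i) Y" and Yb: "\<And>i. i < n \<Longrightarrow> unbiased (1 / of_nat n) (b i) Y"
    and Wa: "\<And>i. i < n \<Longrightarrow> unbiased (1 / of_nat n) (a i) W" and Wb: "\<And>i. i < n \<Longrightarrow> unbiased (1 / of_nat n) (b i) W"
    and L: "L * adj L = z" "L * Y = L"
begin

lemma adj_L: "Y * adj L = adj L" if "adj Y = Y"
  using L(2) that by (metis adj_times)

definition g :: "nat \<Rightarrow> nat \<Rightarrow> nat \<Rightarrow> nat \<Rightarrow> 'a bop" where
  "g i k j m = (of_nat n * of_nat n) *\<^sub>C (L * a i * b k * W * b m * a j * adj L)"

text \<open>For \<open>k = m\<close> the middle factor \<open>b k * W * b k\<close> is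
  \<open>b k\<close> divided by n, and commutation then brings \<open>a i\<close> next to
  \<open>a j\<close>. The other case is the mirror image.\<close>

lemma g_same_right:
  assumes "i < n" "j < n" "k < n"
  shows "g i k j k = (if i = j then of_nat n *\<^sub>C (L * a i * b k * adj L) else 0)"
proof -
  have n: "n > 0" using assms by simp
  have "L * a i * b k * W * b k * a j * adj L = L * a i * (b k * W * b k) * a j * adj L"
    by (simp add: mult.assoc)
  also have "\<dots> = (1 / of_nat n) *\<^sub>C (L * (a i * b k) * a j * adj L)"
    using Wb[OF assms(3)] by (simp add: unbiased_def mult.assoc)
  also have "L * (a i * b k) * a j * adj L = L * b k * (a i * a j) * adj L"
    using comm[OF assms(1,3)] by (simp add: mult.assoc)
  also have "\<dots> = (if i = j then L * (b k * a i) * adj L else 0)"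
    using pouD(2)[OF a assms(1), THEN amul] pouD(3)[OF a assms(1,2), THEN amul] by (cases "i = j") (simp_all add: mult.assoc)
  also have "\<dots> = (if i = j then L * a i * b k * adj L else 0)"
    unfolding comm[OF assms(1,3), symmetric] by (simp add: mult.assoc)
  finally show ?thesis using n by (simp add: g_def)
qed

lemma g_same_left:
  assumes "i < n" "k < n" "m < n"
  shows "g i k i m = (if k = m then of_nat n *\<^sub>C (L * a i * b k * adj L) else 0)"
proof -
  have n: "n > 0" using assms by simp
  have "L * a i * b k * W * b m * a i * adj L = L * (a i * b k) * W * (b m * a i) * adj L"
    by (simp add: mult.assoc)
  also have "\<dots> = L * b k * (a i * W * a i) * b m * adj L"
    using comm[OF assms(1,2)] comm[OF assms(1,3)] by (simp add: mult.assoc)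
  also have "\<dots> = (1 / of_nat n) *\<^sub>C (L * (b k * a i) * b m * adj L)"
    using Wa[OF assms(1)] by (simp add: unbiased_def mult.assoc)
  also have "L * (b k * a i) * b m * adj L = L * a i * (b k * b m) * adj L"
    unfolding comm[OF assms(1,2), symmetric] by (simp add: mult.assoc)
  also have "\<dots> = (if k = m then L * a i * b k * adj L else 0)"
    using pouD(2)[OF b assms(2), THEN amul] pouD(3)[OF b assms(2,3), THEN amul] by (cases "k = m") (simp_all add: mult.assoc)
  finally show ?thesis using n by (simp add: g_def)
qed

text \<open>As \<open>L\<close> absorbs \<open>Y\<close>, the factor \<open>x\<close> may be
  replaced by \<open>Y * x * Y\<close>. In the sums below one of the two partitions adds up to
  \<open>E\<close>, which leaves a single \<open>a i\<close> or \<open>b k\<close> as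
  \<open>x\<close>.\<close>

lemma LaL:
  assumes "adj Y = Y" "Y * x * Y = (1 / of_nat n) *\<^sub>C Y" "n > 0"
  shows "of_nat n *\<^sub>C (L * x * adj L) = z"
proof -
  have "L * x * adj L = L * (Y * x * Y) * adj L"
    using L adj_L[OF assms(1)] by (metis mult.assoc)
  also have "\<dots> = (1 / of_nat n) *\<^sub>C (L * (Y * adj L))"
    using assms(2) by (simp add: mult.assoc)
  also have "L * (Y * adj L) = z"
    using L by (simp flip: mult.assoc)
  finally show ?thesis using assms(3) by simp
qed

lemma sum_right:
  assumes "adj Y = Y" "i < n" "j < n"
  shows "(\<Sum>k<n. g i k j k) = (if i = j then z else 0)"
proof -
  have "(\<Sum>k<n. of_nat n *\<^sub>C (L * a i * b k * adj L)) = of_nat n *\<^sub>C (L * (a i * (\<Sum>k<n. b k)) * adj L)"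
    by (simp add: sum_distrib_left sum_distrib_right csc.scale_sum_right mult.assoc)
  also have "\<dots> = z"
    using pouD(4)[OF a assms(2)] pouD(6)[OF b assms(2)] Ya[OF assms(2)] LaL[OF assms(1), of "a i"] assms
    by (simp add: unbiased_def)
  finally show ?thesis using assms by (cases "i = j") (simp_all add: g_same_right)
qed

lemma sum_left:
  assumes "adj Y = Y" "k < n" "m < n"
  shows "(\<Sum>i<n. g i k i m) = (if k = m then z else 0)"
proof -
  have "(\<Sum>i<n. of_nat n *\<^sub>C (L * a i * b k * adj L)) = of_nat n *\<^sub>C (L * ((\<Sum>i<n. a i) * b k) * adj L)"
    by (simp add: sum_distrib_left sum_distrib_right csc.scale_sum_right mult.assoc)
  also have "\<dots> = z"
    using pouD(5)[OF b assms(2)] pouD(6)[OF a assms(2)] Yb[OF assms(2)] LaL[OF assms(1), of "b k"] assms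
    by (simp add: unbiased_def)
  finally show ?thesis using assms by (cases "k = m") (simp_all add: g_same_left)
qed

end

definition fqr :: "nat \<Rightarrow> 'a bop \<Rightarrow> (nat \<Rightarrow> nat \<Rightarrow> 'a bop) \<Rightarrow> bool" where
  "fqr n z U \<longleftrightarrow> (\<forall>i<n. \<forall>j<n.
        (\<Sum>k<n. U i k * adj (U j k)) = (if i = j then z else 0) \<and>
        (\<Sum>k<n. adj (U k i) * U k j) = (if i = j then z else 0) \<and>
        (\<Sum>k<n. adj (U i k) * U j k) = (if i = j then z else 0) \<and>
        (\<Sum>k<n. U k i * adj (U k j)) = (if i = j then z else 0) \<and>
        (\<forall>k<n. i \<noteq> j \<longrightarrow> U i k * adj (U j k) = 0 \<and> U k i * adj (U k j) = 0))"

lemma fqr_sandwich: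
  fixes \<alpha> \<beta> :: "nat \<Rightarrow> complex"
  assumes a: "pou n E a" and b: "pou n E b" and comm: "\<And>i k. i < n \<Longrightarrow> k < n \<Longrightarrow> a i * b k = b k * a i"
    and Ya: "\<And>i. i < n \<Longrightarrow> unbiased (1 / of_nat n) (a i) Y" and Yb: "\<And>i. i < n \<Longrightarrow> unbiased (1 / of_nat n) (b i) Y"
    and Wa: "\<And>i. i < n \<Longrightarrow> unbiased (1 / of_nat n) (a i) W" and Wb: "\<And>i. i < n \<Longrightarrow> unbiased (1 / of_nat n) (b i) W"
    and Y: "adj Y = Y" and W: "adj W = W"
    and L: "L * adj L = z" "adj L * L = Y" "L * Y = L"
    and R: "R * adj R = W" "adj R * R = z" "W * R = R"
    and \<alpha>: "\<And>i. i < n \<Longrightarrow> cmod (\<alpha> i) = 1" and \<beta>: "\<And>i. i < n \<Longrightarrow> cmod (\<beta> i) = 1"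
  shows "fqr n z (\<lambda>i k. (\<alpha> i * \<beta> k * of_nat n) *\<^sub>C (L * a i * b k * R))"
proof -
  interpret l: sandwich n E a b L Y W z by unfold_locales fact+
  have R': "adj R * W = adj R" using R(3) W by (metis adj_times)
  \<comment> \<open>Products with the adjoint on the left are sandwiches as well:
    \<open>adj R\<close> takes the place of \<open>L\<close>, \<open>Y\<close> and \<open>W\<close>
    are exchanged, and the partitions appear in the opposite order.\<close>
  interpret r: sandwich n E b a "adj R" W Y z
    by unfold_locales (use assms R' in \<open>simp_all\<close>)
  have un: "\<alpha> i * cnj (\<alpha> i) = 1" "\<beta> i * cnj (\<beta> i) = 1" if "i < n" for i
    using \<alpha>[OF that] \<beta>[OF that] by (simp_all add: complex_norm_square[symmetric])
  let ?U = "\<lambda>i k. (\<alpha> i * \<beta> k * of_nat n) *\<^sub>C (L * a i * b k * R)"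
  have UU: "?U i k * adj (?U j m) = (\<alpha> i * \<beta> k * cnj (\<alpha> j) * cnj (\<beta> m)) *\<^sub>C l.g i k j m"
    if "i < n" "j < n" "k < n" "m < n" for i j k m
  proof -
    have "(L * a i * b k * R) * adj (L * a j * b m * R) = L * a i * b k * (R * adj R) * b m * a j * adj L"
      using that pouD(1)[OF a] pouD(1)[OF b] by (simp add: mult.assoc)
    then show ?thesis by (simp add: l.g_def R mult_ac)
  qed
  have UU': "adj (?U j m) * ?U i k = (\<alpha> i * \<beta> k * cnj (\<alpha> j) * cnj (\<beta> m)) *\<^sub>C r.g m j k i"
    if "i < n" "j < n" "k < n" "m < n" for i j k m
  proof -
    have "adj (L * a j * b m * R) * (L * a i * b k * R) = adj R * b m * a j * (adj L * L) * (a i * b k) * R"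
      using that pouD(1)[OF a] pouD(1)[OF b] by (simp add: mult.assoc)
    also have "\<dots> = adj R * b m * a j * Y * a i * b k * R"
      by (simp add: L mult.assoc)
    finally show ?thesis by (simp add: r.g_def mult_ac)
  qed
  show ?thesis
    unfolding fqr_def
  proof (intro allI impI conjI)
    fix i j assume ij: "i < n" "j < n"
    have "(\<Sum>k<n. ?U i k * adj (?U j k)) = (\<Sum>k<n. (\<alpha> i * cnj (\<alpha> j)) *\<^sub>C l.g i k j k)"
      using ij un by (intro sum.cong refl, subst UU) (simp_all add: mult_ac)
    then show "(\<Sum>k<n. ?U i k * adj (?U j k)) = (if i = j then z else 0)"
      using ij un by (simp add: csc.scale_sum_right[symmetric] l.sum_right[OF Y])
    have "(\<Sum>k<n. ?U k i * adj (?U k j)) = (\<Sum>k<n. (\<beta> i * cnj (\<beta> j)) *\<^sub>C l.g k i k j)"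
      using ij un by (intro sum.cong refl, subst UU) (simp_all add: mult_ac)
    then show "(\<Sum>k<n. ?U k i * adj (?U k j)) = (if i = j then z else 0)"
      using ij un by (simp add: csc.scale_sum_right[symmetric] l.sum_left[OF Y])
    have "(\<Sum>k<n. adj (?U k i) * ?U k j) = (\<Sum>k<n. (\<beta> j * cnj (\<beta> i)) *\<^sub>C r.g i k j k)"
      using ij un by (intro sum.cong refl, subst UU') (simp_all add: mult_ac)
    then show "(\<Sum>k<n. adj (?U k i) * ?U k j) = (if i = j then z else 0)"
      using ij un by (simp add: csc.scale_sum_right[symmetric] r.sum_right[OF W])
    have "(\<Sum>k<n. adj (?U i k) * ?U j k) = (\<Sum>k<n. (\<alpha> j * cnj (\<alpha> i)) *\<^sub>C r.g k i k j)"
      using ij un by (intro sum.cong refl, subst UU') (simp_all add: mult_ac)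
    then show "(\<Sum>k<n. adj (?U i k) * ?U j k) = (if i = j then z else 0)"
      using ij un by (simp add: csc.scale_sum_right[symmetric] r.sum_left[OF W])
    fix k assume k: "k < n" and "i \<noteq> j"
    then show "?U i k * adj (?U j k) = 0" "?U k i * adj (?U k j) = 0"
      using ij by (simp_all only: UU l.g_same_right l.g_same_left) simp_all
  qed
qed

text \<open>Functions of two indices instead of matrices, so that conjugate and transposed Hadamard
  matrices are mere lambda terms.\<close>

definition hmat :: "nat \<Rightarrow> (nat \<Rightarrow> nat \<Rightarrow> complex) \<Rightarrow> bool" where
  "hmat n h \<longleftrightarrow> (\<forall>i<n. \<forall>j<n. cmod (h i j) = 1) \<and>
     (\<forall>i<n. \<forall>j<n. (\<Sum>k<n. h i k * cnj (h j k)) = (if i = j then of_nat n else 0)) \<and>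
     (\<forall>i<n. \<forall>j<n. (\<Sum>k<n. h k i * cnj (h k j)) = (if i = j then of_nat n else 0))"

lemma hmatD:
  assumes "hmat n h" "i < n" "j < n"
  shows "cmod (h i j) = 1" "h i j * cnj (h i j) = 1" "cnj (h i j) * h i j = 1"
    "(\<Sum>k<n. h i k * cnj (h j k)) = (if i = j then of_nat n else 0)"
    "(\<Sum>k<n. h k i * cnj (h k j)) = (if i = j then of_nat n else 0)"
proof -
  show 1: "cmod (h i j) = 1" using assms by (simp add: hmat_def)
  then show "h i j * cnj (h i j) = 1" "cnj (h i j) * h i j = 1"
    by (simp_all add: complex_norm_square[symmetric] mult.commute[of "cnj _"])
qed (use assms in \<open>auto simp: hmat_def\<close>)

lemma hadamard_hmat:
  assumes "hadamard n H"
  shows "hmat n (\<lambda>i j. H $$ (i, j))"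
proof -
  have H: "H \<in> carrier_mat n n" "H * mat_adjoint H = of_nat n \<cdot>\<^sub>m 1\<^sub>m n" "mat_adjoint H * H = of_nat n \<cdot>\<^sub>m 1\<^sub>m n"
    using assms by (auto simp: hadamard_def)
  have ad: "mat_adjoint H $$ (i, j) = cnj (H $$ (j, i))" if "i < n" "j < n" for i j
    using H(1) that by (simp add: mat_adjoint_def mat_of_rows_def)
  have dim: "dim_row (mat_adjoint H) = n" "dim_col (mat_adjoint H) = n"
    using H(1) by (auto simp: mat_adjoint_def)
  have "(\<Sum>k<n. H $$ (i, k) * cnj (H $$ (j, k))) = (if i = j then of_nat n else 0)" if "i < n" "j < n" for i j
  proof -
    have "(H * mat_adjoint H) $$ (i, j) = (\<Sum>k<n. H $$ (i, k) * cnj (H $$ (j, k)))"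
      using that H(1) dim by (simp add: scalar_prod_def ad lessThan_atLeast0)
    then show ?thesis using that H by (cases "i = j") simp_all
  qed
  moreover have "(\<Sum>k<n. H $$ (k, i) * cnj (H $$ (k, j))) = (if i = j then of_nat n else 0)" if "i < n" "j < n" for i j
  proof -
    have "(mat_adjoint H * H) $$ (j, i) = (\<Sum>k<n. H $$ (k, i) * cnj (H $$ (k, j)))"
      using that H(1) dim by (simp add: scalar_prod_def ad lessThan_atLeast0 mult.commute)
    then show ?thesis using that H by (cases "i = j") simp_all
  qed
  ultimately show ?thesis using assms by (auto simp: hmat_def hadamard_def)
qed

lemma csc_of_nat: "of_nat m *\<^sub>C A = of_nat m * A"
  by (induction m) (simp_all add: csc.scale_left_distrib distrib_right)

lemma unbiased_sym: "unbiased t x y \<Longrightarrow> unbiased t y x"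
  by (simp add: unbiased_def)

text \<open>A unitary of the corner \<open>E\<close> that commutes with \<open>x\<close> conjugates
  \<open>y\<close> alone and can be cancelled around \<open>x\<close>.\<close>

lemma unbiased_conj:
  assumes "unbiased t x y" "x * u = u * x" "u * adj u = E" "adj u * u = E" "x * E = x" "E * y = y"
    "y * E = y" "adj x = x"
  shows "unbiased t x (u * y * adj u)"
proof -
  have xu: "x * adj u = adj u * x"
    using arg_cong[OF assms(2), of adj] assms(8) by simp
  have "x * (u * y * adj u) * x = u * (x * y * x) * adj u"
    by (simp add: mult.assoc assms(2)[THEN amul] xu)
  also have "\<dots> = t *\<^sub>C (u * x * adj u)"
    using assms(1) by (simp add: unbiased_def)
  also have "u * x * adj u = x * (u * adj u)"
    by (simp add: mult.assoc assms(2)[symmetric, THEN amul])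
  finally have 1: "x * (u * y * adj u) * x = t *\<^sub>C x"
    by (simp add: assms)
  have "(u * y * adj u) * x * (u * y * adj u) = u * y * (adj u * u) * x * y * adj u"
    by (simp add: mult.assoc xu[symmetric, THEN amul] assms(2)[THEN amul])
  also have "\<dots> = u * (y * x * y) * adj u"
    by (simp add: mult.assoc assms(4)) (simp flip: mult.assoc add: assms(7))
  finally show ?thesis
    using assms(1) 1 by (simp add: unbiased_def)
qed

text \<open>The model case: \<open>e k\<close> are the diagonal matrix units on an n-dimensional
  space, \<open>Y\<close> is the projection onto the all-ones vector and \<open>f l\<close> the
  projection onto the conjugate of row l of \<open>h\<close>.\<close>

locale hpair =
  fixes n :: nat and h :: "nat \<Rightarrow> nat \<Rightarrow> complex" and E :: "'a bop" and e f :: "nat \<Rightarrow> 'a bop" and Y :: "'a bop"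
  assumes n: "n > 0" and h: "hmat n h" and e: "pou n E e" and f: "pou n E f"
    and conj: "\<And>l. l < n \<Longrightarrow> (\<Sum>k<n. h l k *\<^sub>C e k) * f l * adj (\<Sum>k<n. h l k *\<^sub>C e k) = Y"
begin

definition u :: "nat \<Rightarrow> 'a bop" where "u l = (\<Sum>k<n. h l k *\<^sub>C e k)"

lemma u_e:
  assumes "k < n"
  shows "u l * e k = h l k *\<^sub>C e k" "e k * u l = h l k *\<^sub>C e k"
    "adj (u l) * e k = cnj (h l k) *\<^sub>C e k" "e k * adj (u l) = cnj (h l k) *\<^sub>C e k"
proof -
  have "u l * e k = (\<Sum>m<n. if m = k then h l k *\<^sub>C e k else 0)"
    unfolding u_def sum_distrib_right using pouD(2,3)[OF e] assms by (intro sum.cong) auto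
  then show 1: "u l * e k = h l k *\<^sub>C e k" using assms by simp
  have "e k * u l = (\<Sum>m<n. if m = k then h l k *\<^sub>C e k else 0)"
    unfolding u_def sum_distrib_left using pouD(2,3)[OF e assms] assms by (intro sum.cong) auto
  then show 2: "e k * u l = h l k *\<^sub>C e k" using assms by simp
  show "adj (u l) * e k = cnj (h l k) *\<^sub>C e k" "e k * adj (u l) = cnj (h l k) *\<^sub>C e k"
    using arg_cong[OF 2, of adj] arg_cong[OF 1, of adj] pouD(1)[OF e assms] by simp_all
qed

lemma u_adj_u: "u l * adj (u r) = (\<Sum>k<n. (h l k * cnj (h r k)) *\<^sub>C e k)"
proof -
  have "u l * adj (u r) = (\<Sum>k<n. u l * (cnj (h r k) *\<^sub>C e k))"
    using pouD(1)[OF e] unfolding u_def[of r] by (simp add: sum_distrib_left)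
  also have "\<dots> = (\<Sum>k<n. (h l k * cnj (h r k)) *\<^sub>C e k)"
    by (intro sum.cong) (simp_all add: u_e mult.commute)
  finally show ?thesis .
qed

lemma u_unitary: "l < n \<Longrightarrow> u l * adj (u l) = E" "l < n \<Longrightarrow> adj (u l) * u l = E"
proof -
  assume l: "l < n"
  show "u l * adj (u l) = E"
    using l pouD(6)[OF e n] hmatD(2)[OF h] by (simp add: u_adj_u)
  have "adj (u l) * u l = (\<Sum>k<n. adj (u l) * (h l k *\<^sub>C e k))"
    unfolding u_def[of l] by (simp add: sum_distrib_left)
  also have "\<dots> = (\<Sum>k<n. e k)"
    using l hmatD(2)[OF h] by (intro sum.cong) (simp_all add: u_e)
  finally show "adj (u l) * u l = E" using pouD(6)[OF e n] by simp
qed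

lemma E: "adj E = E" "E * E = E"
proof -
  show "adj E = E"
    using u_unitary(1)[OF n] by (metis adj_times adj_adj)
  have "E * E = (\<Sum>k<n. e k * E)"
    using pouD(6)[OF e n] by (metis sum_distrib_right)
  then show "E * E = E"
    using pouD(4)[OF e] pouD(6)[OF e n] by simp
qed

lemma u_E: "l < n \<Longrightarrow> u l * E = u l" "l < n \<Longrightarrow> E * adj (u l) = adj (u l)" "l < n \<Longrightarrow> E * u l = u l"
    "l < n \<Longrightarrow> adj (u l) * E = adj (u l)"
proof -
  show 1: "u l * E = u l" "E * u l = u l"
    using pouD(4,5)[OF e] unfolding u_def by (simp_all add: sum_distrib_right sum_distrib_left)
  show "E * adj (u l) = adj (u l)" "adj (u l) * E = adj (u l)"
    using arg_cong[OF 1(1), of adj] arg_cong[OF 1(2), of adj] by (simp_all add: E)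
qed

lemma Y: "l < n \<Longrightarrow> Y = u l * f l * adj (u l)"
  using conj by (simp add: u_def)

lemma Y_proj: "adj Y = Y" "Y * Y = Y" "Y * E = Y" "E * Y = Y"
proof -
  note [simp] = u_unitary[OF n] u_E[OF n] pouD[OF f n] u_unitary[OF n, THEN amul] u_E[OF n, THEN amul]
    pouD(2,4,5)[OF f n, THEN amul]
  show "adj Y = Y" "Y * Y = Y" "Y * E = Y" "E * Y = Y"
    unfolding Y[OF n] by (simp_all add: mult.assoc)
qed

lemma u_Y:
  assumes "l < n"
  shows "u l * f l = Y * u l" "f l * adj (u l) = adj (u l) * Y" "f l = adj (u l) * Y * u l"
proof -
  note [simp] = u_unitary[OF assms] u_unitary[OF assms, THEN amul] pouD(4,5)[OF f assms] pouD(5)[OF f assms, THEN amul]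
  show "u l * f l = Y * u l" "f l * adj (u l) = adj (u l) * Y" "f l = adj (u l) * Y * u l"
    unfolding Y[OF assms] by (simp_all add: mult.assoc)
qed

lemma e_f_e:
  assumes "k < n" "l < n"
  shows "e k * f l * e k = e k * Y * e k"
proof -
  have "e k * f l * e k = (e k * adj (u l)) * Y * (u l * e k)"
    using u_Y(3)[OF assms(2)] by (simp add: mult.assoc)
  then show ?thesis
    using assms hmatD(2,3)[OF h assms(2,1)] by (simp add: u_e)
qed

text \<open>The compression \<open>e k * f l * e k\<close> does not depend on \<open>l\<close>,
  since \<open>u l\<close> acts on \<open>e k\<close> by a phase; summing over \<open>l\<close>
  gives the first relation. The second one comes from the orthogonality of the \<open>f l\<close>
  and the invertibility of \<open>h\<close>.\<close>

lemma unbiased_e_Y: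
  assumes "k < n"
  shows "unbiased (1 / of_nat n) (e k) Y"
proof -
  have "of_nat n *\<^sub>C (e k * Y * e k) = (\<Sum>l<n. e k * f l * e k)"
    using assms by (simp add: e_f_e csc_of_nat)
  also have "\<dots> = e k * E * e k"
    unfolding pouD(6)[OF f n, symmetric] by (simp add: sum_distrib_left sum_distrib_right)
  also have "\<dots> = e k"
    using assms pouD[OF e assms] by simp
  finally have 1: "of_nat n *\<^sub>C (e k * Y * e k) = e k" .
  \<comment> \<open>Orthogonality of \<open>f l\<close> and \<open>f r\<close>, conjugated into
    \<open>Y\<close>: a system of linear equations for the compressions
    \<open>Y * e m * Y\<close>.\<close>
  have d: "(\<Sum>m<n. (h l m * cnj (h r m)) *\<^sub>C (Y * e m * Y)) = (if l = r then Y else 0)" if "l < n" "r < n" for l r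
  proof -
    have "(\<Sum>m<n. (h l m * cnj (h r m)) *\<^sub>C (Y * e m * Y)) = Y * (u l * adj (u r)) * Y"
      by (simp add: u_adj_u sum_distrib_left sum_distrib_right)
    also have "\<dots> = u l * (f l * f r) * adj (u r)"
      using u_Y[OF that(1)] u_Y[OF that(2)] by (simp add: mult.assoc) (simp flip: mult.assoc)
    also have "\<dots> = (if l = r then Y else 0)"
      using pouD(2,3)[OF f that(1)] that Y[OF that(1)] by (cases "l = r") simp_all
    finally show ?thesis .
  qed
  \<comment> \<open>The system for \<open>r = 0\<close> is solved by Fourier inversion: column
    orthogonality of \<open>h\<close> isolates \<open>m = k\<close>, and only \<open>l = 0\<close>
    has a nonzero right-hand side.\<close>
  have "of_nat n *\<^sub>C (Y * e k * Y) = (\<Sum>m<n. (\<Sum>l<n. h l m * cnj (h l k)) *\<^sub>C ((h 0 k * cnj (h 0 m)) *\<^sub>C (Y * e m * Y)))"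
  proof -
    have "(\<Sum>m<n. (\<Sum>l<n. h l m * cnj (h l k)) *\<^sub>C ((h 0 k * cnj (h 0 m)) *\<^sub>C (Y * e m * Y))) =
        (\<Sum>m<n. if m = k then of_nat n *\<^sub>C (Y * e k * Y) else 0)"
      using assms hmatD(2,5)[OF h] n by (intro sum.cong) auto
    then show ?thesis using assms by simp
  qed
  also have "\<dots> = (\<Sum>m<n. \<Sum>l<n. (cnj (h l k) * h 0 k) *\<^sub>C ((h l m * cnj (h 0 m)) *\<^sub>C (Y * e m * Y)))"
    by (intro sum.cong refl) (simp add: csc.scale_sum_left[symmetric] sum_distrib_left mult_ac)
  also have "\<dots> = (\<Sum>l<n. (cnj (h l k) * h 0 k) *\<^sub>C (\<Sum>m<n. (h l m * cnj (h 0 m)) *\<^sub>C (Y * e m * Y)))"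
    unfolding csc.scale_sum_right by (rule sum.swap)
  also have "\<dots> = (\<Sum>l<n. if l = 0 then (cnj (h 0 k) * h 0 k) *\<^sub>C Y else 0)"
    by (intro sum.cong) (auto simp: d n)
  also have "\<dots> = Y"
    using hmatD(3)[OF h n assms] n by simp
  finally have 2: "of_nat n *\<^sub>C (Y * e k * Y) = Y" .
  have "x = (1 / of_nat n) *\<^sub>C (of_nat n *\<^sub>C x)" for x :: "'a bop"
    using n by simp
  then show ?thesis
    unfolding unbiased_def using 1 2 by metis
qed

lemma unbiased_e_f:
  assumes "k < n" "l < n"
  shows "unbiased (1 / of_nat n) (e k) (f l)"
proof -
  have c: "e k * adj (u l) = adj (u l) * e k"
    by (simp add: u_e assms)
  have "unbiased (1 / of_nat n) (e k) (adj (u l) * Y * adj (adj (u l)))"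
    by (rule unbiased_conj[OF unbiased_e_Y[OF assms(1)] c, where E = E])
       (simp_all add: u_unitary assms Y_proj pouD(1,4)[OF e assms(1)])
  then show ?thesis using u_Y(3)[OF assms(2)] by simp
qed

text \<open>\<open>f l\<close> is \<open>Y\<close> conjugated by \<open>u l\<close>, and
  \<open>u l\<close> is a scalar on \<open>e k\<close>, so \<open>Y * e k * Y\<close> appears and
  reduces to a multiple of \<open>Y\<close>. With \<open>k = 0\<close> this converts between the two
  descriptions of the matrix \<open>P\<close> below.\<close>

lemma Y_e_f:
  assumes "l < n" "k < n"
  shows "Y * e k * f l = (cnj (h l k) / of_nat n) *\<^sub>C (Y * u l)" "f l * e k * Y = (h l k / of_nat n) *\<^sub>C (adj (u l) * Y)"
proof -
  have "Y * e k * f l = Y * (e k * adj (u l)) * Y * u l"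
    using u_Y(3)[OF assms(1)] by (simp add: mult.assoc)
  also have "\<dots> = cnj (h l k) *\<^sub>C (Y * e k * Y * u l)"
    by (simp add: u_e assms)
  finally show 1: "Y * e k * f l = (cnj (h l k) / of_nat n) *\<^sub>C (Y * u l)"
    using unbiased_e_Y[OF assms(2)] by (simp add: unbiased_def)
  show "f l * e k * Y = (h l k / of_nat n) *\<^sub>C (adj (u l) * Y)"
    using arg_cong[OF 1, of adj] by (simp add: pouD(1)[OF e] pouD(1)[OF f] assms Y_proj mult.assoc)
qed

end

lemma weakly_quantum_equivalent_of_families:
  fixes e f e' f' :: "nat \<Rightarrow> 'a :: countable bop"
  assumes H: "hpair n (\<lambda>i j. H $$ (i, j)) E e f W" and H': "hpair n (\<lambda>i j. H' $$ (i, j)) E e' f' Y"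
    and ee': "\<And>i k. i < n \<Longrightarrow> k < n \<Longrightarrow> e' i * e k = e k * e' i"
    and ff': "\<And>i k. i < n \<Longrightarrow> k < n \<Longrightarrow> f' i * f k = f k * f' i"
    and ef': "\<And>i k. i < n \<Longrightarrow> k < n \<Longrightarrow> unbiased (1 / of_nat n) (e k) (f' i)"
    and e'f: "\<And>i k. i < n \<Longrightarrow> k < n \<Longrightarrow> unbiased (1 / of_nat n) (e' i) (f k)"
    and nz: "e 0 \<noteq> 0"
  shows "weakly_quantum_equivalent n H H'"
proof -
  interpret A: hpair n "\<lambda>i j. H $$ (i, j)" E e f W by fact
  interpret B: hpair n "\<lambda>i j. H' $$ (i, j)" E e' f' Y by fact
  note n = A.n
  define z where "z = e 0"
  have z: "adj z = z" "z * z = z" "z * E = z" "E * z = z"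
    using pouD[OF A.e n] by (simp_all add: z_def)
  interpret proj z by standard (use z in simp_all)
  have Bu: "e k * B.u j = B.u j * e k" if "k < n" for k j
    unfolding B.u_def sum_distrib_left sum_distrib_right using ee' that by (intro sum.cong) simp_all
  have Au: "e' k * A.u j = A.u j * e' k" if "k < n" for k j
    unfolding A.u_def sum_distrib_left sum_distrib_right using ee' that by (intro sum.cong) simp_all
  \<comment> \<open>All \<open>e k\<close> commute with the unitaries made of the \<open>e'\<close>,
    so their unbiasedness to \<open>f'\<close> passes to the conjugate \<open>Y\<close>. The fact
    for \<open>e'\<close> and \<open>W\<close> is symmetric.\<close>
  have eY: "unbiased (1 / of_nat n) (e k) Y" if "k < n" for k
    unfolding B.Y[OF n] using that n
    by (intro unbiased_conj[OF ef' Bu, where E = E]) (simp_all add: B.u_unitary pouD[OF A.e] pouD[OF B.f])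
  have e'W: "unbiased (1 / of_nat n) (e' k) W" if "k < n" for k
    unfolding A.Y[OF n] using that n
    by (intro unbiased_conj[OF e'f Au, where E = E]) (simp_all add: A.u_unitary pouD[OF B.e] pouD[OF A.f])
  \<comment> \<open>Because \<open>z\<close> and \<open>Y\<close> are unbiased, the square root of n
    times \<open>z * Y\<close> is a partial isometry from the range of \<open>Y\<close> onto that of
    \<open>z\<close>; likewise \<open>W * z\<close> on the other side.\<close>
  let ?s = "complex_of_real (sqrt (real n))"
  have s: "?s * ?s = of_nat n" "cnj ?s = ?s"
    by (simp_all flip: of_real_mult)
  define Q where "Q i k = (1 * 1 * of_nat n) *\<^sub>C ((?s *\<^sub>C (z * Y)) * e' i * e k * (?s *\<^sub>C (W * z)))" for i k
  \<comment> \<open>The phases from column 0 cancel those produced by inserting \<open>e' 0\<close>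
    and \<open>e 0\<close>. The insertion makes the outer factors partial isometries between
    \<open>e' 0\<close> or \<open>e 0\<close> and \<open>z\<close>, as the sandwich
    requires.\<close>
  define P where "P j l = (H' $$ (j, 0) * cnj (H $$ (l, 0)) * of_nat n) *\<^sub>C
      ((of_nat n *\<^sub>C (z * Y * e' 0)) * f' j * f l * (of_nat n *\<^sub>C (e 0 * W * z)))" for j l
  have zY: "z * Y * z = (1 / of_nat n) *\<^sub>C z" "Y * z * Y = (1 / of_nat n) *\<^sub>C Y"
    using eY[OF n] by (simp_all add: z_def unbiased_def)
  have zW: "z * W * z = (1 / of_nat n) *\<^sub>C z" "W * z * W = (1 / of_nat n) *\<^sub>C W"
    using A.unbiased_e_Y[OF n] by (simp_all add: z_def unbiased_def)
  have e'Y: "e' 0 * Y * e' 0 = (1 / of_nat n) *\<^sub>C e' 0" "Y * e' 0 * Y = (1 / of_nat n) *\<^sub>C Y"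
    using B.unbiased_e_Y[OF n] by (simp_all add: unbiased_def)
  have e0W: "e 0 * W * e 0 = (1 / of_nat n) *\<^sub>C e 0" "W * e 0 * W = (1 / of_nat n) *\<^sub>C W"
    using A.unbiased_e_Y[OF n] by (simp_all add: unbiased_def)
  note [simp] = A.Y_proj(1,2) B.Y_proj(1,2) A.Y_proj(2)[THEN amul] B.Y_proj(2)[THEN amul] z(2)[THEN amul]
    pouD(1,2)[OF A.e n] pouD(1,2)[OF B.e n] pouD(2)[OF A.e n, THEN amul] pouD(2)[OF B.e n, THEN amul]
  note m = zY[THEN amul3] zY[unfolded mult.assoc] zW[THEN amul3] zW[unfolded mult.assoc]
    e'Y[THEN amul3] e'Y[unfolded mult.assoc] e0W[THEN amul3] e0W[unfolded mult.assoc]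
  have fQ: "fqr n z Q"
    unfolding Q_def
    by (rule fqr_sandwich[OF B.e A.e ee' B.unbiased_e_Y eY e'W A.unbiased_e_Y])
      (use n in \<open>simp_all add: mult.assoc m s\<close>)
  define L where "L = of_nat n *\<^sub>C (z * Y * e' 0)"
  define R where "R = of_nat n *\<^sub>C (e 0 * W * z)"
  have L: "L * adj L = z" "adj L * L = e' 0" "L * e' 0 = L"
    using n by (simp_all add: L_def mult.assoc m)
  have R: "R * adj R = e 0" "adj R * R = z" "e 0 * R = R"
    using n by (simp_all add: R_def mult.assoc m)
  have fP: "fqr n z P"
    unfolding P_def L_def[symmetric] R_def[symmetric]
    by (rule fqr_sandwich[OF B.f A.f ff' unbiased_sym[OF B.unbiased_e_f] unbiased_sym[OF e'f]
            unbiased_sym[OF ef'] unbiased_sym[OF A.unbiased_e_f] _ _ L R])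
      (use n hmatD(1)[OF A.h _ n] hmatD(1)[OF B.h _ n] in simp_all)
  have P: "P j l = of_nat n *\<^sub>C (z * Y * B.u j * adj (A.u l) * W * z)" if "j < n" "l < n" for j l
  proof -
    have "P j l = (H' $$ (j, 0) * cnj (H $$ (l, 0)) * of_nat n * of_nat n * of_nat n) *\<^sub>C
       (z * (Y * e' 0 * f' j) * (f l * e 0 * W) * z)"
      by (simp add: P_def mult.assoc mult_ac(2))
    also have "\<dots> = (H' $$ (j, 0) * cnj (H' $$ (j, 0)) * (H $$ (l, 0) * cnj (H $$ (l, 0))) * of_nat n) *\<^sub>C
        (z * Y * B.u j * adj (A.u l) * W * z)"
      unfolding B.Y_e_f(1)[OF that(1) n] A.Y_e_f(2)[OF that(2) n] using n
      by (simp add: mult.assoc mult_ac(2))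
    finally show ?thesis
      using hmatD(2)[OF A.h that(2) n] hmatD(2)[OF B.h that(1) n] by simp
  qed
  \<comment> \<open>\<open>P\<close> is, up to the factor n, the transform of \<open>Q\<close> by
    \<open>H'\<close> on the left and by the adjoint of \<open>H\<close> on the right; multiplying
    by \<open>H\<close> undoes the latter, whence the intertwining relation.\<close>
  have PQ: "of_nat n *\<^sub>C P j l = (\<Sum>i<n. \<Sum>k<n. (H' $$ (j, i) * cnj (H $$ (l, k))) *\<^sub>C Q i k)" if "j < n" "l < n" for j l
  proof -
    have "(\<Sum>i<n. \<Sum>k<n. (H' $$ (j, i) * cnj (H $$ (l, k))) *\<^sub>C Q i k) =
       (\<Sum>i<n. \<Sum>k<n. (of_nat n * of_nat n) *\<^sub>C (z * Y * (H' $$ (j, i) *\<^sub>C e' i) * (cnj (H $$ (l, k)) *\<^sub>C e k) * W * z))"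
      by (intro sum.cong refl) (simp add: Q_def mult.assoc s mult_ac)
    also have "\<dots> = (of_nat n * of_nat n) *\<^sub>C (z * Y * B.u j * adj (A.u l) * W * z)"
      unfolding B.u_def A.u_def
      by (simp add: sum_distrib_left sum_distrib_right csc.scale_sum_right pouD(1)[OF A.e] mult.assoc)
        (rule sum.swap)
    finally show ?thesis using P[OF that] by simp
  qed
  show ?thesis
  proof (rule weakly_quantum_equivalentI)
    show "z \<noteq> 0" using nz by (simp add: z_def)
    show "P i j \<in> sub" "Q i j \<in> sub" for i j
      by (simp_all add: sub_def P_def Q_def mult.assoc)
    show "\<forall>i<n. \<forall>j<n.
        (\<Sum>k<n. U i k * adj (U j k)) = (if i = j then z else 0) \<and>
        (\<Sum>k<n. adj (U k i) * U k j) = (if i = j then z else 0) \<and>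
        (\<Sum>k<n. adj (U i k) * U j k) = (if i = j then z else 0) \<and>
        (\<Sum>k<n. U k i * adj (U k j)) = (if i = j then z else 0) \<and>
        (\<forall>k<n. i \<noteq> j \<longrightarrow> U i k * adj (U j k) = 0 \<and> U k i * adj (U k j) = 0)" if "U = P \<or> U = Q" for U
      using that fP fQ unfolding fqr_def by blast
    fix i j assume ij: "i < n" "j < n"
    have "of_nat n *\<^sub>C (\<Sum>l<n. H $$ (l, j) *\<^sub>C P i l) = (\<Sum>l<n. H $$ (l, j) *\<^sub>C (of_nat n *\<^sub>C P i l))"
      by (simp add: csc.scale_sum_right mult_ac)
    also have "\<dots> = (\<Sum>l<n. \<Sum>i'<n. \<Sum>k<n. (H' $$ (i, i') * (H $$ (l, j) * cnj (H $$ (l, k)))) *\<^sub>C Q i' k)"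
      using ij by (intro sum.cong refl) (simp add: PQ csc.scale_sum_right mult_ac)
    also have "\<dots> = (\<Sum>i'<n. \<Sum>k<n. \<Sum>l<n. (H' $$ (i, i') * (H $$ (l, j) * cnj (H $$ (l, k)))) *\<^sub>C Q i' k)"
      by (subst sum.swap) (intro sum.cong refl sum.swap)
    also have "\<dots> = (\<Sum>i'<n. \<Sum>k<n. (H' $$ (i, i') * (\<Sum>l<n. H $$ (l, j) * cnj (H $$ (l, k)))) *\<^sub>C Q i' k)"
      by (simp add: sum_distrib_left csc.scale_sum_left)
    also have "\<dots> = (\<Sum>i'<n. \<Sum>k<n. if k = j then (of_nat n * H' $$ (i, i')) *\<^sub>C Q i' j else 0)"
      using ij hmatD(5)[OF A.h] by (intro sum.cong refl) (auto simp: mult.commute)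
    also have "\<dots> = of_nat n *\<^sub>C (\<Sum>i'<n. H' $$ (i, i') *\<^sub>C Q i' j)"
      using ij by (simp add: csc.scale_sum_right)
    finally show "(\<Sum>k<n. H' $$ (i, k) *\<^sub>C Q k j) = (\<Sum>k<n. H $$ (k, j) *\<^sub>C P i k)"
      using n by simp
  qed
qed

section \<open>Operators graded by levels\<close>

definition is_proj :: "'a bop \<Rightarrow> bool" where "is_proj P \<longleftrightarrow> adj P = P \<and> P * P = P"

lemma bnorm_proj:
  assumes "is_proj P"
  shows "bnorm P \<le> 1"
proof -
  have P: "adj P = P" "P * P = P" using assms by (simp_all add: is_proj_def)
  have "bnorm P * bnorm P = bnorm P"
    using bnorm_cstar[of P] unfolding P power2_eq_square by (rule sym)
  then have "bnorm P = 0 \<or> bnorm P = 1" by simp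
  then show ?thesis by (elim disjE) simp_all
qed

lemma adjoint_sym:
  assumes "\<And>x y. cinner (T x) y = cinner x (S y)"
  shows "cinner (S x) y = cinner x (T y)"
  using arg_cong[OF assms[of y x], of cnj] by (simp only: cinner_commute[symmetric])

text \<open>Pull-back of coordinates along a partial map. If the map is injective with partial
  inverse \<open>h\<close>, this is a partial isometry with adjoint \<open>part h\<close>; creation
  operators and matrix units are of this kind.\<close>

definition part :: "('a \<Rightarrow> 'a option) \<Rightarrow> 'a bop" where
  "part g = bop_of (\<lambda>x. Abs_ell2 (\<lambda>i. case g i of None \<Rightarrow> 0 | Some j \<Rightarrow> Rep_ell2 x j))"

lemma part:
  assumes gh: "\<And>i j. g i = Some j \<longleftrightarrow> h j = Some i"
  shows "Rep_ell2 (app (part g) x) i = (case g i of None \<Rightarrow> 0 | Some j \<Rightarrow> Rep_ell2 x j)"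
    and "adj (part g) = part h"
proof -
  define T where "T g x = Abs_ell2 (\<lambda>i. case g i of None \<Rightarrow> 0 | Some j \<Rightarrow> Rep_ell2 x j)"
    for g :: "'a \<Rightarrow> 'a option" and x
  have sum: "(\<Sum>i\<in>F. (cmod (case g i of None \<Rightarrow> 0 | Some j \<Rightarrow> Rep_ell2 x j))\<^sup>2) \<le> (norm x)\<^sup>2"
    if "finite F" and gh: "\<And>i j. g i = Some j \<longleftrightarrow> h j = Some i" for F x and g h :: "'a \<Rightarrow> 'a option"
  proof -
    let ?D = "{i \<in> F. g i \<noteq> None}"
    have inj: "inj_on (\<lambda>i. the (g i)) ?D"
    proof (rule inj_onI)
      fix i j assume "i \<in> ?D" "j \<in> ?D" "the (g i) = the (g j)"
      then have "h (the (g i)) = Some i" "h (the (g i)) = Some j"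
        using gh[of i "the (g i)"] gh[of j "the (g i)"] by auto
      then show "i = j" by simp
    qed
    have "(\<Sum>i\<in>F. (cmod (case g i of None \<Rightarrow> 0 | Some j \<Rightarrow> Rep_ell2 x j))\<^sup>2) =
        (\<Sum>i\<in>?D. (cmod (Rep_ell2 x (the (g i))))\<^sup>2)"
      using \<open>finite F\<close> by (intro sum.mono_neutral_cong_right) auto
    also have "\<dots> = (\<Sum>j\<in>(\<lambda>i. the (g i)) ` ?D. (cmod (Rep_ell2 x j))\<^sup>2)"
      by (subst sum.reindex[OF inj]) simp
    also have "\<dots> \<le> (norm x)\<^sup>2"
      using \<open>finite F\<close> by (intro sum_square_le_norm) auto
    finally show ?thesis .
  qed
  have T: "Rep_ell2 (T g x) = (\<lambda>i. case g i of None \<Rightarrow> 0 | Some j \<Rightarrow> Rep_ell2 x j)" "norm (T g x) \<le> 1 * norm x"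
    if "\<And>i j. g i = Some j \<longleftrightarrow> h j = Some i" for x and g h :: "'a \<Rightarrow> 'a option"
    unfolding T_def mult_1 by (rule ell2_boundedI[OF sum[OF _ that] norm_ge_zero], assumption)+
  have hg: "\<And>i j. h i = Some j \<longleftrightarrow> g j = Some i" using gh by blast
  have adj: "cinner (T g x) y = cinner x (T h y)" for x y
  proof -
    let ?G = "{i. g i \<noteq> None}" and ?H = "{i. h i \<noteq> None}"
    have G: "h (the (g i)) = Some i" if "g i \<noteq> None" for i
      using that gh[of i "the (g i)"] by simp
    have H: "g (the (h j)) = Some j" if "h j \<noteq> None" for j
      using that gh[of "the (h j)" j] by simp
    have b: "bij_betw (\<lambda>i. the (g i)) ?G ?H"
      by (rule bij_betwI[where g = "\<lambda>j. the (h j)"]) (simp_all add: G H)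
    have "cinner (T g x) y = (\<Sum>\<^sub>\<infinity>i\<in>?G. cnj (Rep_ell2 x (the (g i))) * Rep_ell2 y (the (h (the (g i)))))"
      unfolding cinner_def' T(1)[OF gh] by (rule infsum_cong_neutral) (auto simp: G)
    also have "\<dots> = (\<Sum>\<^sub>\<infinity>j\<in>?H. cnj (Rep_ell2 x j) * Rep_ell2 y (the (h j)))"
      by (rule infsum_reindex_bij_betw[OF b])
    also have "\<dots> = cinner x (T h y)"
      unfolding cinner_def' T(1)[OF hg] by (rule infsum_cong_neutral) auto
    finally show ?thesis .
  qed
  have adj': "cinner (T h x) y = cinner x (T g y)" for x y
    by (rule adjoint_sym[OF adj])
  have g: "app (part g) = T g"
    unfolding part_def T_def[symmetric] by (rule app_bop_of[OF adj T(2)[OF gh]])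
  have h: "app (part h) = T h"
    unfolding part_def T_def[symmetric] by (rule app_bop_of[OF adj' T(2)[OF hg]])
  show "Rep_ell2 (app (part g) x) i = (case g i of None \<Rightarrow> 0 | Some j \<Rightarrow> Rep_ell2 x j)"
    by (simp add: g T(1)[OF gh])
  show "adj (part g) = part h"
    by (rule adj_eqI) (simp add: g h adj)
qed

definition diag :: "('a \<Rightarrow> complex) \<Rightarrow> 'a bop" where
  "diag \<phi> = bop_of (\<lambda>x. Abs_ell2 (\<lambda>i. \<phi> i * Rep_ell2 x i))"

lemma diag:
  assumes "\<And>i. cmod (\<phi> i) \<le> C"
  shows "Rep_ell2 (app (diag \<phi>) x) i = \<phi> i * Rep_ell2 x i" "adj (diag \<phi>) = diag (\<lambda>i. cnj (\<phi> i))"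
proof -
  define T where "T \<phi> x = Abs_ell2 (\<lambda>i. \<phi> i * Rep_ell2 x i)" for \<phi> :: "'a \<Rightarrow> complex" and x
  have C: "0 \<le> C" by (rule order_trans[OF norm_ge_zero assms[of undefined]])
  have bd: "(\<Sum>i\<in>F. (cmod (\<phi> i * Rep_ell2 x i))\<^sup>2) \<le> (C * norm x)\<^sup>2"
    if "finite F" "\<And>i. cmod (\<phi> i) \<le> C" for F x and \<phi> :: "'a \<Rightarrow> complex"
  proof -
    have "(\<Sum>i\<in>F. (cmod (\<phi> i * Rep_ell2 x i))\<^sup>2) \<le> (\<Sum>i\<in>F. C\<^sup>2 * (cmod (Rep_ell2 x i))\<^sup>2)"
      by (intro sum_mono) (simp add: norm_mult power_mult_distrib mult_right_mono power_mono that)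
    also have "\<dots> \<le> C\<^sup>2 * (norm x)\<^sup>2"
      unfolding sum_distrib_left[symmetric] by (intro mult_left_mono sum_square_le_norm that) auto
    finally show ?thesis by (simp add: power_mult_distrib)
  qed
  have T: "Rep_ell2 (T \<phi> x) = (\<lambda>i. \<phi> i * Rep_ell2 x i)" "norm (T \<phi> x) \<le> C * norm x"
    if "\<And>i. cmod (\<phi> i) \<le> C" for x and \<phi> :: "'a \<Rightarrow> complex"
    unfolding T_def
    by (rule ell2_boundedI[OF bd[OF _ that] mult_nonneg_nonneg[OF C norm_ge_zero]], assumption)+
  have as: "cmod (cnj (\<phi> i)) \<le> C" for i using assms by simp
  have adj: "cinner (T \<phi> x) y = cinner x (T (\<lambda>i. cnj (\<phi> i)) y)" for x y
    unfolding cinner_def' T(1)[OF assms] T(1)[OF as] by (simp add: mult_ac)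
  have adj': "cinner (T (\<lambda>i. cnj (\<phi> i)) x) y = cinner x (T \<phi> y)" for x y
    by (rule adjoint_sym[OF adj])
  have 1: "app (diag \<phi>) = T \<phi>"
    unfolding diag_def T_def[symmetric] by (rule app_bop_of[OF adj T(2)[OF assms]])
  have 2: "app (diag (\<lambda>i. cnj (\<phi> i))) = T (\<lambda>i. cnj (\<phi> i))"
    unfolding diag_def T_def[symmetric] by (rule app_bop_of[OF adj' T(2)[OF as]])
  show "Rep_ell2 (app (diag \<phi>) x) i = \<phi> i * Rep_ell2 x i"
    by (simp add: 1 T(1)[OF assms])
  show "adj (diag \<phi>) = diag (\<lambda>i. cnj (\<phi> i))"
    by (rule adj_eqI) (simp add: 1 2 adj)
qed

definition ind :: "('a \<Rightarrow> bool) \<Rightarrow> 'a bop" where "ind p = diag (\<lambda>i. of_bool (p i))"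

lemma Rep_ind [simp]: "Rep_ell2 (app (ind p) x) i = (if p i then Rep_ell2 x i else 0)"
  unfolding ind_def by (subst diag[where C = 1]) auto

lemma ind: "adj (ind p) = ind p" "ind p * ind q = ind (\<lambda>i. p i \<and> q i)" "ind (\<lambda>i. True) = 1" "ind (\<lambda>i. False) = 0"
proof -
  show "adj (ind p) = ind p"
    unfolding ind_def by (subst diag(2)[where C = 1]) (auto intro!: arg_cong[where f = diag])
qed (rule bop_eqI; rule ell2_eqI; simp)+

lemma proj_ind: "is_proj (ind p)"
  by (simp add: is_proj_def ind)

locale graded =
  fixes lev :: "'a \<Rightarrow> nat"
begin

definition N :: "nat \<Rightarrow> 'a bop" where "N j = ind (\<lambda>i. lev i = j)"

lemma N: "adj (N j) = N j" "N i * N j = (if i = j then N i else 0)" "is_proj (N j)"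
proof -
  have "(\<lambda>k. lev k = i \<and> lev k = j) = (\<lambda>_. False)" if "i \<noteq> j"
    using that by auto
  then show "N i * N j = (if i = j then N i else 0)"
    by (simp add: N_def ind)
qed (simp_all add: N_def ind proj_ind)

lemma cinner_levels: "((\<lambda>j. cinner (app (N j) x) y) has_sum cinner x y) UNIV"
proof -
  let ?f = "\<lambda>i. cnj (Rep_ell2 x i) * Rep_ell2 y i"
  have b: "bij_betw (snd :: nat \<times> 'a \<Rightarrow> 'a) (SIGMA j:UNIV. {i. lev i = j}) UNIV"
    by (rule bij_betwI[where g = "\<lambda>i. (lev i, i)"]) auto
  have hs: "(?f has_sum cinner x y) UNIV"
    unfolding cinner_def' by (rule has_sum_infsum[OF prod_summable])
  have "((\<lambda>p. ?f (snd p)) has_sum cinner x y) (SIGMA j:UNIV. {i. lev i = j})"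
    using hs has_sum_reindex_bij_betw[OF b, of ?f] by simp
  then have s: "((\<lambda>(j, i). ?f i) has_sum cinner x y) (SIGMA j:UNIV. {i. lev i = j})"
    by (simp add: case_prod_unfold)
  have "(?f has_sum cinner (app (N j) x) y) {i. lev i = j}" for j
  proof -
    have "((\<lambda>i. cnj (Rep_ell2 (app (N j) x) i) * Rep_ell2 y i) has_sum cinner (app (N j) x) y) UNIV"
      unfolding cinner_def' by (rule has_sum_infsum[OF prod_summable])
    then show ?thesis
      by (rule has_sum_cong_neutral[THEN iffD1, rotated -1]) (auto simp: N_def)
  qed
  then show ?thesis
    by (intro has_sum_SigmaD[OF s]) auto
qed

text \<open>Coordinate \<open>i\<close> of \<open>adj A\<close> applied to a vector is already
  visible after \<open>N (lev i)\<close>, so operators that agree on every level are equal.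
  Identities for direct sums over the levels are thereby checked level by level.\<close>

lemma lev_ext:
  assumes "\<And>j. A * N j = B * N j"
  shows "A = B"
proof -
  have *: "N j * adj A = N j * adj B" for j
    using arg_cong[OF assms[of j], of adj] by (simp add: N)
  have "adj A = adj B"
  proof (rule bop_eqI, rule ell2_eqI)
    fix x i
    have "Rep_ell2 (app (N (lev i) * adj A) x) i = Rep_ell2 (app (N (lev i) * adj B) x) i"
      using * by simp
    then show "Rep_ell2 (app (adj A) x) i = Rep_ell2 (app (adj B) x) i"
      by (simp add: N_def)
  qed
  then show ?thesis by (metis adj_adj)
qed

lemma lev_mult:
  assumes "A * N j = a" "B * N j = b" "N j * B = b"
  shows "A * B * N j = a * b"
proof -
  have "a * b = A * (N j * N j) * B"
    unfolding assms(1)[symmetric] assms(3)[symmetric] by (simp only: mult.assoc)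
  also have "\<dots> = A * (B * N j)"
    unfolding assms(2) assms(3)[symmetric] by (simp add: N(2) mult.assoc)
  finally show ?thesis by (simp only: mult.assoc)
qed

text \<open>The direct sum of a uniformly bounded family of blocks. Each block is an operator on the
  whole space supported on its level, so no separate Hilbert spaces are needed.\<close>

definition asm :: "(nat \<Rightarrow> 'a bop) \<Rightarrow> 'a bop" where
  "asm a = bop_of (\<lambda>x. Abs_ell2 (\<lambda>i. Rep_ell2 (app (a (lev i)) x) i))"

definition blocks :: "(nat \<Rightarrow> 'a bop) \<Rightarrow> bool" where
  "blocks a \<longleftrightarrow> (\<forall>j. N j * a j = a j \<and> a j * N j = a j) \<and> (\<exists>C. \<forall>j. bnorm (a j) \<le> C)"

lemma sum_N_le: "finite J \<Longrightarrow> (\<Sum>j\<in>J. (norm (app (N j) x))\<^sup>2) \<le> (norm x)\<^sup>2"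
proof -
  assume J: "finite J"
  let ?P = "ind (\<lambda>i. lev i \<in> J)"
  have sumN: "(\<Sum>j\<in>J. N j) = ?P"
    using J
  proof (induction J)
    case empty
    show ?case by (simp add: ind)
  next
    case (insert j J)
    then have "(\<Sum>j\<in>insert j J. N j) = N j + ind (\<lambda>i. lev i \<in> J)" by simp
    also have "\<dots> = ind (\<lambda>i. lev i \<in> insert j J)"
      using insert(2) by (intro bop_eqI ell2_eqI) (auto simp: N_def)
    finally show ?case .
  qed
  have "complex_of_real (\<Sum>j\<in>J. (norm (app (N j) x))\<^sup>2) = (\<Sum>j\<in>J. cinner x (app (N j) x))"
    unfolding of_real_sum unfolding norm_app_square N by simp
  also have "\<dots> = cinner x (app (\<Sum>j\<in>J. N j) x)"
    using J by (induction J) (simp_all add: cinner_add_right)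
  also have "\<dots> = complex_of_real ((norm (app ?P x))\<^sup>2)"
    by (simp only: norm_app_square sumN ind conj_absorb)
  finally have "(\<Sum>j\<in>J. (norm (app (N j) x))\<^sup>2) = (norm (app ?P x))\<^sup>2"
    by (simp only: of_real_eq_iff)
  also have "\<dots> \<le> (1 * norm x)\<^sup>2"
    by (intro power_mono order_trans[OF norm_app] mult_right_mono bnorm_proj proj_ind) auto
  finally show ?thesis by simp
qed

lemma asm:
  assumes "blocks a"
  shows "asm a * N j = a j" "N j * asm a = a j" "adj (asm a) = asm (\<lambda>j. adj (a j))"
proof -
  define T where "T a x = Abs_ell2 (\<lambda>i. Rep_ell2 (app (a (lev i)) x) i)" for a :: "nat \<Rightarrow> 'a bop" and x
  have T: "\<exists>C. \<forall>x. Rep_ell2 (T a x) = (\<lambda>i. Rep_ell2 (app (a (lev i)) x) i) \<and> norm (T a x) \<le> C * norm x"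
    if a: "blocks a" for a
  proof -
    obtain C where C: "\<And>j. bnorm (a j) \<le> C" using a by (auto simp: blocks_def)
    have C0: "0 \<le> C" by (rule order_trans[OF bnorm_nonneg C[of 0]])
    have "(\<Sum>i\<in>F. (cmod (Rep_ell2 (app (a (lev i)) x) i))\<^sup>2) \<le> (C * norm x)\<^sup>2" if F: "finite F" for F x
    proof -
      have "(\<Sum>i\<in>F. (cmod (Rep_ell2 (app (a (lev i)) x) i))\<^sup>2) =
          (\<Sum>j\<in>lev ` F. \<Sum>i\<in>{i \<in> F. lev i = j}. (cmod (Rep_ell2 (app (a (lev i)) x) i))\<^sup>2)"
        using F by (rule sum.image_gen)
      also have "\<dots> \<le> (\<Sum>j\<in>lev ` F. C\<^sup>2 * (norm (app (N j) x))\<^sup>2)"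
      proof (rule sum_mono)
        fix j
        have "(\<Sum>i\<in>{i \<in> F. lev i = j}. (cmod (Rep_ell2 (app (a (lev i)) x) i))\<^sup>2) =
            (\<Sum>i\<in>{i \<in> F. lev i = j}. (cmod (Rep_ell2 (app (a j) (app (N j) x)) i))\<^sup>2)"
          using a by (intro sum.cong refl) (auto simp: blocks_def app_times[symmetric] simp del: app_times)
        also have "\<dots> \<le> (norm (app (a j) (app (N j) x)))\<^sup>2"
          using F by (intro sum_square_le_norm) auto
        also have "\<dots> \<le> (C * norm (app (N j) x))\<^sup>2"
          by (intro power_mono order_trans[OF norm_app] mult_right_mono C) auto
        finally show "(\<Sum>i\<in>{i \<in> F. lev i = j}. (cmod (Rep_ell2 (app (a (lev i)) x) i))\<^sup>2) \<le> C\<^sup>2 * (norm (app (N j) x))\<^sup>2"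
          by (simp add: power_mult_distrib)
      qed
      also have "\<dots> \<le> C\<^sup>2 * (norm x)\<^sup>2"
        unfolding sum_distrib_left[symmetric] using F by (intro mult_left_mono sum_N_le) auto
      finally show ?thesis by (simp add: power_mult_distrib)
    qed
    note bd = this
    show ?thesis
      unfolding T_def
      by (intro exI[of _ C] allI conjI ell2_boundedI[OF bd mult_nonneg_nonneg[OF C0 norm_ge_zero]])
  qed
  have ba: "blocks (\<lambda>j. adj (a j))"
    using assms unfolding blocks_def bnorm_adj by (metis N(1) adj_times)
  have NT: "app (N j) (T a x) = app (a j) x" if a: "blocks a" for a j x
  proof (rule ell2_eqI)
    fix i
    have "a j = N j * a j" using a by (simp add: blocks_def)
    then have "Rep_ell2 (app (a j) x) i = Rep_ell2 (app (N j * a j) x) i"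
      by (rule arg_cong)
    also have "\<dots> = (if lev i = j then Rep_ell2 (app (a j) x) i else 0)"
      by (simp add: N_def)
    finally have "Rep_ell2 (app (a j) x) i = (if lev i = j then Rep_ell2 (app (a j) x) i else 0)" .
    then show "Rep_ell2 (app (N j) (T a x)) i = Rep_ell2 (app (a j) x) i"
      using T[OF a] by (auto simp: N_def)
  qed
  \<comment> \<open>The inner product is the sum of its contributions from the levels, and on each
    level the adjoint is that of a single block.\<close>
  have adj: "cinner (T a x) y = cinner x (T (\<lambda>j. adj (a j)) y)" for x y
  proof (rule has_sum_unique)
    show "((\<lambda>j. cinner (app (N j) (T a x)) y) has_sum cinner (T a x) y) UNIV"
      by (rule cinner_levels)
    have "((\<lambda>j. cnj (cinner (app (N j) (T (\<lambda>j. adj (a j)) y)) x)) has_sum cnj (cinner (T (\<lambda>j. adj (a j)) y) x)) UNIV"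
      by (simp only: has_sum_cnj_iff cinner_levels)
    then show "((\<lambda>j. cinner (app (N j) (T a x)) y) has_sum cinner x (T (\<lambda>j. adj (a j)) y)) UNIV"
      by (simp add: NT assms ba cinner_commute[symmetric] app_adj)
  qed
  have adj': "cinner (T (\<lambda>j. adj (a j)) x) y = cinner x (T a y)" for x y
    by (rule adjoint_sym[OF adj])
  obtain C where C: "norm (T a x) \<le> C * norm x" for x using T[OF assms] by blast
  obtain C' where C': "norm (T (\<lambda>j. adj (a j)) x) \<le> C' * norm x" for x using T[OF ba] by blast
  have asm_T: "asm b = bop_of (T b)" for b
    unfolding asm_def T_def ..
  have 1: "app (asm a) = T a"
    unfolding asm_T by (rule app_bop_of[OF adj C])
  have 2: "app (asm (\<lambda>j. adj (a j))) = T (\<lambda>j. adj (a j))"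
    unfolding asm_T by (rule app_bop_of[OF adj' C'])
  show 3: "adj (asm a) = asm (\<lambda>j. adj (a j))"
    by (rule adj_eqI) (simp add: 1 2 adj)
  show "N j * asm a = a j"
    by (rule bop_eqI) (simp add: 1 NT assms)
  have "N j * adj (asm a) = adj (a j)"
    unfolding 3 by (rule bop_eqI) (simp add: 2 NT ba)
  from arg_cong[OF this, of adj] show "asm a * N j = a j"
    by (simp add: N)
qed

lemma blocks_proj:
  assumes "\<And>j. is_proj (a j)" "\<And>j. N j * a j = a j"
  shows "blocks a"
  unfolding blocks_def
proof (intro conjI allI exI)
  fix j
  show "N j * a j = a j" by fact
  from arg_cong[OF this, of adj] show "a j * N j = a j"
    using assms(1)[of j] by (simp add: is_proj_def N(1))
  show "bnorm (a j) \<le> 1" by (rule bnorm_proj[OF assms(1)])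
qed

end

section \<open>Towers\<close>

text \<open>Functional calculus: for a partition of unity \<open>f\<close> the map from
  \<open>\<phi>\<close> to \<open>comb n \<phi> f\<close> respects products, adjoints and
  units.\<close>

definition comb :: "nat \<Rightarrow> (nat \<Rightarrow> complex) \<Rightarrow> (nat \<Rightarrow> 'a bop) \<Rightarrow> 'a bop" where
  "comb n \<phi> f = (\<Sum>l<n. \<phi> l *\<^sub>C f l)"

lemma comb:
  assumes f: "pou n P f"
  shows "l < n \<Longrightarrow> comb n \<phi> f * f l = \<phi> l *\<^sub>C f l" "l < n \<Longrightarrow> f l * comb n \<phi> f = \<phi> l *\<^sub>C f l"
    "comb n \<phi> f * comb n \<psi> f = comb n (\<lambda>l. \<phi> l * \<psi> l) f"
    "adj (comb n \<phi> f) = comb n (\<lambda>l. cnj (\<phi> l)) f"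
    "(\<And>l. l < n \<Longrightarrow> \<phi> l = 1) \<Longrightarrow> comb n \<phi> f = P"
proof -
  show 1: "comb n \<phi> f * f l = \<phi> l *\<^sub>C f l" if "l < n" for \<phi> l
  proof -
    have "comb n \<phi> f * f l = (\<Sum>m<n. if m = l then \<phi> l *\<^sub>C f l else 0)"
      unfolding comb_def sum_distrib_right using pouD(2,3)[OF f] that by (intro sum.cong) auto
    then show ?thesis using that by simp
  qed
  show "f l * comb n \<phi> f = \<phi> l *\<^sub>C f l" if "l < n" for l
  proof -
    have "f l * comb n \<phi> f = (\<Sum>m<n. if m = l then \<phi> l *\<^sub>C f l else 0)"
      unfolding comb_def sum_distrib_left using pouD(2,3)[OF f that] that by (intro sum.cong) auto
    then show ?thesis using that by simp
  qed
  have "comb n \<phi> f * comb n \<psi> f = (\<Sum>l<n. \<psi> l *\<^sub>C (comb n \<phi> f * f l))"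
    by (subst (2) comb_def) (simp add: sum_distrib_left)
  also have "\<dots> = comb n (\<lambda>l. \<phi> l * \<psi> l) f"
    unfolding comb_def[of n "\<lambda>l. \<phi> l * \<psi> l"] by (intro sum.cong) (simp_all add: 1 mult.commute)
  finally show "comb n \<phi> f * comb n \<psi> f = comb n (\<lambda>l. \<phi> l * \<psi> l) f" .
  show "adj (comb n \<phi> f) = comb n (\<lambda>l. cnj (\<phi> l)) f"
    using pouD(1)[OF f] by (simp add: comb_def)
  show "comb n \<phi> f = P" if "\<And>l. l < n \<Longrightarrow> \<phi> l = 1"
    using that f by (simp add: comb_def pou_def)
qed

text \<open>The \<open>c i\<close> behave like creation operators: isometries with orthogonal ranges
  that raise the level by one. \<open>b\<close> is a partition of unity commuting with them, from
  which the partition \<open>F\<close> is grown.\<close>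

locale tower = graded lev for lev :: "'a \<Rightarrow> nat" +
  fixes n :: nat and h :: "nat \<Rightarrow> nat \<Rightarrow> complex" and c b :: "nat \<Rightarrow> 'a bop"
  assumes n: "n > 0" and h: "hmat n h"
    and c_iso: "\<And>i j. i < n \<Longrightarrow> j < n \<Longrightarrow> adj (c i) * c j = (if i = j then 1 else 0)"
    and c_N: "\<And>i j. i < n \<Longrightarrow> c i * N j = N (Suc j) * c i"
    and c_0: "\<And>i. i < n \<Longrightarrow> N 0 * c i = 0"
    and b: "pou n 1 b"
    and b_c: "\<And>l i. l < n \<Longrightarrow> i < n \<Longrightarrow> b l * c i = c i * b l"
    and b_N: "\<And>l j. l < n \<Longrightarrow> b l * N j = N j * b l"
begin

lemma ac_N: "i < n \<Longrightarrow> adj (c i) * N (Suc j) = N j * adj (c i)"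
  using arg_cong[OF c_N[of i j], of adj] by (simp add: N)

lemma ac_b: "l < n \<Longrightarrow> i < n \<Longrightarrow> adj (c i) * b l = b l * adj (c i)"
  using arg_cong[OF b_c[of l i], of adj] pouD(1)[OF b, of l] by simp

definition W :: "'a bop" where "W = 1 - (\<Sum>k<n. c k * adj (c k))"

lemma W: "i < n \<Longrightarrow> W * c i = 0" "adj W = W" "W * W = W"
proof -
  have cc: "(\<Sum>k<n. c k * adj (c k)) * c i = c i" if "i < n" for i
  proof -
    have "(\<Sum>k<n. c k * adj (c k)) * c i = (\<Sum>k<n. if k = i then c i else 0)"
      unfolding sum_distrib_right using that by (intro sum.cong) (auto simp: mult.assoc c_iso)
    then show ?thesis using that by simp
  qed
  then show 1: "W * c i = 0" if "i < n" for i
    using that by (simp add: W_def left_diff_distrib)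
  show "adj W = W"
    by (simp add: W_def)
  have "W * W = W - (\<Sum>k<n. W * c k * adj (c k))"
    by (subst (2) W_def) (simp add: right_diff_distrib sum_distrib_left mult.assoc)
  then show "W * W = W"
    using 1 by simp
qed

lemma W_comm:
  assumes "\<And>i. i < n \<Longrightarrow> z * c i = c i * z" "\<And>i. i < n \<Longrightarrow> z * adj (c i) = adj (c i) * z"
  shows "z * W = W * z"
proof -
  have "z * (\<Sum>k<n. c k * adj (c k)) = (\<Sum>k<n. c k * adj (c k)) * z"
    unfolding sum_distrib_left sum_distrib_right
    by (intro sum.cong refl) (simp add: mult.assoc assms(1)[THEN amul] assms(2))
  then show ?thesis by (simp add: W_def algebra_simps)
qed

lemma b_W: "l < n \<Longrightarrow> b l * W = W * b l"
  by (rule W_comm) (simp_all add: b_c ac_b)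

lemma N_W: "N j * W = W * N j"
proof -
  have "N j * (c k * adj (c k)) = c k * adj (c k) * N j" if "k < n" for k
  proof (cases j)
    case 0
    have "adj (c k) * N 0 = 0" using arg_cong[OF c_0[OF that], of adj] by (simp add: N)
    then show ?thesis using c_0[OF that] 0 by (simp add: mult.assoc) (simp flip: mult.assoc)
  next
    case (Suc i)
    then show ?thesis
      using c_N[OF that, of i] ac_N[OF that, of i] by (simp add: mult.assoc) (simp flip: mult.assoc)
  qed
  then show ?thesis
    by (simp add: W_def algebra_simps sum_distrib_left sum_distrib_right)
qed

definition uu :: "(nat \<Rightarrow> 'a bop) \<Rightarrow> nat \<Rightarrow> 'a bop" where "uu f k = comb n (\<lambda>l. h l k) f"

definition s :: complex where "s = of_real (1 / sqrt (real n))"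

text \<open>For a partition of unity \<open>f\<close> of one level, the operators \<open>psi f l\<close> are isometries into the next one
  with orthogonal ranges. They diagonalise the required covariance: as soon as \<open>F l\<close> contains the range of
  \<open>psi F l\<close>, \<open>U k * c k * adj (U k)\<close> is the same multiple of the sum of all \<open>psi F l\<close>. This forces the recursion \<open>fl\<close>.\<close>

definition psi :: "(nat \<Rightarrow> 'a bop) \<Rightarrow> nat \<Rightarrow> 'a bop" where
  "psi f l = s *\<^sub>C (\<Sum>k<n. h l k *\<^sub>C (c k * adj (uu f k)))"

lemma s: "s * s = 1 / of_nat n" "cnj s = s"
  unfolding s_def by (simp_all flip: of_real_mult add: n)

lemma uu:
  assumes f: "pou n P f" and k: "k < n"
  shows "l < n \<Longrightarrow> uu f k * f l = h l k *\<^sub>C f l" "l < n \<Longrightarrow> f l * uu f k = h l k *\<^sub>C f l"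
    "l < n \<Longrightarrow> adj (uu f k) * f l = cnj (h l k) *\<^sub>C f l" "l < n \<Longrightarrow> f l * adj (uu f k) = cnj (h l k) *\<^sub>C f l"
    "uu f k * adj (uu f k) = P" "adj (uu f k) * uu f k = P"
    "m < n \<Longrightarrow> adj (uu f k) * uu f m = (\<Sum>l<n. (cnj (h l k) * h l m) *\<^sub>C f l)"
    "uu f k * z * adj (uu f k) = (\<Sum>l<n. \<Sum>m<n. (h l k * cnj (h m k)) *\<^sub>C (f l * z * f m))"
proof -
  show "uu f k * z * adj (uu f k) = (\<Sum>l<n. \<Sum>m<n. (h l k * cnj (h m k)) *\<^sub>C (f l * z * f m))"
    unfolding uu_def comb(4)[OF f] unfolding comb_def
    by (simp add: sum_distrib_left sum_distrib_right mult.assoc csc.scale_sum_right)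
       (subst sum.swap, simp add: mult.commute)
  show "adj (uu f k) * uu f m = (\<Sum>l<n. (cnj (h l k) * h l m) *\<^sub>C f l)"
    by (simp add: uu_def comb[OF f]) (simp add: comb_def)
qed (use k hmatD(2,3)[OF h] in \<open>simp_all add: uu_def comb[OF f]\<close>)

lemma uu_P:
  assumes f: "pou n P f" and k: "k < n"
  shows "uu f k * P = uu f k" "P * uu f k = uu f k" "adj (uu f k) * P = adj (uu f k)" "P * adj (uu f k) = adj (uu f k)"
proof -
  have *: "comb n \<phi> f * P = comb n \<phi> f" "P * comb n \<phi> f = comb n \<phi> f" for \<phi>
    using pouD(4,5)[OF f] by (simp_all add: comb_def sum_distrib_left sum_distrib_right)
  show "uu f k * P = uu f k" "P * uu f k = uu f k" "adj (uu f k) * P = adj (uu f k)" "P * adj (uu f k) = adj (uu f k)"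
    by (simp_all add: uu_def comb(4)[OF f] *)
qed

text \<open>Row orthogonality of \<open>h\<close> kills the terms \<open>f l * z * f m\<close> with
  different indices: averaging over the conjugations by \<open>uu f k\<close> is pinching by
  \<open>f\<close>.\<close>

lemma sum_uu_conj:
  assumes f: "pou n P f"
  shows "(\<Sum>k<n. uu f k * z * adj (uu f k)) = of_nat n *\<^sub>C (\<Sum>l<n. f l * z * f l)"
proof -
  have "(\<Sum>k<n. uu f k * z * adj (uu f k)) = (\<Sum>k<n. \<Sum>l<n. \<Sum>m<n. (h l k * cnj (h m k)) *\<^sub>C (f l * z * f m))"
    by (intro sum.cong refl uu(8)[OF f]) simp
  also have "\<dots> = (\<Sum>l<n. \<Sum>m<n. (\<Sum>k<n. h l k * cnj (h m k)) *\<^sub>C (f l * z * f m))"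
    unfolding csc.scale_sum_left by (subst sum.swap) (intro sum.cong refl sum.swap)
  also have "\<dots> = (\<Sum>l<n. \<Sum>m<n. if m = l then of_nat n *\<^sub>C (f l * z * f l) else 0)"
    using hmatD(4)[OF h] by (intro sum.cong refl) auto
  finally show ?thesis by (simp add: csc.scale_sum_right)
qed

lemma psi_z_psi:
  assumes f: "pou n P f" and lm: "l < n" "m < n" and z: "\<And>i. i < n \<Longrightarrow> z * c i = c i * z"
  shows "adj (psi f l) * z * psi f m = (1 / of_nat n) *\<^sub>C (\<Sum>k<n. (cnj (h l k) * h m k) *\<^sub>C (uu f k * z * adj (uu f k)))"
proof -
  have "adj (psi f l) * z * psi f m =
      (s * s) *\<^sub>C (\<Sum>k<n. \<Sum>k'<n. (cnj (h l k) * h m k') *\<^sub>C (uu f k * (adj (c k) * (z * c k')) * adj (uu f k')))"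
    unfolding psi_def
    by (simp add: sum_distrib_left sum_distrib_right csc.scale_sum_right mult.assoc s(2))
       (subst sum.swap, simp add: mult_ac(2,3))
  also have "(\<Sum>k<n. \<Sum>k'<n. (cnj (h l k) * h m k') *\<^sub>C (uu f k * (adj (c k) * (z * c k')) * adj (uu f k'))) =
      (\<Sum>k<n. \<Sum>k'<n. if k' = k then (cnj (h l k) * h m k) *\<^sub>C (uu f k * z * adj (uu f k)) else 0)"
    using z c_iso by (intro sum.cong refl) (auto simp: c_iso[THEN amul])
  finally show ?thesis by (simp add: s)
qed

lemma psi_psi:
  assumes f: "pou n P f" and lm: "l < n" "m < n"
  shows "adj (psi f l) * psi f m = (if l = m then P else 0)" "psi f l * P = psi f l" "W * psi f l = 0"
proof -
  have "adj (psi f l) * psi f m = (1 / of_nat n) *\<^sub>C ((\<Sum>k<n. h m k * cnj (h l k)) *\<^sub>C P)"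
    using psi_z_psi[OF f lm, of 1] uu(5)[OF f] by (simp add: csc.scale_sum_left mult.commute)
  then show "adj (psi f l) * psi f m = (if l = m then P else 0)"
    using hmatD(4)[OF h lm(2,1)] n by auto
  show "psi f l * P = psi f l" "W * psi f l = 0"
    unfolding psi_def using uu_P[OF f] W(1)
    by (simp_all add: sum_distrib_left sum_distrib_right mult.assoc W(1)[THEN amul, simplified])
qed

text \<open>The definition of \<open>psi\<close> is inverted by column orthogonality of
  \<open>h\<close>.\<close>

lemma c_uu_psi:
  assumes f: "pou n P f" and k: "k < n"
  shows "c k * adj (uu f k) = s *\<^sub>C (\<Sum>l<n. cnj (h l k) *\<^sub>C psi f l)"
proof -
  have "s *\<^sub>C (\<Sum>l<n. cnj (h l k) *\<^sub>C psi f l) = (s * s) *\<^sub>C (\<Sum>l<n. \<Sum>m<n. (h l m * cnj (h l k)) *\<^sub>C (c m * adj (uu f m)))"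
    unfolding psi_def by (simp add: csc.scale_sum_right mult_ac)
  also have "\<dots> = (s * s) *\<^sub>C (\<Sum>m<n. (\<Sum>l<n. h l m * cnj (h l k)) *\<^sub>C (c m * adj (uu f m)))"
    unfolding csc.scale_sum_left by (subst sum.swap) simp
  also have "(\<Sum>m<n. (\<Sum>l<n. h l m * cnj (h l k)) *\<^sub>C (c m * adj (uu f m))) = (\<Sum>m<n. if m = k then of_nat n *\<^sub>C (c k * adj (uu f k)) else 0)"
    using hmatD(5)[OF h _ k] by (intro sum.cong) auto
  finally show ?thesis using k n by (simp add: s)
qed

lemma psi_adj_psi:
  assumes f: "pou n P f" and l: "l < n"
  shows "y * (psi f l * adj (psi f l)) * y' = (1 / of_nat n) *\<^sub>C (\<Sum>k<n. \<Sum>m<n. (h l k * cnj (h l m)) *\<^sub>C (y * c k * (adj (uu f k) * uu f m) * adj (c m) * y'))"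
  unfolding psi_def
  by (simp add: sum_distrib_left sum_distrib_right csc.scale_sum_right mult.assoc s(2) flip: s(1))
     (subst sum.swap, simp add: mult_ac(2,3))

text \<open>The operators \<open>psi f l\<close> arise from \<open>c k * adj (uu f k)\<close> by the
  unitary matrix \<open>s\<close> times \<open>h\<close>, which preserves the sum of the products
  with the adjoints; the \<open>uu f k\<close> then cancel.\<close>

lemma sum_psi:
  assumes f: "pou n P f"
  shows "(\<Sum>l<n. psi f l * adj (psi f l)) = (\<Sum>k<n. c k * P * adj (c k))"
proof -
  have "(\<Sum>l<n. psi f l * adj (psi f l)) = (1 / of_nat n) *\<^sub>C (\<Sum>l<n. \<Sum>k<n. \<Sum>m<n. (h l k * cnj (h l m)) *\<^sub>C (c k * (adj (uu f k) * uu f m) * adj (c m)))"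
    using psi_adj_psi[OF f, where y = 1 and y' = 1] by (simp add: csc.scale_sum_right)
  also have "(\<Sum>l<n. \<Sum>k<n. \<Sum>m<n. (h l k * cnj (h l m)) *\<^sub>C (c k * (adj (uu f k) * uu f m) * adj (c m))) =
      (\<Sum>k<n. \<Sum>m<n. (\<Sum>l<n. h l k * cnj (h l m)) *\<^sub>C (c k * (adj (uu f k) * uu f m) * adj (c m)))"
    unfolding csc.scale_sum_left by (subst sum.swap) (intro sum.cong refl sum.swap)
  also have "\<dots> = (\<Sum>k<n. \<Sum>m<n. if m = k then of_nat n *\<^sub>C (c k * P * adj (c k)) else 0)"
    using hmatD(5)[OF h] uu(6)[OF f] by (intro sum.cong refl) auto
  finally show ?thesis using n by (simp add: csc.scale_sum_right[symmetric])
qed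

text \<open>Where no \<open>c k\<close> reaches, on the range of \<open>W\<close>, covariance
  imposes nothing and \<open>b\<close> is used. In the Fock model this occurs on all levels, as
  words may begin with a letter that is at least n.\<close>

primrec fl :: "nat \<Rightarrow> nat \<Rightarrow> 'a bop" where
  "fl 0 = (\<lambda>l. N 0 * b l)"
| "fl (Suc j) = (\<lambda>l. N (Suc j) * W * b l + psi (fl j) l * adj (psi (fl j) l))"

lemma N_psi:
  assumes f: "pou n (N j) f" and l: "l < n"
  shows "N (Suc j) * psi f l = psi f l"
  unfolding psi_def using uu_P(4)[OF f] c_N[symmetric, THEN amul]
  by (simp add: sum_distrib_left mult.assoc)

lemma fl: "pou n (N j) (fl j)"
proof (induction j)
  case 0
  have "N 0 * b l * (N 0 * b m) = N 0 * (b l * b m)" if "l < n" for l m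
    using b_N[OF that, of 0, THEN amul] N(2)[of 0 0, THEN amul] by (simp add: mult.assoc)
  then show ?case
    using b b_N by (auto simp: pou_def N(1) sum_distrib_left[symmetric])
next
  case (Suc j)
  let ?N = "N (Suc j)" and ?p = "psi (fl j)"
  have NN: "?N * ?N = ?N" by (simp add: N)
  have 1: "(?N * W * b l) * (?N * W * b m) = ?N * W * (b l * b m)" if "l < n" "m < n" for l m
    using b_N[OF that(1), THEN amul] b_W[OF that(1), THEN amul] N_W[of "Suc j"] N_W[of "Suc j", THEN amul] W(3)[THEN amul] NN[THEN amul]
    by (simp add: mult.assoc)
  \<comment> \<open>The new part and the part carried over from below are orthogonal because
    \<open>W\<close> annihilates the range of \<open>psi\<close>.\<close>
  have 2: "(?N * W * b l) * ?p m = 0" if "l < n" "m < n" for l m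
    using psi_psi(3)[OF Suc that(2,2)] b_W[OF that(1)] by (metis mult.assoc mult_zero_right)
  have 3: "adj (?N * W * b l) = ?N * W * b l" if "l < n" for l
    using pouD(1)[OF b that] b_N[OF that] b_W[OF that] N_W[of "Suc j"] N(1)[of "Suc j"] W(2)
    by (simp add: mult.assoc) (metis mult.assoc)
  have 4: "adj (?p l) * (?N * W * b m) = 0" if "l < n" "m < n" for l m
    using arg_cong[OF 2[OF that(2,1)], of adj] 3[OF that(2)] by simp
  have prod: "(?N * W * b l + ?p l * adj (?p l)) * (?N * W * b m + ?p m * adj (?p m)) =
      ?N * W * (b l * b m) + ?p l * (adj (?p l) * ?p m) * adj (?p m)" if "l < n" "m < n" for l m
  proof -
    have "?p l * adj (?p l) * (?N * W * b m) = 0" "?N * W * b l * (?p m * adj (?p m)) = 0"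
      using 4[OF that] 2[OF that] by (metis mult.assoc mult_zero_right mult_zero_left)+
    then show ?thesis using 1[OF that] by (simp add: distrib_left distrib_right mult.assoc)
  qed
  have "(\<Sum>l<n. ?N * W * b l + ?p l * adj (?p l)) = ?N * W + (\<Sum>k<n. c k * N j * adj (c k))"
    using pouD(6)[OF b n] by (simp add: sum.distrib sum_psi[OF Suc] sum_distrib_left[symmetric])
  also have "(\<Sum>k<n. c k * N j * adj (c k)) = ?N * (\<Sum>k<n. c k * adj (c k))"
    using c_N by (simp add: sum_distrib_left mult.assoc[symmetric])
  also have "?N * W + ?N * (\<Sum>k<n. c k * adj (c k)) = ?N"
    by (simp add: W_def right_diff_distrib)
  finally have sum: "(\<Sum>l<n. ?N * W * b l + ?p l * adj (?p l)) = ?N" .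
  show ?case
    unfolding pou_def fl.simps
  proof (intro conjI allI impI)
    fix l assume l: "l < n"
    show "adj (?N * W * b l + ?p l * adj (?p l)) = ?N * W * b l + ?p l * adj (?p l)"
      using 3[OF l] by (simp only: adj_plus adj_times[of "?p l"] adj_adj)
    fix m assume m: "m < n"
    show "(?N * W * b l + ?p l * adj (?p l)) * (?N * W * b m + ?p m * adj (?p m)) =
        (if l = m then ?N * W * b l + ?p l * adj (?p l) else 0)"
      unfolding prod[OF l m] psi_psi(1)[OF Suc l m]
      using psi_psi(2)[OF Suc l l] pouD(2)[OF b l] pouD(3)[OF b l m] by (cases "l = m") simp_all
  qed (rule sum)
qed

definition F :: "nat \<Rightarrow> 'a bop" where "F l = asm (\<lambda>j. fl j l)"

lemma F_N: "l < n \<Longrightarrow> F l * N j = fl j l" "l < n \<Longrightarrow> N j * F l = fl j l"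
proof -
  assume l: "l < n"
  have "blocks (\<lambda>j. fl j l)"
    using pouD(1,2,5)[OF fl l] by (intro blocks_proj) (auto simp: is_proj_def)
  then show "F l * N j = fl j l" "N j * F l = fl j l"
    unfolding F_def by (rule asm)+
qed

lemma F: "pou n 1 F"
  unfolding pou_def
proof (intro conjI allI impI)
  fix l assume l: "l < n"
  show "adj (F l) = F l"
  proof (rule lev_ext)
    fix j
    have "adj (F l) * N j = adj (N j * F l)" by (simp add: N)
    then show "adj (F l) * N j = F l * N j" using l pouD(1)[OF fl] by (simp add: F_N)
  qed
  fix m assume m: "m < n"
  show "F l * F m = (if l = m then F l else 0)"
  proof (rule lev_ext)
    fix j
    have "F l * F m * N j = F l * (N j * F m)" using m by (simp add: F_N mult.assoc)
    also have "\<dots> = fl j l * F m" using l by (simp add: F_N flip: mult.assoc)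
    also have "\<dots> = fl j l * (N j * F m)" using l pouD(4)[OF fl l] by (simp flip: mult.assoc)
    also have "\<dots> = fl j l * fl j m" using m by (simp add: F_N)
    also have "\<dots> = (if l = m then fl j l else 0)"
      using pouD(2)[OF fl[of j] l] pouD(3)[OF fl[of j] l m] by (cases "l = m") simp_all
    finally show "F l * F m * N j = (if l = m then F l else 0) * N j"
      using l by (simp add: F_N)
  qed
next
  show "(\<Sum>l<n. F l) = 1"
  proof (rule lev_ext)
    fix j
    have "(\<Sum>l<n. F l) * N j = (\<Sum>l<n. fl j l)"
      unfolding sum_distrib_right by (intro sum.cong refl) (simp add: F_N)
    then show "(\<Sum>l<n. F l) * N j = 1 * N j"
      using pouD(6)[OF fl[of j] n] by simp
  qed
qed

definition U :: "nat \<Rightarrow> 'a bop" where "U = uu F"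

lemma U_N: "U k * N j = uu (fl j) k" "N j * adj (U k) = adj (uu (fl j) k)" "N j * U k = uu (fl j) k" "adj (U k) * N j = adj (uu (fl j) k)"
  using pouD(1)[OF F] pouD(1)[OF fl]
  by (simp_all add: U_def uu_def comb_def sum_distrib_right sum_distrib_left F_N)

text \<open>On the next level \<open>F l\<close> is the range projection of \<open>psi F l\<close>
  plus a part under \<open>W\<close>, which does not meet the range of any
  \<open>psi F m\<close>.\<close>

lemma F_psi: "l < n \<Longrightarrow> m < n \<Longrightarrow> F l * psi F m = (if l = m then psi F m else 0)"
proof (rule lev_ext)
  fix j assume lm: "l < n" "m < n"
  have p: "psi F m * N j = psi (fl j) m"
    unfolding psi_def using U_N(4)[unfolded U_def] by (simp add: sum_distrib_right mult.assoc)
  have "F l * psi F m * N j = F l * (N (Suc j) * psi (fl j) m)"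
    using p N_psi[OF fl lm(2), of j] by (simp add: mult.assoc)
  also have "\<dots> = fl (Suc j) l * psi (fl j) m"
    using lm by (simp add: F_N flip: mult.assoc)
  also have "\<dots> = N (Suc j) * (b l * (W * psi (fl j) m)) + psi (fl j) l * (adj (psi (fl j) l) * psi (fl j) m)"
    using b_W[OF lm(1)] by (simp add: distrib_right mult.assoc) (simp flip: mult.assoc)
  also have "\<dots> = (if l = m then psi (fl j) m else 0)"
    using psi_psi[OF fl[of j] lm] psi_psi(3)[OF fl[of j] lm(2,2)] by (cases "l = m") simp_all
  finally show "F l * psi F m * N j = (if l = m then psi F m else 0) * N j"
    using p by simp
qed

lemma U_unitary: "k < n \<Longrightarrow> U k * adj (U k) = 1" "k < n \<Longrightarrow> adj (U k) * U k = 1"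
  by (simp_all add: U_def uu[OF F])

section \<open>Families covariant under the unitaries \<open>U k\<close>\<close>

definition cov :: "(nat \<Rightarrow> 'a bop) \<Rightarrow> bool" where
  "cov a \<longleftrightarrow> (\<exists>Y. \<forall>k<n. a k = adj (U k) * Y * U k)"

text \<open>By \<open>F_psi\<close>, \<open>U k\<close> acts on the range of \<open>psi F l\<close>
  as the scalar \<open>h l k\<close>, which cancels the coefficient in \<open>c_uu_psi\<close>. What
  remains is the sum of all \<open>psi F l\<close> times \<open>s\<close>, free of
  \<open>k\<close>.\<close>

lemma cov_c: "cov c"
proof -
  have "U k * psi F l = h l k *\<^sub>C psi F l" if "k < n" "l < n" for k l
  proof -
    have "U k * psi F l = (\<Sum>m<n. if m = l then h l k *\<^sub>C psi F l else 0)"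
      unfolding U_def uu_def comb_def sum_distrib_right using F_psi that by (intro sum.cong refl) simp
    then show ?thesis using that by simp
  qed
  then have "U k * (c k * adj (U k)) = s *\<^sub>C (\<Sum>l<n. psi F l)" if "k < n" for k
    using that hmatD(3)[OF h] unfolding U_def c_uu_psi[OF F that]
    by (simp add: sum_distrib_left)
  then have "c k = adj (U k) * (s *\<^sub>C (\<Sum>l<n. psi F l)) * U k" if "k < n" for k
    using that U_unitary[OF that] U_unitary(2)[OF that, THEN amul] by (simp add: mult.assoc flip: \<open>\<And>k. k < n \<Longrightarrow> U k * (c k * adj (U k)) = _\<close>)
  then show ?thesis unfolding cov_def by blast
qed

lemma covI: "(\<And>k. k < n \<Longrightarrow> a k = adj (U k) * Y * U k) \<Longrightarrow> cov a"
  unfolding cov_def by blast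

lemma covE:
  assumes "cov a"
  obtains Y where "\<And>k. k < n \<Longrightarrow> a k = adj (U k) * Y * U k"
  using assms unfolding cov_def by blast

lemma cov_mult:
  assumes "cov a" "cov a'"
  shows "cov (\<lambda>k. a k * a' k)"
proof -
  obtain Y Z where Y: "\<And>k. k < n \<Longrightarrow> a k = adj (U k) * Y * U k" and Z: "\<And>k. k < n \<Longrightarrow> a' k = adj (U k) * Z * U k"
    using assms by (metis covE)
  show ?thesis
  proof (rule covI)
    fix k assume k: "k < n"
    show "a k * a' k = adj (U k) * (Y * Z) * U k"
      using Y[OF k] Z[OF k] U_unitary(1)[OF k, THEN amul] by (simp add: mult.assoc)
  qed
qed

lemma cov_adj: "cov a \<Longrightarrow> cov (\<lambda>k. adj (a k))"
proof (elim covE, rule covI)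
  fix k Y assume "\<And>k. k < n \<Longrightarrow> a k = adj (U k) * Y * U k" "k < n"
  then show "adj (a k) = adj (U k) * adj Y * U k" by (simp add: mult.assoc)
qed

lemma cov_add: "cov a \<Longrightarrow> cov a' \<Longrightarrow> cov (\<lambda>k. a k + a' k)"
proof (elim covE, rule covI)
  fix k Y Z assume "\<And>k. k < n \<Longrightarrow> a k = adj (U k) * Y * U k" "\<And>k. k < n \<Longrightarrow> a' k = adj (U k) * Z * U k" "k < n"
  then show "a k + a' k = adj (U k) * (Y + Z) * U k" by (simp add: distrib_left distrib_right)
qed

lemma cov_csc: "cov a \<Longrightarrow> cov (\<lambda>k. t *\<^sub>C a k)"
proof (elim covE, rule covI)
  fix k Y assume "\<And>k. k < n \<Longrightarrow> a k = adj (U k) * Y * U k" "k < n"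
  then show "t *\<^sub>C a k = adj (U k) * (t *\<^sub>C Y) * U k" by simp
qed

lemma U_comm:
  assumes "\<And>l. l < n \<Longrightarrow> z * F l = F l * z"
  shows "z * U k = U k * z"
  unfolding U_def uu_def comb_def sum_distrib_left sum_distrib_right
  using assms by (intro sum.cong refl) simp

lemma cov_const:
  assumes "\<And>l. l < n \<Longrightarrow> z * F l = F l * z"
  shows "cov (\<lambda>_. z)"
proof (rule covI)
  fix k assume k: "k < n"
  have "adj (U k) * z * U k = adj (U k) * U k * z"
    using U_comm[OF assms, of k] by (simp add: mult.assoc)
  then show "z = adj (U k) * z * U k"
    using U_unitary(2)[OF k] by simp
qed

lemma sum_adj_uu_conj:
  assumes f: "pou n P f"
  shows "(\<Sum>k<n. adj (uu f k) * z * uu f k) = of_nat n *\<^sub>C (\<Sum>l<n. f l * z * f l)"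
proof -
  have "(\<Sum>k<n. adj (uu f k) * z * uu f k) = (\<Sum>k<n. \<Sum>l<n. \<Sum>m<n. (h m k * cnj (h l k)) *\<^sub>C (f l * z * f m))"
    unfolding uu_def comb(4)[OF f] unfolding comb_def
    by (intro sum.cong refl) (simp add: sum_distrib_left sum_distrib_right mult.assoc csc.scale_sum_right,
        subst sum.swap, simp add: mult.commute)
  also have "\<dots> = (\<Sum>l<n. \<Sum>m<n. (\<Sum>k<n. h m k * cnj (h l k)) *\<^sub>C (f l * z * f m))"
    unfolding csc.scale_sum_left by (subst sum.swap) (intro sum.cong refl sum.swap)
  also have "\<dots> = (\<Sum>l<n. \<Sum>m<n. if m = l then of_nat n *\<^sub>C (f l * z * f l) else 0)"
    using hmatD(4)[OF h] by (intro sum.cong refl) auto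
  finally show ?thesis by (simp add: csc.scale_sum_right)
qed

text \<open>The sum over a covariant family is n times the pinching of its common conjugate by
  \<open>F\<close>, and a pinching commutes with the projections used.\<close>

lemma cov_sum:
  assumes "cov a" and l: "l < n"
  shows "(\<Sum>k<n. a k) * F l = F l * (\<Sum>k<n. a k)"
proof -
  obtain Y where Y: "\<And>k. k < n \<Longrightarrow> a k = adj (U k) * Y * U k"
    using assms by (metis covE)
  have a: "(\<Sum>k<n. a k) = of_nat n *\<^sub>C (\<Sum>m<n. F m * Y * F m)"
    unfolding sum_adj_uu_conj[OF F, symmetric] using Y by (intro sum.cong) (simp_all add: U_def)
  have "(\<Sum>m<n. F m * Y * F m) * F l = (\<Sum>m<n. if m = l then F l * Y * F l else 0)"
    unfolding sum_distrib_right using pouD(2,3)[OF F] l by (intro sum.cong refl) (auto simp: mult.assoc)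
  moreover have "F l * (\<Sum>m<n. F m * Y * F m) = (\<Sum>m<n. if m = l then F l * Y * F l else 0)"
    unfolding sum_distrib_left using pouD(2,3)[OF F l] l by (intro sum.cong refl) (auto simp flip: mult.assoc)
  ultimately show ?thesis by (simp add: a)
qed

text \<open>The commutant of the operators of a tower. It will contain the operators of the other
  tower, and facts about \<open>z\<close> in it are transported along the recursion for
  \<open>F\<close>.\<close>

definition cm :: "'a bop \<Rightarrow> bool" where
  "cm z \<longleftrightarrow> (\<forall>i<n. z * c i = c i * z \<and> z * adj (c i) = adj (c i) * z) \<and> (\<forall>j. z * N j = N j * z)"

lemma cmD: "cm z \<Longrightarrow> i < n \<Longrightarrow> z * c i = c i * z" "cm z \<Longrightarrow> i < n \<Longrightarrow> z * adj (c i) = adj (c i) * z"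
  "cm z \<Longrightarrow> z * N j = N j * z"
  by (simp_all add: cm_def)

lemma cm_adj: "cm z \<Longrightarrow> cm (adj z)"
proof -
  assume z: "cm z"
  have 1: "adj z * adj x = adj x * adj z" if "z * x = x * z" for x
    using arg_cong[OF that, of adj] by simp
  show "cm (adj z)"
    unfolding cm_def
  proof (intro conjI allI impI)
    fix i assume i: "i < n"
    show "adj z * c i = c i * adj z" using 1[OF cmD(2)[OF z i]] by simp
    show "adj z * adj (c i) = adj (c i) * adj z" using 1[OF cmD(1)[OF z i]] .
  next
    fix j show "adj z * N j = N j * adj z" using 1[OF cmD(3)[OF z, of j]] by (simp add: N(1))
  qed
qed

lemma uu_comm:
  assumes "\<And>l. l < n \<Longrightarrow> z * f l = f l * z" "\<And>l. l < n \<Longrightarrow> adj (f l) = f l"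
  shows "z * uu f k = uu f k * z" "z * adj (uu f k) = adj (uu f k) * z"
  using assms unfolding uu_def comb_def by (simp_all add: sum_distrib_left sum_distrib_right)

lemma F_comm:
  assumes z: "cm z" and zb: "\<And>l. l < n \<Longrightarrow> z * b l = b l * z" and l: "l < n"
  shows "z * F l = F l * z"
proof -
  have zW: "z * W = W * z" by (rule W_comm) (use z in \<open>auto simp: cm_def\<close>)
  have "z * fl j l = fl j l * z" if "l < n" for j l
    using that
  proof (induction j arbitrary: l)
    case 0
    then show ?case by (simp add: mult.assoc zb cmD(3)[OF z, of 0, THEN amul])
  next
    case (Suc j)
    have fa: "adj (fl j l) = fl j l" if "l < n" for l using pouD(1)[OF fl that] .
    have 1: "z * psi (fl j) l = psi (fl j) l * z"
      unfolding psi_def using uu_comm(2)[OF Suc.IH fa] cmD(1)[OF z, THEN amul]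
      by (simp add: sum_distrib_left sum_distrib_right mult.assoc)
    have 2: "z * adj (psi (fl j) l) = adj (psi (fl j) l) * z"
      unfolding psi_def using uu_comm(1)[OF Suc.IH fa, THEN amul] cmD(2)[OF z]
      by (simp add: sum_distrib_left sum_distrib_right mult.assoc)
    have 3: "z * (N (Suc j) * W * b l) = N (Suc j) * W * b l * z"
      using cmD(3)[OF z, of "Suc j", THEN amul] zW[THEN amul] zb[OF Suc.prems] by (simp add: mult.assoc)
    have 4: "z * (psi (fl j) l * adj (psi (fl j) l)) = psi (fl j) l * adj (psi (fl j) l) * z"
      using 1[THEN amul] 2 by (simp add: mult.assoc)
    show ?case using 3 4 by (simp add: distrib_left distrib_right)
  qed
  note fz = this
  show ?thesis
  proof (rule lev_ext)
    fix j
    have "z * F l * N j = z * fl j l" using l by (simp add: F_N mult.assoc)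
    also have "\<dots> = F l * (N j * z)" using l fz[OF l] by (simp add: F_N flip: mult.assoc)
    finally show "z * F l * N j = F l * z * N j" using cmD(3)[OF z, of j] by (simp add: mult.assoc)
  qed
qed

text \<open>Compressing \<open>z\<close> by \<open>psi (fl j) l\<close> averages its conjugates by
  the \<open>uu (fl j) k\<close>, hence gives its pinching on the level below; by induction that is
  the scalar \<open>t\<close> there.\<close>

lemma F_z_F:
  assumes z: "cm z" and bzb: "\<And>l. l < n \<Longrightarrow> b l * z * b l = t *\<^sub>C b l" and l: "l < n"
  shows "F l * z * F l = t *\<^sub>C F l"
proof -
  have zW: "z * W = W * z" by (rule W_comm) (use z in \<open>auto simp: cm_def\<close>)
  have "fl j l * z * fl j l = t *\<^sub>C fl j l" if "l < n" for j l
    using that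
  proof (induction j arbitrary: l)
    case 0
    have "fl 0 l * z * fl 0 l = (N 0 * N 0) * (b l * z * b l)"
      using b_N[OF 0, of 0, THEN amul] b_N[OF 0, of 0] cmD(3)[OF z, of 0, THEN amul] by (simp add: mult.assoc)
    then show ?case using bzb[OF 0] by (simp add: N(2))
  next
    case (Suc j)
    let ?N = "N (Suc j)" and ?p = "psi (fl j) l"
    have A: "?N * W * b l * z * (?N * W * b l) = (?N * ?N) * ((W * W) * (b l * z * b l))"
      using b_N[OF Suc.prems, of "Suc j", THEN amul] b_W[OF Suc.prems, THEN amul] cmD(3)[OF z, of "Suc j", THEN amul]
        zW[THEN amul] N_W[of "Suc j", THEN amul] by (simp add: mult.assoc)
    have B: "?N * W * b l * z * ?p = 0"
    proof -
      have "?N * W * b l * z * ?p = ?N * (b l * (z * (W * ?p)))"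
        using b_W[OF Suc.prems, THEN amul] zW[THEN amul] by (simp add: mult.assoc)
      then show ?thesis using psi_psi(3)[OF fl[of j] Suc.prems Suc.prems] by simp
    qed
    have C: "adj ?p * z * (?N * W * b l) = 0"
    proof -
      have "adj ?p * z * (?N * W * b l) = adj (W * ?p) * z * ?N * b l"
        using zW[THEN amul] N_W[of "Suc j", THEN amul] by (simp add: mult.assoc W(2))
      then show ?thesis using psi_psi(3)[OF fl[of j] Suc.prems Suc.prems] by simp
    qed
    have "adj ?p * z * ?p = (1 / of_nat n) *\<^sub>C (\<Sum>k<n. (cnj (h l k) * h l k) *\<^sub>C (uu (fl j) k * z * adj (uu (fl j) k)))"
      by (rule psi_z_psi[OF fl[of j] Suc.prems Suc.prems cmD(1)[OF z]])
    also have "(\<Sum>k<n. (cnj (h l k) * h l k) *\<^sub>C (uu (fl j) k * z * adj (uu (fl j) k))) = (\<Sum>k<n. uu (fl j) k * z * adj (uu (fl j) k))"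
      by (intro sum.cong refl) (simp add: hmatD(3)[OF h Suc.prems])
    also have "(1 / of_nat n) *\<^sub>C (\<Sum>k<n. uu (fl j) k * z * adj (uu (fl j) k)) = (\<Sum>m<n. fl j m * z * fl j m)"
      unfolding sum_uu_conj[OF fl[of j]] using n by simp
    also have "\<dots> = t *\<^sub>C N j"
      using Suc.IH pouD(6)[OF fl[of j] n] by (simp add: csc.scale_sum_right[symmetric])
    finally have D: "adj ?p * z * ?p = t *\<^sub>C N j" .
    have "fl (Suc j) l * z * fl (Suc j) l = ?N * W * b l * z * (?N * W * b l) + ?N * W * b l * z * ?p * adj ?p +
       ?p * (adj ?p * z * (?N * W * b l)) + ?p * (adj ?p * z * ?p) * adj ?p"
      by (simp add: distrib_left distrib_right mult.assoc)
    also have "\<dots> = t *\<^sub>C fl (Suc j) l"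
      unfolding A B C D using bzb[OF Suc.prems] psi_psi(2)[OF fl[of j] Suc.prems Suc.prems] W(3)
      by (simp add: N(2) csc.scale_right_distrib mult.assoc[symmetric])
    finally show ?case .
  qed
  note fzf = this
  show ?thesis
  proof (rule lev_ext)
    fix j
    have "F l * z * F l * N j = F l * z * (N j * fl j l)"
      using l pouD(5)[OF fl[of j] l] by (simp add: F_N mult.assoc)
    also have "\<dots> = F l * N j * z * fl j l"
      using cmD(3)[OF z, of j, THEN amul] by (simp add: mult.assoc)
    also have "\<dots> = t *\<^sub>C fl j l"
      using l fzf[OF l] by (simp add: F_N)
    finally show "F l * z * F l * N j = t *\<^sub>C F l * N j"
      using l by (simp add: F_N)
  qed
qed

text \<open>The induction hypothesis and column orthogonality of \<open>h\<close> make
  \<open>y * (adj (uu (fl j) k) * uu (fl j) m) * y\<close> vanish for different \<open>k\<close> and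
  \<open>m\<close>. Only the diagonal terms of \<open>psi\<close> times its adjoint survive, and
  these no longer see the phases.\<close>

lemma y_F_y:
  assumes y: "cm y" and yby: "\<And>l. l < n \<Longrightarrow> y * b l * y = t *\<^sub>C y" and l: "l < n"
  shows "y * F l * y = t *\<^sub>C y"
proof -
  have yW: "y * W = W * y" by (rule W_comm) (use y in \<open>auto simp: cm_def\<close>)
  have "y * fl j l * y = t *\<^sub>C (N j * y)" if "l < n" for j l
    using that
  proof (induction j arbitrary: l)
    case 0
    have "y * fl 0 l * y = N 0 * (y * b l * y)"
      using cmD(3)[OF y, of 0, THEN amul] by (simp add: mult.assoc)
    then show ?case using yby[OF 0] by simp
  next
    case (Suc j)
    let ?N = "N (Suc j)" and ?p = "psi (fl j) l" and ?u = "uu (fl j)"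
    have A: "y * (?N * W * b l) * y = t *\<^sub>C (?N * W * y)"
    proof -
      have "y * (?N * W * b l) * y = ?N * W * (y * b l * y)"
        using cmD(3)[OF y, of "Suc j", THEN amul] yW[THEN amul] by (simp add: mult.assoc)
      then show ?thesis using yby[OF Suc.prems] by simp
    qed
    have uyu: "y * (adj (?u k) * ?u m) * y = (if k = m then (t * of_nat n) *\<^sub>C (N j * y) else 0)" if "k < n" "m < n" for k m
    proof -
      have "y * (adj (?u k) * ?u m) * y = (\<Sum>r<n. (cnj (h r k) * h r m) *\<^sub>C (y * fl j r * y))"
        unfolding uu(7)[OF fl[of j] that] by (simp add: sum_distrib_left sum_distrib_right)
      also have "\<dots> = (\<Sum>r<n. h r m * cnj (h r k)) *\<^sub>C (t *\<^sub>C (N j * y))"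
        unfolding csc.scale_sum_left using Suc.IH by (intro sum.cong refl) (simp add: mult.commute)
      finally show ?thesis
        using hmatD(5)[OF h that(2,1)] by (auto simp: mult.commute)
    qed
    have "y * (?p * adj ?p) * y = (1 / of_nat n) *\<^sub>C (\<Sum>k<n. \<Sum>m<n. (h l k * cnj (h l m)) *\<^sub>C (c k * (y * (adj (?u k) * ?u m) * y) * adj (c m)))"
      unfolding psi_adj_psi[OF fl[of j] Suc.prems]
      by (intro arg_cong[where f = "\<lambda>x. _ *\<^sub>C x"] sum.cong refl)
         (simp add: cmD(1)[OF y, THEN amul] cmD(2)[OF y, symmetric] mult.assoc)
    also have "(\<Sum>k<n. \<Sum>m<n. (h l k * cnj (h l m)) *\<^sub>C (c k * (y * (adj (?u k) * ?u m) * y) * adj (c m))) =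
        (\<Sum>k<n. \<Sum>m<n. if m = k then (t * of_nat n) *\<^sub>C (c k * (N j * y) * adj (c k)) else 0)"
      using uyu hmatD(2)[OF h Suc.prems] by (intro sum.cong refl) auto
    also have "\<dots> = (t * of_nat n) *\<^sub>C (\<Sum>k<n. c k * (N j * y) * adj (c k))"
      by (simp add: csc.scale_sum_right)
    also have "(\<Sum>k<n. c k * (N j * y) * adj (c k)) = ?N * (\<Sum>k<n. c k * adj (c k)) * y"
      unfolding sum_distrib_left sum_distrib_right
      by (intro sum.cong refl) (simp add: c_N[THEN amul] cmD(2)[OF y] mult.assoc)
    finally have B: "y * (?p * adj ?p) * y = t *\<^sub>C (?N * (\<Sum>k<n. c k * adj (c k)) * y)"
      using n by simp
    have "y * fl (Suc j) l * y = t *\<^sub>C (?N * W * y) + t *\<^sub>C (?N * (\<Sum>k<n. c k * adj (c k)) * y)"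
      using A B by (simp add: distrib_left distrib_right)
    also have "\<dots> = t *\<^sub>C (?N * y)"
      by (simp add: W_def right_diff_distrib left_diff_distrib csc.scale_right_distrib csc.scale_right_diff_distrib)
    finally show ?case .
  qed
  note yfy = this
  show ?thesis
  proof (rule lev_ext)
    fix j
    have "y * F l * y * N j = y * (F l * N j) * y"
      using cmD(3)[OF y, of j] by (simp add: mult.assoc)
    also have "\<dots> = t *\<^sub>C (N j * y)"
      using l yfy[OF l] by (simp add: F_N)
    finally show "y * F l * y * N j = t *\<^sub>C y * N j"
      using cmD(3)[OF y, of j] by simp
  qed
qed

text \<open>Covariance has a dual form. By definition, conjugation by unitaries made of
  \<open>F\<close> makes the \<open>a k\<close> independent of \<open>k\<close>; here unitaries made
  of \<open>a\<close>, with conjugate coefficients, make the \<open>F l\<close> independent of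
  \<open>l\<close>.\<close>

lemma cov_conj_const:
  assumes a: "cov a" "pou n E a" and lm: "l < n" "r < n"
  defines "u \<equiv> \<lambda>l. comb n (\<lambda>k. cnj (h l k)) a"
  shows "u l * F l * adj (u l) = u r * F r * adj (u r)"
proof -
  obtain Y where Y: "\<And>k. k < n \<Longrightarrow> a k = adj (U k) * Y * U k"
    using a by (metis covE)
  have FaF: "F l * a k * F r = (cnj (h l k) * h r k) *\<^sub>C (F l * Y * F r)" if "l < n" "r < n" "k < n" for l r k
  proof -
    have "F l * a k * F r = (F l * adj (U k)) * Y * (U k * F r)"
      by (simp add: Y[OF that(3)] mult.assoc)
    then show ?thesis
      by (simp add: U_def uu[OF F] that mult.commute)
  qed
  have uu: "adj (u l) * u r = comb n (\<lambda>k. h l k * cnj (h r k)) a" for l r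
    unfolding u_def comb(3,4)[OF a(2)] by simp
  \<comment> \<open>When one outer index matches, two of the four phases cancel and the rest is an
    inner product of two rows of \<open>h\<close>. Both sides of the commutation in \<open>2\<close>
    thereby reduce to the same single term.\<close>
  have 1: "F s * (adj (u l) * u r) * F s' = (if s = l \<and> s' = r then of_nat n *\<^sub>C (F l * Y * F r) else 0)"
    if "l < n" "r < n" "s < n" "s' < n" "s = l \<or> s' = r" for l r s s'
  proof -
    have "F s * (adj (u l) * u r) * F s' = (\<Sum>k<n. (h l k * cnj (h r k) * (cnj (h s k) * h s' k)) *\<^sub>C (F s * Y * F s'))"
      unfolding uu comb_def sum_distrib_left sum_distrib_right
      by (intro sum.cong refl) (simp add: FaF that)
    also have "\<dots> = (\<Sum>k<n. (if s = l then h s' k * cnj (h r k) else h l k * cnj (h s k)) *\<^sub>C (F s * Y * F s'))"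
      using that hmatD(2,3)[OF h] by (intro sum.cong refl arg_cong[where f = "\<lambda>t. t *\<^sub>C (F s * Y * F s')"]) (auto simp: mult_ac)
    also have "\<dots> = (if s = l then \<Sum>k<n. h s' k * cnj (h r k) else \<Sum>k<n. h l k * cnj (h s k)) *\<^sub>C (F s * Y * F s')"
      by (simp add: csc.scale_sum_left)
    also have "\<dots> = (if s = l \<and> s' = r then of_nat n *\<^sub>C (F l * Y * F r) else 0)"
      using that hmatD(4)[OF h] by auto
    finally show ?thesis .
  qed
  have 2: "F l * (adj (u l) * u r) = adj (u l) * u r * F r" if "l < n" "r < n" for l r
  proof -
    have "F l * (adj (u l) * u r) = (\<Sum>s<n. F l * (adj (u l) * u r) * F s)"
      using pouD(6)[OF F n] by (simp flip: sum_distrib_left)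
    also have "\<dots> = (\<Sum>s<n. if s = r then of_nat n *\<^sub>C (F l * Y * F r) else 0)"
      by (intro sum.cong refl) (simp add: 1 that)
    also have "\<dots> = (\<Sum>s<n. if s = l then of_nat n *\<^sub>C (F l * Y * F r) else 0)"
      using that by simp
    also have "\<dots> = (\<Sum>s<n. F s * (adj (u l) * u r) * F r)"
      by (intro sum.cong refl) (simp add: 1 that)
    also have "\<dots> = adj (u l) * u r * F r"
      using pouD(6)[OF F n] by (simp flip: sum_distrib_right)
    finally show ?thesis .
  qed
  have uE: "u l * adj (u l) = E" "E * u l = u l" "u l * E = u l" if "l < n" for l
  proof -
    show "u l * adj (u l) = E"
      unfolding u_def comb(3,4)[OF a(2)] using hmatD(2,3)[OF h that] by (intro comb(5)[OF a(2)]) simp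
    show "E * u l = u l" "u l * E = u l"
      unfolding u_def comb_def sum_distrib_left sum_distrib_right
      using pouD(4,5)[OF a(2)] by (auto intro!: sum.cong)
  qed
  have "E = adj E"
    using uE(1)[OF lm(1)] by (metis adj_adj adj_times)
  then have "adj (u l) * E = adj (u l)"
    using arg_cong[OF uE(2)[OF lm(1)], of adj] by simp
  then have "u l * F l * adj (u l) = u l * F l * adj (u l) * (u r * adj (u r))"
    by (simp add: uE lm mult.assoc)
  also have "\<dots> = u l * (F l * (adj (u l) * u r)) * adj (u r)"
    by (simp add: mult.assoc)
  also have "\<dots> = (u l * adj (u l)) * u r * F r * adj (u r)"
    unfolding 2[OF lm] by (simp add: mult.assoc)
  finally show ?thesis
    by (simp add: uE lm)
qed

end

section \<open>Projections along a tower\<close>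

text \<open>At level 0 every \<open>P k\<close> is the unit, so the invariant \<open>qinv\<close>
  requires n times the square of the parameter to equal the parameter: 0 and 1 / n are the possible
  starts.\<close>

locale qtower = tower lev n h c b for lev :: "'a \<Rightarrow> nat" and n h c b +
  fixes \<iota> :: "nat \<Rightarrow> real"
  assumes \<iota>0: "\<iota> 0 = 0 \<or> \<iota> 0 = 1 / n"
    and \<iota>1: "\<And>j. 0 \<le> \<iota> j" "\<And>j. \<iota> j < 1"
    and \<iota>S: "\<And>j. \<iota> (Suc j) * (n - 1 / (1 - \<iota> j)) = 1"
begin

text \<open>Let \<open>A\<close> be \<open>cA P\<close>, so that \<open>adj A * A\<close> is the sum of the \<open>P k\<close>. As this sum times \<open>\<iota> j\<close> is the unit \<open>Q\<close> of the
  \<open>P k\<close> (or \<open>\<iota> j = 0\<close>), \<open>sqrt (\<iota> j)\<close> times \<open>A\<close> is a partial isometry, and \<open>qnext\<close> removes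
  its range from that of the sum of the \<open>c k * P k * adj (c k)\<close>. Then \<open>pnext\<close> is what is orthogonal to the range of
  \<open>Q * c k\<close>, and counting shows that the parameter of the next level is the one in \<open>\<iota>S\<close>.\<close>

abbreviation i :: "nat \<Rightarrow> complex" where "i j \<equiv> complex_of_real (\<iota> j)"

definition cA :: "(nat \<Rightarrow> 'a bop) \<Rightarrow> 'a bop" where "cA P = (\<Sum>k<n. c k * P k)"

definition qnext :: "complex \<Rightarrow> (nat \<Rightarrow> 'a bop) \<Rightarrow> 'a bop" where
  "qnext t P = (\<Sum>k<n. c k * P k * adj (c k)) - t *\<^sub>C (cA P * adj (cA P))"

definition pnext :: "complex \<Rightarrow> (nat \<Rightarrow> 'a bop) \<Rightarrow> nat \<Rightarrow> 'a bop" where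
  "pnext t P k = qnext t P - (1 / (1 - t)) *\<^sub>C (qnext t P * c k * adj (c k) * qnext t P)"

primrec QP :: "nat \<Rightarrow> 'a bop \<times> (nat \<Rightarrow> 'a bop)" where
  "QP 0 = (N 0, \<lambda>_. N 0)"
| "QP (Suc j) = (qnext (i j) (snd (QP j)), pnext (i j) (snd (QP j)))"

text \<open>The factor \<open>t * t\<close> keeps the case \<open>t = 0\<close>, where nothing is known about the sum.\<close>

definition qinv :: "nat \<Rightarrow> complex \<Rightarrow> 'a bop \<Rightarrow> (nat \<Rightarrow> 'a bop) \<Rightarrow> bool" where
  "qinv j t Q P \<longleftrightarrow> is_proj Q \<and> N j * Q = Q \<and> (\<forall>k<n. is_proj (P k) \<and> Q * P k = P k) \<and>
     (t * t) *\<^sub>C (\<Sum>k<n. P k) = t *\<^sub>C Q"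

text \<open>One step of the recursion. Everything rests on \<open>adj (c k) * cA P = P k\<close>,
  which gives \<open>qnext t P * c k = c k * P k - t *\<^sub>C (cA P * P k)\<close>.\<close>

lemma
  assumes inv: "qinv j t Q P" and t: "cnj t = t" "t \<noteq> 1"
  shows qnext_c_c: "\<And>k m. k < n \<Longrightarrow> m < n \<Longrightarrow> adj (c k) * qnext t P * c m = (if k = m then P k else 0) - t *\<^sub>C (P k * P m)"
    and qnext_c_P: "\<And>k. k < n \<Longrightarrow> qnext t P * c k * P k = qnext t P * c k"
    and qnext_cA: "t *\<^sub>C (qnext t P * cA P) = 0"
    and qnext_proj: "is_proj (qnext t P)" "N (Suc j) * qnext t P = qnext t P"
    and pnext_proj: "\<And>k. k < n \<Longrightarrow> is_proj (pnext t P k)" "\<And>k. k < n \<Longrightarrow> qnext t P * pnext t P k = pnext t P k"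
    and pnext_qnext_c: "\<And>k. k < n \<Longrightarrow> pnext t P k * qnext t P * c k = 0"
    and qnext_cc_qnext: "\<And>k. k < n \<Longrightarrow> qnext t P * c k * adj (c k) * qnext t P = (1 - t) *\<^sub>C (qnext t P - pnext t P k)"
    and sum_qnext_cc: "(\<Sum>k<n. qnext t P * c k * adj (c k) * qnext t P) = qnext t P"
    and sum_pnext: "(\<Sum>k<n. pnext t P k) = (of_nat n - 1 / (1 - t)) *\<^sub>C qnext t P"
proof -
  let ?A = "cA P" and ?S = "\<Sum>k<n. c k * P k * adj (c k)" and ?Q = "qnext t P"
  have P: "adj (P k) = P k" "P k * P k = P k" "Q * P k = P k" "P k * Q = P k" if "k < n" for k
  proof -
    show 1: "adj (P k) = P k" "P k * P k = P k" "Q * P k = P k"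
      using inv that by (auto simp: qinv_def is_proj_def)
    have "adj Q = Q" using inv by (simp add: qinv_def is_proj_def)
    then show "P k * Q = P k" using arg_cong[OF 1(3), of adj] 1(1) by simp
  qed
  have Q: "adj Q = Q" "Q * Q = Q" "N j * Q = Q"
    using inv by (auto simp: qinv_def is_proj_def)
  have cA: "adj (c k) * ?A = P k" if "k < n" for k
  proof -
    have "adj (c k) * ?A = (\<Sum>m<n. if m = k then P k else 0)"
      unfolding cA_def sum_distrib_left using that
      by (intro sum.cong refl) (auto simp: c_iso[THEN amul])
    then show ?thesis using that by simp
  qed
  have Ac: "adj ?A * c k = P k" if "k < n" for k
    using arg_cong[OF cA[OF that], of adj] P(1)[OF that] by simp
  have Sc: "?S * c k = c k * P k" if "k < n" for k
  proof -
    have "?S * c k = (\<Sum>m<n. if m = k then c k * P k else 0)"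
      unfolding sum_distrib_right using that by (intro sum.cong refl) (auto simp: mult.assoc c_iso)
    then show ?thesis using that by simp
  qed
  have Qc: "?Q * c k = c k * P k - t *\<^sub>C (?A * P k)" if "k < n" for k
    unfolding qnext_def using Sc[OF that] Ac[OF that] by (simp add: left_diff_distrib mult.assoc)
  have adjA: "adj ?A = (\<Sum>k<n. P k * adj (c k))"
    unfolding cA_def using P(1) by simp
  show QcP: "?Q * c k * P k = ?Q * c k" if "k < n" for k
    unfolding Qc[OF that] using P(2)[OF that] by (simp add: left_diff_distrib mult.assoc)
  have AQ: "?A * Q = ?A"
    unfolding cA_def sum_distrib_right using P(4) by (simp add: mult.assoc)
  have QA: "?Q * ?A = ?A - t *\<^sub>C (?A * (\<Sum>k<n. P k))"
  proof -
    have "?Q * ?A = (\<Sum>k<n. ?Q * c k * P k)"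
      unfolding cA_def sum_distrib_left by (simp add: mult.assoc)
    also have "\<dots> = (\<Sum>k<n. c k * P k - t *\<^sub>C (?A * P k))"
      by (intro sum.cong refl trans[OF QcP Qc]) simp_all
    finally show ?thesis
      by (simp add: sum_subtractf cA_def[symmetric] sum_distrib_left csc.scale_sum_right)
  qed
  show tQA: "t *\<^sub>C (?Q * ?A) = 0"
  proof -
    \<comment> \<open>The extra factor \<open>t\<close> produces the square in the invariant, so the
      case \<open>t = 0\<close> needs no separate treatment.\<close>
    have "t *\<^sub>C (?Q * ?A) = t *\<^sub>C ?A - ?A * ((t * t) *\<^sub>C (\<Sum>k<n. P k))"
      unfolding QA by (simp add: csc.scale_right_diff_distrib)
    also have "(t * t) *\<^sub>C (\<Sum>k<n. P k) = t *\<^sub>C Q"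
      using inv by (simp add: qinv_def)
    finally show ?thesis by (simp add: AQ)
  qed
  show ccQ: "adj (c k) * ?Q * c m = (if k = m then P k else 0) - t *\<^sub>C (P k * P m)" if "k < n" "m < n" for k m
    using Qc[OF that(2)] c_iso[OF that, THEN amul] cA[OF that(1), THEN amul]
    by (auto simp: mult.assoc right_diff_distrib)
  have aQ: "adj ?Q = ?Q"
    unfolding qnext_def using t(1) P(1) by (simp add: mult.assoc)
  have QQ: "?Q * ?Q = ?Q"
  proof -
    have "?Q * ?S = (\<Sum>k<n. (?Q * c k * P k) * adj (c k))"
      by (simp add: sum_distrib_left mult.assoc)
    also have "\<dots> = (\<Sum>k<n. c k * P k * adj (c k) - t *\<^sub>C (?A * (P k * adj (c k))))"
      by (intro sum.cong refl, subst trans[OF QcP Qc]) (simp_all add: left_diff_distrib mult.assoc)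
    also have "\<dots> = ?Q"
      by (simp add: sum_subtractf csc.scale_sum_right[symmetric] sum_distrib_left[symmetric] adjA[symmetric] qnext_def)
    finally have QS: "?Q * ?S = ?Q" .
    have "?Q * ?Q = ?Q * ?S - (t *\<^sub>C (?Q * ?A)) * adj ?A"
      by (subst (2) qnext_def) (simp add: right_diff_distrib mult.assoc)
    then show ?thesis by (simp add: QS tQA)
  qed
  show "is_proj ?Q" using aQ QQ by (simp add: is_proj_def)
  have NP: "N j * P k = P k" if "k < n" for k
    using P(3)[OF that] Q(3) by (metis mult.assoc)
  have NcP: "N (Suc j) * (c k * P k) = c k * P k" if "k < n" for k
    using c_N[OF that, of j, symmetric, THEN amul, of "P k"] NP[OF that] by (simp add: mult.assoc)
  show "N (Suc j) * ?Q = ?Q"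
  proof -
    have "N (Suc j) * ?S = ?S"
      unfolding sum_distrib_left using NcP[THEN amul]
      by (intro sum.cong refl) (metis NcP lessThan_iff mult.assoc)
    moreover have "N (Suc j) * ?A = ?A"
      unfolding cA_def sum_distrib_left using NcP by (intro sum.cong refl) simp
    ultimately show ?thesis
      unfolding qnext_def by (simp add: right_diff_distrib mult.assoc[symmetric])
  qed
  \<comment> \<open>Since \<open>adj (c k) * qnext t P * c k\<close> is
    \<open>(1 - t) *\<^sub>C P k\<close>, the positive operator \<open>?G k\<close> is
    \<open>1 - t\<close> times a projection, namely onto the range of
    \<open>qnext t P * c k\<close>; \<open>pnext\<close> is its complement.\<close>
  let ?G = "\<lambda>k. ?Q * c k * adj (c k) * ?Q"
  have t1: "1 - t \<noteq> 0" using t by simp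
  have GQc: "?G k * c k = (1 - t) *\<^sub>C (?Q * c k)" if "k < n" for k
  proof -
    have "?G k * c k = ?Q * c k * (adj (c k) * ?Q * c k)"
      by (simp add: mult.assoc)
    also have "\<dots> = ?Q * c k * P k - t *\<^sub>C (?Q * c k * P k)"
      unfolding ccQ[OF that that] by (simp add: right_diff_distrib P(2)[OF that])
    finally show ?thesis by (simp add: QcP[OF that] csc.scale_left_diff_distrib)
  qed
  have GG: "?G k * ?G k = (1 - t) *\<^sub>C ?G k" if "k < n" for k
  proof -
    have "?G k * ?G k = ?Q * c k * adj (c k) * (?Q * ?Q) * c k * adj (c k) * ?Q"
      by (simp add: mult.assoc)
    also have "\<dots> = ?G k * c k * adj (c k) * ?Q"
      by (simp only: QQ)
    finally show ?thesis by (simp only: GQc[OF that] csc_mult_left)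
  qed
  have QG: "?Q * ?G k = ?G k" "?G k * ?Q = ?G k" "adj (?G k) = ?G k" for k
    using QQ QQ[THEN amul] aQ by (simp_all add: mult.assoc)
  have pp: "pnext t P k * pnext t P k = pnext t P k" if "k < n" for k
  proof -
    have "pnext t P k * pnext t P k = ?Q - (1 / (1 - t)) *\<^sub>C ?G k - (1 / (1 - t)) *\<^sub>C ?G k + (1 / (1 - t) * (1 / (1 - t))) *\<^sub>C (?G k * ?G k)"
      unfolding pnext_def
      by (simp only: left_diff_distrib right_diff_distrib QG QQ csc_mult_left csc_mult_right csc.scale_scale csc.scale_right_diff_distrib)
         (simp add: algebra_simps)
    also have "\<dots> = pnext t P k"
      unfolding GG[OF that] pnext_def using t1 by simp
    finally show ?thesis .
  qed
  have ap: "adj (pnext t P k) = pnext t P k" for k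
    unfolding pnext_def using QG(3)[of k] aQ t(1) by (simp only: adj_minus adj_csc complex_cnj_divide complex_cnj_diff complex_cnj_one)
  show "is_proj (pnext t P k)" if "k < n" for k
    using pp[OF that] ap by (simp add: is_proj_def)
  show Qp: "?Q * pnext t P k = pnext t P k" if "k < n" for k
    unfolding pnext_def by (simp only: right_diff_distrib csc_mult_right QQ QG)
  have pQ: "pnext t P k * ?Q = pnext t P k" for k
    unfolding pnext_def by (simp only: left_diff_distrib csc_mult_left QQ QG)
  show "pnext t P k * ?Q * c k = 0" if "k < n" for k
    unfolding pQ unfolding pnext_def left_diff_distrib csc_mult_left GQc[OF that] using t1 by simp
  show "?G k = (1 - t) *\<^sub>C (?Q - pnext t P k)" if "k < n" for k
    unfolding pnext_def using t1 by simp
  have WQ: "W * ?Q = 0"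
  proof -
    have "W * ?S = 0" "W * ?A = 0"
      unfolding cA_def sum_distrib_left using W(1) by (simp_all add: mult.assoc[symmetric])
    then show ?thesis
      unfolding qnext_def by (simp add: right_diff_distrib mult.assoc[symmetric])
  qed
  show sumG: "(\<Sum>k<n. ?G k) = ?Q"
  proof -
    \<comment> \<open>The projections \<open>c k * adj (c k)\<close> add up to \<open>1 - W\<close>,
      and \<open>W\<close> kills \<open>qnext t P\<close>. This sum is the count that determines the
      sum of the \<open>pnext t P k\<close>.\<close>
    have "(\<Sum>k<n. ?G k) = ?Q * ((1 - W) * ?Q)"
      by (simp add: W_def sum_distrib_left sum_distrib_right mult.assoc)
    then show ?thesis by (simp add: left_diff_distrib WQ QQ)
  qed
  show "(\<Sum>k<n. pnext t P k) = (of_nat n - 1 / (1 - t)) *\<^sub>C ?Q"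
    unfolding pnext_def sum_subtractf csc.scale_sum_right[symmetric] sumG
    by (simp add: csc.scale_left_diff_distrib csc_of_nat)
qed

lemma i: "cnj (i j) = i j" "i j \<noteq> 1" "i (Suc j) * (of_nat n - 1 / (1 - i j)) = 1"
proof -
  show "i j \<noteq> 1" using \<iota>1(2)[of j] by simp
  have "i (Suc j) * (of_nat n - 1 / (1 - i j)) = complex_of_real (\<iota> (Suc j) * (n - 1 / (1 - \<iota> j)))"
    by simp
  then show "i (Suc j) * (of_nat n - 1 / (1 - i j)) = 1" using \<iota>S[of j] by simp
qed simp

lemma QP: "qinv j (i j) (fst (QP j)) (snd (QP j))"
proof (induction j)
  case 0
  have "i 0 * i 0 * of_nat n = i 0"
    using \<iota>0 n by auto
  then have "(i 0 * i 0) *\<^sub>C (of_nat n *\<^sub>C N 0) = i 0 *\<^sub>C N 0"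
    by (simp only: csc.scale_scale)
  then show ?case
    by (simp add: qinv_def N csc_of_nat)
next
  case (Suc j)
  note n = qnext_proj[OF Suc i(1,2)] pnext_proj[OF Suc i(1,2)] sum_pnext[OF Suc i(1,2)]
  have "(i (Suc j) * i (Suc j)) *\<^sub>C (\<Sum>k<n. pnext (i j) (snd (QP j)) k) =
      (i (Suc j) * (i (Suc j) * (of_nat n - 1 / (1 - i j)))) *\<^sub>C qnext (i j) (snd (QP j))"
    unfolding n(5) csc.scale_scale by (simp only: mult.assoc)
  then show ?case
    using n(1-4) unfolding qinv_def i(3) by simp
qed

section \<open>The projections of all levels put together\<close>

definition Q :: "'a bop" where "Q = asm (\<lambda>j. fst (QP j))"
definition Pr :: "nat \<Rightarrow> 'a bop" where "Pr k = asm (\<lambda>j. snd (QP j) k)"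
definition D :: "(nat \<Rightarrow> real) \<Rightarrow> 'a bop" where "D \<phi> = diag (\<lambda>x. of_real (\<phi> (lev x)))"

lemma D_N:
  assumes "\<And>j. \<bar>\<phi> j\<bar> \<le> C"
  shows "D \<phi> * N j = complex_of_real (\<phi> j) *\<^sub>C N j" "N j * D \<phi> = complex_of_real (\<phi> j) *\<^sub>C N j" "adj (D \<phi>) = D \<phi>"
proof -
  have b: "cmod (complex_of_real (\<phi> (lev x))) \<le> C" for x using assms by simp
  note d = diag[where \<phi> = "\<lambda>x. complex_of_real (\<phi> (lev x))", OF b]
  show "D \<phi> * N j = complex_of_real (\<phi> j) *\<^sub>C N j" "N j * D \<phi> = complex_of_real (\<phi> j) *\<^sub>C N j"
    unfolding D_def N_def by (rule bop_eqI, rule ell2_eqI, simp add: d(1))+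
  show "adj (D \<phi>) = D \<phi>"
    unfolding D_def d(2) by simp
qed

lemma Q_N: "Q * N j = fst (QP j)" "N j * Q = fst (QP j)"
proof -
  have "blocks (\<lambda>j. fst (QP j))"
    using QP by (intro blocks_proj) (auto simp: qinv_def)
  then show "Q * N j = fst (QP j)" "N j * Q = fst (QP j)"
    unfolding Q_def by (rule asm)+
qed

lemma Pr_N:
  assumes k: "k < n"
  shows "Pr k * N j = snd (QP j) k" "N j * Pr k = snd (QP j) k"
proof -
  have "N j * snd (QP j) k = snd (QP j) k" for j
  proof -
    have "N j * fst (QP j) = fst (QP j)" "fst (QP j) * snd (QP j) k = snd (QP j) k"
      using QP[of j] k by (auto simp: qinv_def)
    then show ?thesis by (metis mult.assoc)
  qed
  then have "blocks (\<lambda>j. snd (QP j) k)"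
    using QP k by (intro blocks_proj) (auto simp: qinv_def)
  then show "Pr k * N j = snd (QP j) k" "N j * Pr k = snd (QP j) k"
    unfolding Pr_def by (rule asm)+
qed

lemma Q_proj: "adj Q = Q" "Q * Q = Q" "Q * N j = N j * Q"
proof -
  have q: "adj (fst (QP j)) = fst (QP j)" "fst (QP j) * fst (QP j) = fst (QP j)" for j
    using QP[of j] by (auto simp: qinv_def is_proj_def)
  show "adj Q = Q"
  proof (rule lev_ext)
    fix j
    have "adj Q * N j = adj (N j * Q)" by (simp add: N(1))
    then show "adj Q * N j = Q * N j" by (simp add: Q_N q)
  qed
  show "Q * Q = Q"
    by (rule lev_ext) (simp only: lev_mult[OF Q_N(1) Q_N] q Q_N)
  show "Q * N j = N j * Q" by (simp add: Q_N)
qed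

lemma Pr_proj:
  assumes k: "k < n"
  shows "adj (Pr k) = Pr k" "Pr k * Pr k = Pr k" "Pr k * N j = N j * Pr k" "Q * Pr k = Pr k" "Pr k * Q = Pr k"
proof -
  have p: "adj (snd (QP j) k) = snd (QP j) k" "snd (QP j) k * snd (QP j) k = snd (QP j) k"
    "fst (QP j) * snd (QP j) k = snd (QP j) k" for j
    using QP[of j] k by (auto simp: qinv_def is_proj_def)
  show a: "adj (Pr k) = Pr k"
  proof (rule lev_ext)
    fix j
    have "adj (Pr k) * N j = adj (N j * Pr k)" by (simp add: N(1))
    then show "adj (Pr k) * N j = Pr k * N j" by (simp add: Pr_N[OF k] p)
  qed
  show "Pr k * N j = N j * Pr k" by (simp add: Pr_N[OF k])
  show "Pr k * Pr k = Pr k"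
    by (rule lev_ext) (simp only: lev_mult[OF Pr_N(1)[OF k] Pr_N[OF k]] p Pr_N[OF k])
  show QP': "Q * Pr k = Pr k"
    by (rule lev_ext) (simp only: lev_mult[OF Q_N(1) Pr_N[OF k]] p Pr_N[OF k])
  show "Pr k * Q = Pr k"
    using arg_cong[OF QP', of adj] a Q_proj(1) by simp
qed

definition io :: "'a bop" where "io = D \<iota>"
text \<open>The parameter of the level below. Truncated subtraction gives \<open>\<iota> 0\<close>
  at level 0, which does no harm where \<open>im\<close> multiplies \<open>Q - Pr k\<close>, as this
  difference vanishes there.\<close>

definition im :: "'a bop" where "im = D (\<lambda>j. \<iota> (j - 1))"
definition si :: "'a bop" where "si = D (\<lambda>j. sqrt (\<iota> j))"

lemma \<iota>_bound: "\<bar>\<iota> j\<bar> \<le> 1" "\<bar>sqrt (\<iota> j)\<bar> \<le> 1"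
  using \<iota>1[of j] by simp_all

lemmas io_N = D_N[where \<phi> = \<iota> and C = 1, OF \<iota>_bound(1), folded io_def]
lemmas im_N = D_N[where \<phi> = "\<lambda>j. \<iota> (j - 1)" and C = 1, OF \<iota>_bound(1), folded im_def]
lemmas si_N = D_N[where \<phi> = "\<lambda>j. sqrt (\<iota> j)" and C = 1, OF \<iota>_bound(2), folded si_def]

lemma si_si: "si * si = io"
proof (rule lev_ext)
  fix j
  have "complex_of_real (sqrt (\<iota> j)) * complex_of_real (sqrt (\<iota> j)) = i j"
    using \<iota>1(1)[of j] by (simp flip: of_real_mult)
  then show "si * si * N j = io * N j"
    by (simp add: mult.assoc si_N io_N)
qed

lemma D_comm:
  assumes "\<And>j. \<bar>\<phi> j\<bar> \<le> C" "\<And>j. z * N j = N j * z"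
  shows "z * D \<phi> = D \<phi> * z"
proof (rule lev_ext)
  fix j
  note d = D_N[where \<phi> = \<phi> and C = C, OF assms(1)]
  have "z * D \<phi> * N j = complex_of_real (\<phi> j) *\<^sub>C (z * N j)"
    by (simp add: mult.assoc d)
  also have "\<dots> = D \<phi> * N j * z"
    using assms(2)[of j] by (simp add: d)
  finally show "z * D \<phi> * N j = D \<phi> * z * N j"
    using assms(2)[of j] by (simp add: mult.assoc)
qed

lemma io_comm: "(\<And>j. z * N j = N j * z) \<Longrightarrow> z * io = io * z"
  and im_comm: "(\<And>j. z * N j = N j * z) \<Longrightarrow> z * im = im * z"
  and si_comm: "(\<And>j. z * N j = N j * z) \<Longrightarrow> z * si = si * z"
  unfolding io_def im_def si_def
  by (rule D_comm[where C = 1]; simp only: \<iota>_bound)+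

lemma io_lev: "X * N j = N j * X \<Longrightarrow> io * X * N j = i j *\<^sub>C (X * N j)"
  by (simp add: mult.assoc io_N(1)[THEN amul])

lemma QP_Suc_Q: "Q * c k * N j = fst (QP (Suc j)) * c k" if "k < n"
proof -
  have "Q * c k * N j = Q * N (Suc j) * c k"
    using c_N[OF that, of j] by (simp only: mult.assoc)
  then show ?thesis by (simp only: Q_N)
qed

lemma adj_c_Q_c:
  assumes "k < n" "m < n"
  shows "adj (c k) * Q * c m = (if k = m then Pr k else 0) - io * Pr k * Pr m"
proof (rule lev_ext)
  fix j
  have "adj (c k) * Q * c m * N j = adj (c k) * (Q * c m * N j)"
    by (simp only: mult.assoc)
  also have "\<dots> = adj (c k) * fst (QP (Suc j)) * c m"
    unfolding QP_Suc_Q[OF assms(2)] by (rule mult.assoc[symmetric])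
  also have "\<dots> = (if k = m then snd (QP j) k else 0) - i j *\<^sub>C (snd (QP j) k * snd (QP j) m)"
    using qnext_c_c[OF QP[of j] i(1,2) assms] by simp
  also have "snd (QP j) k * snd (QP j) m = Pr k * Pr m * N j"
    by (simp only: lev_mult[OF Pr_N(1)[OF assms(1)] Pr_N[OF assms(2)]])
  also have "i j *\<^sub>C (Pr k * Pr m * N j) = io * (Pr k * Pr m) * N j"
    by (rule io_lev[symmetric]) (simp add: mult.assoc Pr_proj(3)[OF assms(2)] Pr_proj(3)[OF assms(1), THEN amul])
  also have "snd (QP j) k = Pr k * N j" using Pr_N(1)[OF assms(1)] by simp
  finally show "adj (c k) * Q * c m * N j = ((if k = m then Pr k else 0) - io * Pr k * Pr m) * N j"
    by (simp add: left_diff_distrib mult.assoc)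
qed

lemma Q_c_Pr:
  assumes "k < n"
  shows "Q * c k * Pr k = Q * c k"
proof (rule lev_ext)
  fix j
  have "Q * c k * Pr k * N j = fst (QP (Suc j)) * c k * snd (QP j) k"
    by (rule lev_mult[OF QP_Suc_Q[OF assms] Pr_N[OF assms]])
  also have "\<dots> = fst (QP (Suc j)) * c k"
    using qnext_c_P[OF QP[of j] i(1,2) assms] by simp
  also have "\<dots> = Q * c k * N j"
    by (rule QP_Suc_Q[OF assms, symmetric])
  finally show "Q * c k * Pr k * N j = Q * c k * N j" .
qed

lemma Pr_Q_c:
  assumes "k < n"
  shows "Pr k * Q * c k = 0"
proof (rule lev_ext)
  fix j
  have "Pr k * Q * c k * N j = Pr k * Q * N (Suc j) * c k"
    using c_N[OF assms, of j] by (simp add: mult.assoc)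
  also have "Pr k * Q * N (Suc j) = snd (QP (Suc j)) k * fst (QP (Suc j))"
    by (rule lev_mult[OF Pr_N(1)[OF assms] Q_N])
  also have "\<dots> * c k = 0"
    using pnext_qnext_c[OF QP[of j] i(1,2) assms] by simp
  finally show "Pr k * Q * c k * N j = 0 * N j" by simp
qed

lemma Qcc_lev: "Q * c k * adj (c k) * Q * N (Suc j) = fst (QP (Suc j)) * c k * adj (c k) * fst (QP (Suc j))"
  "Q * c k * adj (c k) * Q * N 0 = 0" if "k < n"
proof -
  have cc: "c k * adj (c k) * N (Suc j) = N (Suc j) * (c k * adj (c k))"
    by (simp add: mult.assoc ac_N[OF that] c_N[OF that, THEN amul])
  have "Q * (c k * adj (c k)) * Q * N (Suc j) = fst (QP (Suc j)) * (c k * adj (c k) * N (Suc j)) * fst (QP (Suc j))"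
    by (rule lev_mult[OF lev_mult[OF Q_N(1) refl cc[symmetric]] Q_N])
  also have "\<dots> = fst (QP (Suc j)) * (c k * adj (c k)) * (N (Suc j) * fst (QP (Suc j)))"
    by (simp only: mult.assoc)
  also have "N (Suc j) * fst (QP (Suc j)) = fst (QP (Suc j))"
    using QP[of "Suc j"] by (simp only: qinv_def)
  finally show "Q * c k * adj (c k) * Q * N (Suc j) = fst (QP (Suc j)) * c k * adj (c k) * fst (QP (Suc j))"
    by (simp only: mult.assoc)
  have "adj (c k) * N 0 = 0"
    using arg_cong[OF c_0[OF that], of adj] by (simp add: N(1))
  then show "Q * c k * adj (c k) * Q * N 0 = 0"
    unfolding mult.assoc Q_proj(3) by (simp add: \<open>adj (c k) * N 0 = 0\<close>[THEN amul])
qed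

lemma QP_0: "Q * N 0 = N 0" "k < n \<Longrightarrow> Pr k * N 0 = N 0"
  using Q_N(1)[of 0] Pr_N(1)[of k 0] by simp_all

lemma Q_c_c_Q:
  assumes "k < n"
  shows "Q * c k * adj (c k) * Q = (1 - im) * (Q - Pr k)"
proof (rule lev_ext)
  fix j
  show "Q * c k * adj (c k) * Q * N j = (1 - im) * (Q - Pr k) * N j"
  proof (cases j)
    case 0
    then show ?thesis
      using Qcc_lev(2)[OF assms] QP_0 assms by (simp add: left_diff_distrib right_diff_distrib mult.assoc)
  next
    case (Suc m)
    have "(1 - im) * (Q - Pr k) * N j = (1 - im) * N j * (Q - Pr k)"
      using Q_proj(3)[of j] Pr_proj(3)[OF assms, of j] by (simp add: left_diff_distrib right_diff_distrib mult.assoc)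
    also have "\<dots> = (1 - i m) *\<^sub>C (N j * (Q - Pr k))"
      using im_N(1)[of j] Suc by (simp add: left_diff_distrib csc.scale_left_diff_distrib)
    also have "N j * (Q - Pr k) = fst (QP j) - snd (QP j) k"
      by (simp add: right_diff_distrib Q_N Pr_N assms)
    finally show ?thesis
      using qnext_cc_qnext[OF QP[of m] i(1,2) assms] Suc Qcc_lev(1)[OF assms, of m] by simp
  qed
qed

lemma sum_Q_c_c_Q: "(\<Sum>k<n. Q * c k * adj (c k) * Q) = Q - N 0"
proof (rule lev_ext)
  fix j
  show "(\<Sum>k<n. Q * c k * adj (c k) * Q) * N j = (Q - N 0) * N j"
  proof (cases j)
    case 0
    then show ?thesis
      using Qcc_lev(2) QP_0(1) N(2)[of 0 0] by (simp add: sum_distrib_right left_diff_distrib)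
  next
    case (Suc m)
    have "(\<Sum>k<n. Q * c k * adj (c k) * Q) * N j = (\<Sum>k<n. fst (QP j) * c k * adj (c k) * fst (QP j))"
      unfolding sum_distrib_right Suc using Qcc_lev(1) by (intro sum.cong refl) simp
    then show ?thesis
      using sum_qnext_cc[OF QP[of m] i(1,2)] Suc Q_N(1)[of j] N(2)[of 0 j] by (simp add: left_diff_distrib)
  qed
qed

text \<open>On a level with nonzero parameter one factor of the invariant can be cancelled. By
  \<open>\<iota>S\<close> the parameter can only vanish at level 0, which is then lost.\<close>

lemma sum_Pr: "io * (\<Sum>k<n. Pr k) = (if \<iota> 0 = 0 then Q - N 0 else Q)"
proof (rule lev_ext)
  fix j
  have Pr: "(\<Sum>k<n. Pr k) * N j = (\<Sum>k<n. snd (QP j) k)"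
    unfolding sum_distrib_right using Pr_N(1) by (intro sum.cong refl) simp
  have "io * (\<Sum>k<n. Pr k) * N j = io * (N j * (\<Sum>k<n. Pr k))"
    using Pr_proj(3) by (simp add: sum_distrib_left sum_distrib_right mult.assoc)
  also have "\<dots> = i j *\<^sub>C (\<Sum>k<n. snd (QP j) k)"
    using io_N(1)[of j] Pr Pr_N(2) by (simp add: mult.assoc[symmetric]) (simp add: sum_distrib_left csc.scale_sum_right)
  finally have 1: "io * (\<Sum>k<n. Pr k) * N j = i j *\<^sub>C (\<Sum>k<n. snd (QP j) k)" .
  have inv: "(i j * i j) *\<^sub>C (\<Sum>k<n. snd (QP j) k) = i j *\<^sub>C fst (QP j)"
    using QP[of j] by (simp add: qinv_def)
  have 2: "i j *\<^sub>C (\<Sum>k<n. snd (QP j) k) = fst (QP j)" if "\<iota> j \<noteq> 0"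
  proof -
    have "i j *\<^sub>C (i j *\<^sub>C (\<Sum>k<n. snd (QP j) k)) = i j *\<^sub>C fst (QP j)" using inv by simp
    then show ?thesis using that by (simp only: csc.scale_cancel_left of_real_eq_0_iff simp_thms)
  qed
  have Sj: "\<iota> (Suc m) \<noteq> 0" for m using \<iota>S[of m] by auto
  show "io * (\<Sum>k<n. Pr k) * N j = (if \<iota> 0 = 0 then Q - N 0 else Q) * N j"
  proof (cases j)
    case 0
    then show ?thesis
      using 1 2 Q_N(1)[of 0] N(2)[of 0 0] by (simp add: left_diff_distrib)
  next
    case (Suc m)
    then show ?thesis
      using 1 2 Sj[of m] Q_N(1)[of j] N(2)[of 0 j] by (simp add: left_diff_distrib)
  qed
qed

text \<open>On each level the sum is a multiple of \<open>qnext\<close> applied to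
  \<open>cA\<close>, which vanishes unless the parameter is 0; in that case the factor
  \<open>si\<close> vanishes.\<close>

lemma sum_Q_c_si: "(\<Sum>k<n. Q * c k * si) = 0"
proof (rule lev_ext)
  fix j
  have "(\<Sum>k<n. Q * c k * si) * N j = complex_of_real (sqrt (\<iota> j)) *\<^sub>C (\<Sum>k<n. Q * c k * N j)"
    unfolding sum_distrib_right csc.scale_sum_right
    by (intro sum.cong refl) (simp add: mult.assoc si_N)
  also have "(\<Sum>k<n. Q * c k * N j) = (\<Sum>k<n. fst (QP (Suc j)) * c k * snd (QP j) k)"
    using qnext_c_P[OF QP[of j] i(1,2)] by (intro sum.cong refl) (simp add: QP_Suc_Q)
  also have "\<dots> = qnext (i j) (snd (QP j)) * cA (snd (QP j))"
    by (simp add: cA_def sum_distrib_left mult.assoc)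
  finally have 1: "(\<Sum>k<n. Q * c k * si) * N j = complex_of_real (sqrt (\<iota> j)) *\<^sub>C (qnext (i j) (snd (QP j)) * cA (snd (QP j)))" .
  have "\<iota> j = 0 \<or> qnext (i j) (snd (QP j)) * cA (snd (QP j)) = 0"
    using qnext_cA[OF QP[of j] i(1,2)] by simp
  then show "(\<Sum>k<n. Q * c k * si) * N j = 0 * N j"
    unfolding 1 by auto
qed

lemma Q_Pr_comm:
  assumes z: "cm z"
  shows "z * Q = Q * z" "k < n \<Longrightarrow> z * Pr k = Pr k * z"
proof -
  have *: "z * fst (QP j) = fst (QP j) * z \<and> (\<forall>k<n. z * snd (QP j) k = snd (QP j) k * z)" for j
  proof (induction j)
    case 0
    show ?case using cmD(3)[OF z] by simp
  next
    case (Suc j)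
    let ?P = "snd (QP j)"
    have zP: "z * ?P k = ?P k * z" if "k < n" for k using Suc that by simp
    have zA: "z * cA ?P = cA ?P * z"
      unfolding cA_def sum_distrib_left sum_distrib_right
      by (intro sum.cong refl) (simp add: mult.assoc cmD(1)[OF z, THEN amul] zP)
    have aP: "adj (?P k) = ?P k" if "k < n" for k
      using QP[of j] that by (auto simp: qinv_def is_proj_def)
    have zAa: "z * adj (cA ?P) = adj (cA ?P) * z"
      unfolding cA_def adj_sum adj_times sum_distrib_left sum_distrib_right
      by (intro sum.cong refl) (simp add: mult.assoc aP cmD(2)[OF z] zP[THEN amul])
    have zS: "z * (\<Sum>k<n. c k * ?P k * adj (c k)) = (\<Sum>k<n. c k * ?P k * adj (c k)) * z"
      unfolding sum_distrib_left sum_distrib_right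
      by (intro sum.cong refl) (simp add: mult.assoc cmD(1)[OF z, THEN amul] cmD(2)[OF z] zP[THEN amul])
    have zQ: "z * qnext (i j) ?P = qnext (i j) ?P * z"
      unfolding qnext_def using zS zAa zA[THEN amul] by (simp add: left_diff_distrib right_diff_distrib mult.assoc)
    have "z * pnext (i j) ?P k = pnext (i j) ?P k * z" if k: "k < n" for k
    proof -
      have "z * (qnext (i j) ?P * c k * adj (c k) * qnext (i j) ?P) = qnext (i j) ?P * c k * adj (c k) * qnext (i j) ?P * z"
        by (simp add: mult.assoc zQ zQ[THEN amul] cmD(1)[OF z k, THEN amul] cmD(2)[OF z k, THEN amul])
      then show ?thesis
        unfolding pnext_def using zQ by (simp add: left_diff_distrib right_diff_distrib)
    qed
    then show ?case using zQ by simp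
  qed
  have zN: "z * N j = N j * z" for j by (rule cmD(3)[OF z])
  show "z * Q = Q * z"
  proof (rule lev_ext)
    fix j
    have "z * Q * N j = fst (QP j) * z" using * by (simp add: mult.assoc Q_N)
    also have "\<dots> = Q * z * N j" by (simp add: Q_N(1)[symmetric] mult.assoc zN)
    finally show "z * Q * N j = Q * z * N j" .
  qed
  assume k: "k < n"
  show "z * Pr k = Pr k * z"
  proof (rule lev_ext)
    fix j
    have "z * Pr k * N j = snd (QP j) k * z" using * k by (simp add: mult.assoc Pr_N)
    also have "\<dots> = Pr k * z * N j" by (simp add: Pr_N(1)[OF k, symmetric] mult.assoc zN)
    finally show "z * Pr k * N j = Pr k * z * N j" .
  qed
qed

lemma cov_iff: "cov a \<longleftrightarrow> (\<forall>k<n. \<forall>m<n. U k * a k * adj (U k) = U m * a m * adj (U m))"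
proof
  assume "cov a"
  then obtain Y where Y: "\<And>k. k < n \<Longrightarrow> a k = adj (U k) * Y * U k" by (metis covE)
  have "U k * a k * adj (U k) = Y" if "k < n" for k
    unfolding Y[OF that] by (simp add: mult.assoc U_unitary[OF that] U_unitary(1)[OF that, THEN amul])
  then show "\<forall>k<n. \<forall>m<n. U k * a k * adj (U k) = U m * a m * adj (U m)" by simp
next
  assume *: "\<forall>k<n. \<forall>m<n. U k * a k * adj (U k) = U m * a m * adj (U m)"
  show "cov a"
  proof (rule covI)
    fix k assume k: "k < n"
    have "adj (U k) * (U 0 * a 0 * adj (U 0)) * U k = adj (U k) * (U k * a k * adj (U k)) * U k"
      using * k n by metis
    also have "\<dots> = a k"
      by (simp add: mult.assoc U_unitary[OF k] U_unitary(2)[OF k, THEN amul])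
    finally show "a k = adj (U k) * (U 0 * a 0 * adj (U 0)) * U k" by simp
  qed
qed

text \<open>Induction on the level: \<open>cA\<close> and the other sum in \<open>qnext\<close> are
  sums over covariant families, hence commute with \<open>F\<close>, and \<open>pnext\<close> is
  composed of \<open>c\<close> and operators commuting with \<open>F\<close>.\<close>

lemma cov_QP: "(\<forall>l<n. fst (QP j) * F l = F l * fst (QP j)) \<and> cov (snd (QP j))"
proof (induction j)
  case 0
  have "N 0 * F l = F l * N 0" if "l < n" for l using that by (simp add: F_N)
  then show ?case using cov_const[of "N 0"] by simp
next
  case (Suc j)
  let ?P = "snd (QP j)" and ?Q = "qnext (i j) (snd (QP j))"
  have cP: "cov (\<lambda>k. c k * ?P k)"
    using Suc by (intro cov_mult cov_c) simp
  have A: "cA ?P * F l = F l * cA ?P" if "l < n" for l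
    unfolding cA_def by (rule cov_sum[OF cP that])
  have A': "adj (cA ?P) * F l = F l * adj (cA ?P)" if "l < n" for l
    using arg_cong[OF A[OF that], of adj] pouD(1)[OF F that] by simp
  have S: "(\<Sum>k<n. c k * ?P k * adj (c k)) * F l = F l * (\<Sum>k<n. c k * ?P k * adj (c k))" if "l < n" for l
    by (rule cov_sum[OF cov_mult[OF cP cov_adj[OF cov_c]] that])
  have Q: "?Q * F l = F l * ?Q" if "l < n" for l
    unfolding qnext_def using S[OF that] A[OF that, symmetric, THEN amul] A'[OF that]
    by (simp add: left_diff_distrib right_diff_distrib mult.assoc)
  have "cov (\<lambda>k. ?Q + (- 1 / (1 - i j)) *\<^sub>C (?Q * c k * adj (c k) * ?Q))"
    by (intro cov_add cov_csc cov_mult cov_c cov_adj cov_const Q)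
  moreover have "pnext (i j) ?P = (\<lambda>k. ?Q + (- 1 / (1 - i j)) *\<^sub>C (?Q * c k * adj (c k) * ?Q))"
    by (simp add: pnext_def fun_eq_iff)
  ultimately show ?case using Q by simp
qed

lemma F_Q: "l < n \<Longrightarrow> F l * Q = Q * F l"
proof (rule lev_ext)
  fix j assume l: "l < n"
  have "F l * Q * N j = F l * fst (QP j)"
    by (simp add: mult.assoc Q_N)
  also have "\<dots> = fst (QP j) * F l"
    using cov_QP[of j] l by simp
  also have "\<dots> = Q * (N j * F l)"
    by (simp only: Q_N(1)[symmetric] mult.assoc)
  finally show "F l * Q * N j = Q * F l * N j"
    using l by (simp add: F_N mult.assoc)
qed

lemma U_N_comm: "U k * N j = N j * U k" "adj (U k) * N j = N j * adj (U k)"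
  by (simp_all add: U_N)

lemma cov_Pr: "cov Pr"
  unfolding cov_iff
proof (intro allI impI)
  fix k m assume k: "k < n" and m: "m < n"
  have *: "U k * Pr k * adj (U k) * N j = U k * snd (QP j) k * adj (U k)" if "k < n" for k j
  proof -
    have "U k * Pr k * adj (U k) * N j = U k * (Pr k * N j) * adj (U k)"
      by (simp add: mult.assoc U_N_comm)
    then show ?thesis by (simp only: Pr_N[OF that])
  qed
  show "U k * Pr k * adj (U k) = U m * Pr m * adj (U m)"
  proof (rule lev_ext)
    fix j
    show "U k * Pr k * adj (U k) * N j = U m * Pr m * adj (U m) * N j"
      unfolding *[OF k] *[OF m] using cov_QP[of j] k m unfolding cov_iff by blast
  qed
qed

end

section \<open>Conjugating by the projections of a tower\<close>

text \<open>Used for both towers of a pair, with the roles of \<open>T0\<close> and \<open>T1\<close> exchanged.\<close>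

locale tower_conjugation = qtower lev n h c b \<iota> for lev :: "'a \<Rightarrow> nat" and n h c b \<iota> +
  fixes R T1 T0 :: "'a bop"
  assumes R: "adj R = R" "R * R = R" "cm R" "R * T0 = T0 * R" "R * T1 = T1 * R"
    and T: "adj T0 = T0" "adj T1 = T1" "T0 * T0 = T0" "T1 * T1 = T1" "T0 * T1 = 0" "T1 * T0 = 0"
    and Tc: "\<And>k. k < n \<Longrightarrow> T0 * c k = c k * T1"
    and TN: "\<And>j. T1 * N j = N j * T1" "\<And>j. T0 * N j = N j * T0"
    and TQ: "T1 * Q = Q * T1" "T0 * Q = Q * T0"
    and TP: "\<And>k. k < n \<Longrightarrow> T1 * Pr k = Pr k * T1"  "\<And>k. k < n \<Longrightarrow> T0 * Pr k = Pr k * T0"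
    and F_R: "\<And>l. l < n \<Longrightarrow> R * F l = F l * R" and F_T1: "\<And>l. l < n \<Longrightarrow> T1 * F l = F l * T1"
begin

text \<open>On the part under \<open>T1\<close>, the summand \<open>si\<close> stays in
  \<open>T1\<close> and \<open>Q * c k\<close> moves to \<open>T0\<close>. The squares of the two
  components are \<open>\<iota>\<close> and \<open>1 - \<iota>\<close> times \<open>Pr k\<close>, so
  \<open>X k\<close> is isometric on \<open>Pr k * T1\<close>.\<close>

definition X where "X k = (si + Q * c k) * Pr k"
definition e where "e k = X k * (T1 * R) * adj (X k)"

lemma Tac: "k < n \<Longrightarrow> T1 * adj (c k) = adj (c k) * T0"
  using arg_cong[OF Tc, of k adj] by (simp add: T)

lemma R_E: "R * Q = Q * R" "k < n \<Longrightarrow> R * Pr k = Pr k * R" "k < n \<Longrightarrow> R * c k = c k * R" "k < n \<Longrightarrow> R * adj (c k) = adj (c k) * R"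
  "R * si = si * R" "R * io = io * R" "R * im = im * R"
  using Q_Pr_comm[OF R(3)] cmD[OF R(3)] si_comm[of R] io_comm[of R] im_comm[of R] by simp_all

lemma T_si: "T1 * si = si * T1" "T0 * si = si * T0" "T1 * io = io * T1" "T1 * im = im * T1" "T0 * im = im * T0"
  using si_comm[of T1] si_comm[of T0] io_comm[of T1] im_comm[of T1] im_comm[of T0] TN by simp_all

lemma si_Pr: "k < n \<Longrightarrow> si * Pr k = Pr k * si"
  using si_comm[OF Pr_proj(3), of k] by simp

lemma Pr_ac_Q: "k < n \<Longrightarrow> Pr k * (adj (c k) * Q) = adj (c k) * Q"
  using arg_cong[OF Q_c_Pr, of k adj] by (simp add: Q_proj Pr_proj)

lemma X_eq: "k < n \<Longrightarrow> X k = Pr k * si + Q * c k"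
  by (simp add: X_def distrib_right Q_c_Pr si_Pr)

lemma adj_X: "k < n \<Longrightarrow> adj (X k) = si * Pr k + adj (c k) * Q"
  by (simp add: X_eq Q_proj Pr_proj si_N)

lemma X_Pr: "k < n \<Longrightarrow> X k * Pr k = X k" "k < n \<Longrightarrow> Pr k * adj (X k) = adj (X k)"
proof -
  assume k: "k < n"
  show 1: "X k * Pr k = X k" by (simp add: X_def mult.assoc Pr_proj k)
  show "Pr k * adj (X k) = adj (X k)"
    using arg_cong[OF 1, of adj] by (simp add: Pr_proj k)
qed

lemma R_X: "k < n \<Longrightarrow> R * X k = X k * R" "k < n \<Longrightarrow> R * adj (X k) = adj (X k) * R"
proof -
  assume k: "k < n"
  note E = R_E(1) R_E(2)[OF k] R_E(3)[OF k] R_E(4)[OF k] R_E(5)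
  show "R * X k = X k * R"
    unfolding X_eq[OF k] by (simp add: distrib_left distrib_right mult.assoc E E[THEN amul])
  show "R * adj (X k) = adj (X k) * R"
    unfolding adj_X[OF k] by (simp add: distrib_left distrib_right mult.assoc E E[THEN amul])
qed

lemma e_adj: "adj (e k) = e k"
  by (simp add: e_def R(1,5) T mult.assoc)

text \<open>The contribution \<open>io * Pr k * Pr m\<close> of the two \<open>si\<close> cancels
  the correction term in \<open>adj_c_Q_c\<close>; this is what that term is for. The mixed terms
  change between \<open>T1\<close> and \<open>T0\<close> and die between two factors
  \<open>T1\<close>.\<close>

lemma T1_XX_T1:
  assumes k: "k < n" and m: "m < n"
  shows "T1 * (adj (X k) * X m) * T1 = (if k = m then Pr k * T1 else 0)"
proof -
  have TcT: "T1 * (c m * T1) = 0"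
    using Tc[OF m, symmetric] T(6)[THEN amul] by simp
  have TacT: "T1 * (adj (c k) * (z * T1)) = 0" if "T1 * z = z * T1" for z
    using Tac[OF k, THEN amul] that T(5)[THEN amul] by (simp flip: that) (simp add: T(5)[THEN amul] Tac[OF k, THEN amul] mult.assoc)
  have "adj (X k) * X m = si * Pr k * (Pr m * si) + si * Pr k * Q * c m + adj (c k) * (Q * Pr m * si) + adj (c k) * Q * c m"
    using Q_proj(2)[THEN amul] by (simp add: adj_X[OF k] X_eq[OF m] distrib_left distrib_right mult.assoc)
  also have "si * Pr k * (Pr m * si) = io * Pr k * Pr m"
    by (simp add: mult.assoc si_Pr[OF m, symmetric]) (simp add: mult.assoc si_Pr[OF k, symmetric, THEN amul] si_si[THEN amul])
  also have "adj (c k) * Q * c m = (if k = m then Pr k else 0) - io * Pr k * Pr m"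
    by (rule adj_c_Q_c[OF k m])
  finally have XX: "adj (X k) * X m = (if k = m then Pr k else 0) + si * Pr k * Q * c m + adj (c k) * (Q * Pr m * si)"
    by simp
  have 1: "T1 * (si * Pr k * Q * c m) * T1 = 0"
    by (simp add: mult.assoc T_si(1)[THEN amul] TP(1)[OF k, THEN amul] TQ(1)[THEN amul] TcT)
  have 2: "T1 * (adj (c k) * (Q * Pr m * si)) * T1 = 0"
    using TacT[of "Q * Pr m * si"] by (simp add: mult.assoc T_si(1) TP(1)[OF m, THEN amul] TQ(1)[THEN amul])
  have 3: "T1 * (if k = m then Pr k else 0) * T1 = (if k = m then Pr k * T1 else 0)"
    using TP(1)[OF k, THEN amul] T(4) by (cases "k = m") (simp_all add: mult.assoc)
  show ?thesis
    unfolding XX distrib_left distrib_right 1 2 3 by simp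
qed

lemma e_mult:
  assumes k: "k < n" and m: "m < n"
  shows "e k * e m = (if k = m then e k else 0)"
proof -
  have "e k * e m = X k * R * (T1 * (adj (X k) * X m) * T1) * R * adj (X m)"
    unfolding e_def by (simp add: mult.assoc R_X[OF m] R_X[OF k, THEN amul] R(5) R(5)[THEN amul] R_X(1)[OF m, THEN amul] R_X(2)[OF m, THEN amul])
  also have "\<dots> = (if k = m then e k else 0)"
  proof (cases "k = m")
    case True
    then show ?thesis
      unfolding T1_XX_T1[OF k m] e_def
      by (simp add: mult.assoc R_E(2)[OF m, symmetric, THEN amul] TP(1)[OF m, symmetric] X_Pr[OF m] X_Pr[OF m, THEN amul]
          R(5)[symmetric] R(5)[symmetric, THEN amul] R(2)[THEN amul])
  next
    case False
    then show ?thesis by (simp add: T1_XX_T1[OF k m])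
  qed
  finally show ?thesis .
qed

text \<open>The two-by-two block form of \<open>e k\<close> with respect to \<open>T1\<close> and
  \<open>T0\<close>. It is the shape in which the projections of one tower enter
  \<open>e_z_e\<close> for the other.\<close>

lemma e_expand:
  assumes k: "k < n"
  shows "e k = io * Pr k * (R * T1) + Q * c k * si * (R * T1) + si * adj (c k) * Q * (R * T0) + (1 - im) * (Q - Pr k) * (R * T0)"
proof -
  have A: "Pr k * si * (T1 * R) * (si * Pr k) = io * Pr k * (R * T1)"
  proof -
    have "Pr k * si * (T1 * R) * (si * Pr k) = Pr k * (si * si) * Pr k * (R * T1)"
      by (simp add: mult.assoc R_E(5)[THEN amul] T_si(1)[THEN amul] R_E(2)[OF k] TP(1)[OF k, THEN amul] TP(1)[OF k] R(5))
    also have "Pr k * (si * si) * Pr k = io * Pr k"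
      unfolding si_si io_comm[OF Pr_proj(3)[OF k]] by (simp add: mult.assoc Pr_proj[OF k])
    finally show ?thesis .
  qed
  have B: "Q * c k * (T1 * R) * (si * Pr k) = Q * c k * si * (R * T1)"
  proof -
    have "Q * c k * (T1 * R) * (si * Pr k) = (Q * c k * Pr k) * si * (R * T1)"
      by (simp add: mult.assoc si_Pr[OF k] R_E(2)[OF k, THEN amul] R_E(5) TP(1)[OF k, THEN amul] T_si(1)[THEN amul] R(5))
    then show ?thesis by (simp only: Q_c_Pr[OF k])
  qed
  have C: "Pr k * si * (T1 * R) * (adj (c k) * Q) = si * adj (c k) * Q * (R * T0)"
  proof -
    have "Pr k * si * (T1 * R) * (adj (c k) * Q) = si * (Pr k * (adj (c k) * Q)) * (R * T0)"
      by (simp add: mult.assoc R_E(4)[OF k, THEN amul] R_E(1) Tac[OF k, THEN amul] TQ(2)[THEN amul] R(4)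
        si_Pr[OF k, THEN amul])
    then show ?thesis unfolding Pr_ac_Q[OF k] by (simp add: mult.assoc)
  qed
  have D: "Q * c k * (T1 * R) * (adj (c k) * Q) = Q * c k * adj (c k) * Q * (R * T0)"
    by (simp add: mult.assoc R_E(4)[OF k, THEN amul] R_E(1) Tac[OF k, THEN amul] TQ(2)[THEN amul] R(4))
  show ?thesis
    unfolding e_def adj_X[OF k]
    unfolding X_eq[OF k] Q_c_c_Q[OF k, symmetric]
    unfolding A[symmetric] B[symmetric] C[symmetric] D[symmetric]
    by (simp add: distrib_left distrib_right)
qed

text \<open>The off-diagonal blocks cancel by \<open>sum_Q_c_si\<close>, while the diagonal ones add
  up to units. The \<open>T0\<close> block misses level 0, which no \<open>c k\<close>
  reaches.\<close>

lemma sum_e: "(\<Sum>k<n. e k) = (if \<iota> 0 = 0 then Q - N 0 else Q) * (R * T1) + (Q - N 0) * (R * T0)"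
proof -
  have "(\<Sum>k<n. e k) = (\<Sum>k<n. io * Pr k * (R * T1)) + (\<Sum>k<n. Q * c k * si * (R * T1)) +
      (\<Sum>k<n. si * adj (c k) * Q * (R * T0)) + (\<Sum>k<n. Q * c k * adj (c k) * Q * (R * T0))"
    unfolding sum.distrib[symmetric] by (intro sum.cong refl) (simp add: e_expand Q_c_c_Q)
  also have "(\<Sum>k<n. io * Pr k * (R * T1)) = io * (\<Sum>k<n. Pr k) * (R * T1)"
    by (simp add: sum_distrib_left sum_distrib_right)
  also have "(\<Sum>k<n. Q * c k * si * (R * T1)) = (\<Sum>k<n. Q * c k * si) * (R * T1)"
    by (simp add: sum_distrib_right)
  also have "(\<Sum>k<n. si * adj (c k) * Q * (R * T0)) = adj (\<Sum>k<n. Q * c k * si) * (R * T0)"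
    by (simp add: sum_distrib_right Q_proj si_N mult.assoc)
  also have "(\<Sum>k<n. Q * c k * adj (c k) * Q * (R * T0)) = (\<Sum>k<n. Q * c k * adj (c k) * Q) * (R * T0)"
    by (simp add: sum_distrib_right)
  finally show ?thesis
    unfolding sum_Q_c_si sum_Pr sum_Q_c_c_Q by simp
qed

lemma cov_e: "cov e"
proof -
  have si: "si * F l = F l * si" if "l < n" for l
    using si_comm[of "F l"] F_N[OF that] by simp
  have "cov X"
    unfolding X_def using si F_Q by (intro cov_mult cov_add cov_const cov_c cov_Pr) simp_all
  moreover have "cov (\<lambda>_. T1 * R)"
  proof (rule cov_const)
    fix l assume l: "l < n"
    show "T1 * R * F l = F l * (T1 * R)"
      by (simp add: mult.assoc F_R[OF l] F_T1[OF l, THEN amul])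
  qed
  ultimately have "cov (\<lambda>k. X k * (T1 * R) * adj (X k))"
    by (rule cov_mult[OF cov_mult cov_adj]) fact
  then show ?thesis unfolding e_def[abs_def] .
qed

lemma X_T1:
  assumes k: "k < n"
  shows "T0 * (X k * T1) = Q * (c k * T1)" "T1 * (X k * T1) = si * (Pr k * T1)"
    "T1 * (adj (X k) * T0) = T1 * (adj (c k) * Q)" "T1 * (adj (X k) * T1) = T1 * (si * Pr k)"
proof -
  have t: "T1 * (Q * (c k * T1)) = 0"
    by (simp add: mult.assoc TQ(1)[THEN amul] Tc[OF k, symmetric] T(6)[THEN amul])
  have t': "T0 * (Q * (c k * T1)) = Q * (c k * T1)"
    by (simp add: mult.assoc TQ(2)[THEN amul] Tc[OF k, THEN amul] T(4))
  have s: "T0 * (si * (Pr k * T1)) = 0" "T1 * (si * (Pr k * T1)) = si * (Pr k * T1)"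
    by (simp_all add: mult.assoc T_si(1,2)[THEN amul] TP[OF k, THEN amul] T)
  have X: "X k * T1 = si * (Pr k * T1) + Q * (c k * T1)"
    by (simp add: X_eq[OF k] distrib_right mult.assoc si_Pr[OF k, symmetric, THEN amul])
  show 1: "T0 * (X k * T1) = Q * (c k * T1)" and 2: "T1 * (X k * T1) = si * (Pr k * T1)"
    unfolding X distrib_left t t' s by simp_all
  show "T1 * (adj (X k) * T0) = T1 * (adj (c k) * Q)" "T1 * (adj (X k) * T1) = T1 * (si * Pr k)"
    using arg_cong[OF 1, of adj] arg_cong[OF 2, of adj]
    by (simp_all add: T mult.assoc Q_proj Pr_proj[OF k] si_N si_Pr[OF k])
qed

text \<open>\<open>A\<close>, \<open>B\<close>, \<open>adj B\<close> and \<open>C\<close> are the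
  blocks of \<open>z\<close>. Those that change between \<open>T0\<close> and \<open>T1\<close>
  contribute nothing because \<open>Pr k * Q * c k = 0\<close>; the others are weighted by
  \<open>1 - io\<close> and \<open>io\<close>, the squares of the two components of
  \<open>X k\<close>.\<close>

lemma e_z_e:
  assumes k: "k < n" and cm: "cm A" "cm B" "cm C"
    and z: "z = (A + B) * (Q * T0) + (adj B + C) * (Q * T1)"
    and AT: "T0 * A = A * T0" "T1 * A = A * T1" "T1 * C = C * T1" "T1 * B = B * T0"
    and t: "R * (A * ((1 - io) * (Pr k * T1)) + C * (io * (Pr k * T1))) = t *\<^sub>C (R * (Pr k * T1))"
  shows "e k * z * e k = t *\<^sub>C e k"
proof -
  let ?x = "Q * (c k * T1)" and ?y = "si * (Pr k * T1)"
  let ?x' = "T1 * (adj (c k) * Q)" and ?y' = "T1 * (si * Pr k)"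
  have BT': "adj B * T1 = T0 * adj B"
    using arg_cong[OF AT(4), of adj] by (simp add: T)
  have ccm: "cm (adj B)" by (rule cm_adj[OF cm(2)])
  have zAB: "z = A * (Q * T0) + B * (Q * T0) + adj B * (Q * T1) + C * (Q * T1)"
    unfolding z by (simp add: distrib_right)
  have a1: "T1 * (adj (X k) * (A * (Q * T0) * (X k * T1))) = A * ((1 - io) * (Pr k * T1))"
  proof -
    have "T1 * (adj (X k) * (A * (Q * T0) * (X k * T1))) = (T1 * (adj (X k) * T0)) * (A * (Q * (T0 * (X k * T1))))"
      by (simp add: mult.assoc AT(1)[THEN amul] TQ(2)[THEN amul] T(3)[THEN amul])
    also have "\<dots> = A * (T1 * (adj (c k) * Q * c k * T1))"
      unfolding X_T1[OF k]
      by (simp add: mult.assoc Q_proj(2)[THEN amul] Q_Pr_comm(1)[OF cm(1), symmetric, THEN amul]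
        cmD(2)[OF cm(1) k, symmetric, THEN amul] AT(2)[THEN amul])
    also have "adj (c k) * Q * c k = (1 - io) * Pr k"
      using adj_c_Q_c[OF k k] by (simp add: mult.assoc Pr_proj[OF k] left_diff_distrib)
    finally show ?thesis
      by (simp add: mult.assoc left_diff_distrib right_diff_distrib TP[OF k, THEN amul] T_si(3)[THEN amul] T)
  qed
  have a2: "T1 * (adj (X k) * (B * (Q * T0) * (X k * T1))) = 0"
  proof -
    have "T1 * (adj (X k) * (B * (Q * T0) * (X k * T1))) = (T1 * (adj (X k) * T1)) * (B * (Q * (T0 * (X k * T1))))"
      by (simp add: mult.assoc AT(4)[THEN amul] TQ(2)[THEN amul] T(3)[THEN amul])
    also have "\<dots> = T1 * (si * (B * (Pr k * Q * c k * T1)))"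
      unfolding X_T1[OF k]
      by (simp add: mult.assoc Q_proj(2)[THEN amul] Q_Pr_comm(2)[OF cm(2) k, THEN amul])
    finally show ?thesis
      by (simp add: Pr_Q_c[OF k])
  qed
  have a3: "T1 * (adj (X k) * (adj B * (Q * T1) * (X k * T1))) = 0"
  proof -
    have "T1 * (adj (X k) * (adj B * (Q * T1) * (X k * T1))) = (T1 * (adj (X k) * T0)) * (adj B * (Q * (T1 * (X k * T1))))"
      by (simp add: mult.assoc BT'[symmetric, THEN amul] TQ(1)[THEN amul] T(4)[THEN amul])
    also have "\<dots> = T1 * (adj B * (adj (c k) * Q * Pr k * si * T1))"
      unfolding X_T1[OF k]
      by (simp add: mult.assoc Q_proj(2)[THEN amul] Q_Pr_comm(1)[OF ccm, symmetric, THEN amul]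
        cmD(2)[OF ccm k, symmetric, THEN amul] Q_proj si_Pr[OF k, THEN amul] Pr_proj(2,4,5)[OF k, THEN amul] Pr_proj(2,4,5)[OF k])
    also have "adj (c k) * Q * Pr k = 0"
      using arg_cong[OF Pr_Q_c[OF k], of adj] by (simp add: Q_proj Pr_proj[OF k] mult.assoc)
    finally show ?thesis
      by simp
  qed
  have a4: "T1 * (adj (X k) * (C * (Q * T1) * (X k * T1))) = C * (io * (Pr k * T1))"
  proof -
    have "T1 * (adj (X k) * (C * (Q * T1) * (X k * T1))) = (T1 * (adj (X k) * T1)) * (C * (Q * (T1 * (X k * T1))))"
      by (simp add: mult.assoc AT(3)[THEN amul] TQ(1)[THEN amul] T(4)[THEN amul])
    also have "\<dots> = C * (T1 * (si * si * Pr k * T1))"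
      unfolding X_T1[OF k]
      by (simp add: mult.assoc Q_Pr_comm(2)[OF cm(3) k, symmetric, THEN amul] si_Pr[OF k, THEN amul] Pr_proj(2,4,5)[OF k, THEN amul]
        si_comm[OF cmD(3)[OF cm(3)], symmetric, THEN amul] AT(3)[THEN amul])
    finally show ?thesis
      by (simp add: mult.assoc si_si TP[OF k, THEN amul] T_si(3)[THEN amul] T si_si[THEN amul])
  qed
  have "e k * z * e k = X k * R * (T1 * (adj (X k) * (z * (X k * T1)))) * (R * adj (X k))"
    unfolding e_def by (simp add: mult.assoc R(5)[THEN amul])
  also have "T1 * (adj (X k) * (z * (X k * T1))) = A * ((1 - io) * (Pr k * T1)) + C * (io * (Pr k * T1))"
    unfolding zAB distrib_left distrib_right a1 a2 a3 a4 by simp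
  also have "X k * R * (A * ((1 - io) * (Pr k * T1)) + C * (io * (Pr k * T1))) * (R * adj (X k)) =
      t *\<^sub>C (X k * (R * (Pr k * T1)) * (R * adj (X k)))"
    unfolding mult.assoc[of "X k"] t by simp
  also have "X k * (R * (Pr k * T1)) * (R * adj (X k)) = e k"
    unfolding e_def
    by (simp add: mult.assoc R_E(2)[OF k, THEN amul] X_Pr[OF k, THEN amul] R(5)[symmetric, THEN amul] R(2)[THEN amul] R(5)[symmetric])
  finally show ?thesis .
qed

end

section \<open>Two interlaced towers\<close>

lemma csc_inv: "n > 0 \<Longrightarrow> of_nat n *\<^sub>C A = B \<Longrightarrow> A = (1 / of_nat n) *\<^sub>C B"
  by auto

text \<open>\<open>T0\<close> collects the cells with equal levels, \<open>T1\<close> those where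
  the second level is one ahead. Each tower lies in the commutant of the other one's creation
  operators; only the initial partitions \<open>\<beta>\<close> and \<open>\<gamma>\<close>, being
  unbiased, interact.\<close>

locale tower_pair = E: qtower levE n hE c \<beta> x + D: qtower levD n hD d \<gamma> y
  for levE levD :: "'a \<Rightarrow> nat" and n hE hD c d \<beta> \<gamma> x y +
  fixes T0 T1 :: "'a bop"
  assumes cmD: "\<And>k. k < n \<Longrightarrow> D.cm (c k)" "\<And>k. k < n \<Longrightarrow> D.cm (\<beta> k)" "\<And>j. D.cm (E.N j)"
    and cmE: "\<And>k. k < n \<Longrightarrow> E.cm (d k)" "\<And>k. k < n \<Longrightarrow> E.cm (\<gamma> k)"
    and T: "adj T0 = T0" "adj T1 = T1"
    and TN: "\<And>i j. T0 * E.N j * D.N i = (if i = j then E.N j * D.N i else 0)"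
      "\<And>i j. T1 * E.N j * D.N i = (if i = Suc j then E.N j * D.N i else 0)"
    and xy: "\<And>j. n * x j * (1 - y j) = 1" "\<And>j. n * y (Suc j) * (1 - x j) = 1"
    and x0: "x 0 \<noteq> 0" and y0: "y 0 = 0"
    and \<beta>\<gamma>: "\<And>k l. k < n \<Longrightarrow> l < n \<Longrightarrow> unbiased (1 / of_nat n) (\<beta> k) (\<gamma> l)"
begin

abbreviation Q where "Q \<equiv> E.Q"
abbreviation P where "P \<equiv> E.Pr"
abbreviation R where "R \<equiv> D.Q"
abbreviation S where "S \<equiv> D.Pr"
abbreviation sx where "sx \<equiv> E.si"
abbreviation sy where "sy \<equiv> D.si"

lemmas n = E.n

lemma cmD_adj_c: "k < n \<Longrightarrow> D.cm (adj (c k))"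
  by (rule D.cm_adj[OF cmD(1)])

lemma R_cm: "E.cm R" "k < n \<Longrightarrow> E.cm (S k)" "E.cm (D.N j)" "E.cm D.io" "E.cm D.im" "E.cm D.si"
proof -
  show N: "E.cm (D.N j)" for j
    unfolding E.cm_def using D.cmD(3)[OF cmD(1)] D.cmD(3)[OF cmD_adj_c] D.cmD(3)[OF cmD(3)] by simp
  show "E.cm R"
    unfolding E.cm_def using D.Q_Pr_comm(1)[OF cmD(1)] D.Q_Pr_comm(1)[OF cmD_adj_c] D.Q_Pr_comm(1)[OF cmD(3)] by simp
  show "E.cm (S k)" if "k < n"
    unfolding E.cm_def using D.Q_Pr_comm(2)[OF cmD(1) that] D.Q_Pr_comm(2)[OF cmD_adj_c that] D.Q_Pr_comm(2)[OF cmD(3) that] by simp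
  note d = D.cmD(3)[OF cmD(1)] D.cmD(3)[OF cmD_adj_c] D.cmD(3)[OF cmD(3)]
  show "E.cm D.io" "E.cm D.im" "E.cm D.si"
    unfolding E.cm_def
    using D.io_comm[OF d(1)] D.io_comm[OF d(2)] D.io_comm[OF d(3)]
      D.im_comm[OF d(1)] D.im_comm[OF d(2)] D.im_comm[OF d(3)]
      D.si_comm[OF d(1)] D.si_comm[OF d(2)] D.si_comm[OF d(3)] by simp_all
qed

lemma cm_E:
  assumes "E.cm z" "k < n"
  shows "z * c k = c k * z" "z * adj (c k) = adj (c k) * z" "z * Q = Q * z" "z * P k = P k * z" "z * E.N j = E.N j * z"
    "z * sx = sx * z" "z * E.io = E.io * z" "z * E.im = E.im * z"
  using E.cmD[OF assms(1)] assms(2) E.Q_Pr_comm[OF assms(1)] E.si_comm[of z] E.io_comm[of z] E.im_comm[of z] by simp_all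

lemma cm_d_adj: "k < n \<Longrightarrow> E.cm (adj (d k))"
  by (rule E.cm_adj[OF cmE(1)])

lemma ext2:
  assumes "\<And>i j. A * E.N j * D.N i = B * E.N j * D.N i"
  shows "A = B"
  by (rule E.lev_ext, rule D.lev_ext) (rule assms)

lemma NN: "D.N i * E.N j = E.N j * D.N i"
  using D.cmD(3)[OF cmD(3)[of j], of i] by simp

text \<open>\<open>T0\<close> and \<open>T1\<close> depend on the two levels only, so whatever
  preserves both levels commutes with them.\<close>

lemma T_comm:
  assumes "\<And>j. z * E.N j = E.N j * z" "\<And>j. z * D.N j = D.N j * z"
  shows "T0 * z = z * T0" "T1 * z = z * T1"
proof -
  have 1: "A * z * E.N j * D.N i = A * E.N j * D.N i * z" for A i j
    by (simp add: mult.assoc assms(1)[THEN amul] assms(2))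
  have 2: "z * A * E.N j * D.N i = z * (A * E.N j * D.N i)" for A i j
    by (simp add: mult.assoc)
  have 3: "E.N j * D.N i * z = z * (E.N j * D.N i)" for i j
    using assms(2)[of i] by (simp add: mult.assoc assms(1)[THEN amul])
  show "T0 * z = z * T0" "T1 * z = z * T1"
    by (rule ext2; simp only: 1 2 TN; simp add: 3)+
qed

lemma T_N: "T0 * E.N j = E.N j * T0" "T1 * E.N j = E.N j * T1" "T0 * D.N j = D.N j * T0" "T1 * D.N j = D.N j * T1"
  by (rule T_comm; simp add: E.N(2) D.N(2) NN)+

lemma T_alg: "T0 * T0 = T0" "T1 * T1 = T1" "T0 * T1 = 0" "T1 * T0 = 0"
proof -
  have *: "A * B * E.N j * D.N i = A * (B * E.N j * D.N i)" for A B i j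
    by (simp add: mult.assoc)
  show "T0 * T0 = T0" "T1 * T1 = T1" "T0 * T1 = 0" "T1 * T0 = 0"
    by (rule ext2; simp only: * TN; simp add: mult.assoc[symmetric] TN)+
qed

text \<open>Raising the first level closes the gap between the levels, raising the second one opens
  it: \<open>c\<close> goes from \<open>T1\<close> to \<open>T0\<close> and \<open>d\<close> from
  \<open>T0\<close> to \<open>T1\<close>.\<close>

lemma Tc: "k < n \<Longrightarrow> T0 * c k = c k * T1" and Td: "k < n \<Longrightarrow> T1 * d k = d k * T0"
proof -
  assume k: "k < n"
  have c: "A * c k * E.N j * D.N i = A * E.N (Suc j) * D.N i * c k" for A i j
    by (simp add: mult.assoc E.c_N[OF k, THEN amul] D.cmD(3)[OF cmD(1)[OF k]])
  have c': "c k * A * E.N j * D.N i = c k * (A * E.N j * D.N i)" for A i j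
    by (simp add: mult.assoc)
  have cc: "E.N (Suc j) * D.N i * c k = c k * (E.N j * D.N i)" for i j
    by (simp add: mult.assoc E.c_N[OF k, THEN amul] D.cmD(3)[OF cmD(1)[OF k], symmetric])
  show "T0 * c k = c k * T1"
    by (rule ext2) (simp only: c c' TN, simp add: cc)
  have d: "A * d k * E.N j * D.N i = A * E.N j * D.N (Suc i) * d k" for A i j
    by (simp add: mult.assoc E.cmD(3)[OF cmE(1)[OF k], THEN amul] D.c_N[OF k])
  have d': "d k * A * E.N j * D.N i = d k * (A * E.N j * D.N i)" for A i j
    by (simp add: mult.assoc)
  have dd: "E.N j * D.N (Suc i) * d k = d k * (E.N j * D.N i)" for i j
    by (simp add: mult.assoc E.cmD(3)[OF cmE(1)[OF k], THEN amul] D.c_N[OF k, symmetric])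
  show "T1 * d k = d k * T0"
    by (rule ext2) (simp only: d d' TN, simp add: dd)
qed

lemma T00: "E.N 0 * T0 = D.N 0 * T0" "D.N 0 * T1 = 0"
proof -
  have *: "A * B * E.N j * D.N i = A * (B * E.N j * D.N i)" for A B i j
    by (simp add: mult.assoc)
  show "E.N 0 * T0 = D.N 0 * T0"
    by (rule ext2, simp only: * TN) (simp add: mult.assoc[symmetric] E.N(2), simp add: mult.assoc D.N(2) NN[symmetric] NN[symmetric, THEN amul] D.N(2)[THEN amul])
  show "D.N 0 * T1 = 0"
    by (rule ext2, simp only: * TN) (simp add: NN[THEN amul] mult.assoc D.N(2))
qed

lemma T_E: "T0 * Q = Q * T0" "T1 * Q = Q * T1" "k < n \<Longrightarrow> T0 * P k = P k * T0" "k < n \<Longrightarrow> T1 * P k = P k * T1"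
  "T0 * R = R * T0" "T1 * R = R * T1" "k < n \<Longrightarrow> T0 * S k = S k * T0" "k < n \<Longrightarrow> T1 * S k = S k * T1"
  "T0 * sx = sx * T0" "T1 * sx = sx * T1" "T0 * sy = sy * T0" "T1 * sy = sy * T1"
  "T0 * E.io = E.io * T0" "T1 * E.io = E.io * T1" "T0 * D.io = D.io * T0" "T1 * D.io = D.io * T1"
  "T0 * E.im = E.im * T0" "T1 * E.im = E.im * T1" "T0 * D.im = D.im * T0" "T1 * D.im = D.im * T1"
proof -
  note EN = R_cm(3)[THEN cm_E(3)] R_cm(3)[THEN cm_E(4)]
  show "T0 * Q = Q * T0" "T1 * Q = Q * T1"
    using E.Q_proj(3) cm_E(3)[OF R_cm(3) n] by (intro T_comm; simp)+
  show "T0 * P k = P k * T0" "T1 * P k = P k * T1" if "k < n"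
    using E.Pr_proj(3)[OF that] cm_E(4)[OF R_cm(3) that] by (intro T_comm; simp)+
  show "T0 * R = R * T0" "T1 * R = R * T1"
    using D.Q_proj(3) cm_E(5)[OF R_cm(1) n] by (intro T_comm; simp)+
  show "T0 * S k = S k * T0" "T1 * S k = S k * T1" if "k < n"
    using D.Pr_proj(3)[OF that] cm_E(5)[OF R_cm(2)[OF that] n] by (intro T_comm; simp)+
  show "T0 * sx = sx * T0" "T1 * sx = sx * T1"
    using E.si_N(1,2) cm_E(6)[OF R_cm(3) n] by (intro T_comm; simp)+
  show "T0 * E.io = E.io * T0" "T1 * E.io = E.io * T1"
    using E.io_N(1,2) cm_E(7)[OF R_cm(3) n] by (intro T_comm; simp)+
  show "T0 * E.im = E.im * T0" "T1 * E.im = E.im * T1"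
    using E.im_N(1,2) cm_E(8)[OF R_cm(3) n] by (intro T_comm; simp)+
  show "T0 * sy = sy * T0" "T1 * sy = sy * T1"
    using D.si_N(1,2) cm_E(5)[OF R_cm(6) n] by (intro T_comm; simp)+
  show "T0 * D.io = D.io * T0" "T1 * D.io = D.io * T1"
    using D.io_N(1,2) cm_E(5)[OF R_cm(4) n] by (intro T_comm; simp)+
  show "T0 * D.im = D.im * T0" "T1 * D.im = D.im * T1"
    using D.im_N(1,2) cm_E(5)[OF R_cm(5) n] by (intro T_comm; simp)+
qed

text \<open>The equations between \<open>x\<close> and \<open>y\<close> read off in the cells (j,j)
  of \<open>T0\<close> and (j,j+1) of \<open>T1\<close>, where \<open>im\<close> supplies the
  parameter of the preceding level. The factor \<open>1 - E.N 0\<close> excludes (0,0), where the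
  last equation fails because \<open>y 0 = 0\<close>.\<close>

lemma scalars:
  "of_nat n *\<^sub>C (E.io * ((1 - D.io) * T0)) = T0" "of_nat n *\<^sub>C (E.io * ((1 - D.im) * T1)) = T1"
  "of_nat n *\<^sub>C (D.io * ((1 - E.io) * T1)) = T1" "of_nat n *\<^sub>C (D.io * ((1 - E.im) * ((1 - E.N 0) * T0))) = (1 - E.N 0) * T0"
proof -
  have *: "A * (B * C) * E.N j * D.N i = A * (B * (C * E.N j * D.N i))" for A B C i j
    by (simp add: mult.assoc)
  have D: "D.io * (E.N j * D.N i) = complex_of_real (y i) *\<^sub>C (E.N j * D.N i)"
      "D.im * (E.N j * D.N i) = complex_of_real (y (i - 1)) *\<^sub>C (E.N j * D.N i)" for i j
    using D.io_N(1)[of i] D.im_N(1)[of i] by (simp_all add: NN[symmetric]) (simp_all flip: mult.assoc)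
  have E: "E.io * (E.N j * D.N i) = complex_of_real (x j) *\<^sub>C (E.N j * D.N i)"
      "E.im * (E.N j * D.N i) = complex_of_real (x (j - 1)) *\<^sub>C (E.N j * D.N i)" for i j
    using E.io_N(1)[of j, THEN amul] E.im_N(1)[of j, THEN amul] by simp_all
  have c: "of_nat n * (complex_of_real (x j) * (1 - complex_of_real (y j))) = 1"
    "of_nat n * (complex_of_real (y (Suc j)) * (1 - complex_of_real (x j))) = 1" for j
    using arg_cong[OF xy(1)[of j], of complex_of_real] arg_cong[OF xy(2)[of j], of complex_of_real]
    by (simp_all add: mult.assoc)
  have c': "of_nat n * (complex_of_real (x j) - complex_of_real (y j) * complex_of_real (x j)) = 1"
    "of_nat n * (complex_of_real (y (Suc j)) - complex_of_real (x j) * complex_of_real (y (Suc j))) = 1" for j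
    using c[of j] by (simp_all add: algebra_simps)
  have s: "A - t *\<^sub>C A = (1 - t) *\<^sub>C A" for t and A :: "'a bop"
    by (simp add: csc.scale_left_diff_distrib)
  have r: "of_nat n *\<^sub>C (A * (B * C)) * E.N j * D.N i = of_nat n *\<^sub>C (A * (B * (C * E.N j * D.N i)))" for A B C i j
    by (simp add: mult.assoc)
  show "of_nat n *\<^sub>C (E.io * ((1 - D.io) * T0)) = T0"
    by (rule ext2) (simp only: r TN, simp add: D E left_diff_distrib s c')
  show "of_nat n *\<^sub>C (E.io * ((1 - D.im) * T1)) = T1"
    by (rule ext2) (simp only: r TN, simp add: D E left_diff_distrib s c')
  show "of_nat n *\<^sub>C (D.io * ((1 - E.io) * T1)) = T1"
    by (rule ext2) (simp only: r TN, simp add: D E left_diff_distrib s c')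
  show "of_nat n *\<^sub>C (D.io * ((1 - E.im) * ((1 - E.N 0) * T0))) = (1 - E.N 0) * T0"
  proof (rule ext2)
    fix i j
    have "(1 - E.N 0) * (T0 * E.N j * D.N i) = (if i = j \<and> j \<noteq> 0 then E.N j * D.N i else 0)"
      by (simp add: TN left_diff_distrib mult.assoc[symmetric] E.N(2))
    moreover have "of_nat n *\<^sub>C (D.io * ((1 - E.im) * (E.N j * D.N j))) = E.N j * D.N j" if "j \<noteq> 0"
      using that c'(2)[of "j - 1"] by (simp add: D E left_diff_distrib s)
    ultimately show "of_nat n *\<^sub>C (D.io * ((1 - E.im) * ((1 - E.N 0) * T0))) * E.N j * D.N i = (1 - E.N 0) * T0 * E.N j * D.N i"
      by (simp add: mult.assoc)
  qed
qed

lemma T_EF: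
  assumes l: "l < n"
  shows "R * E.F l = E.F l * R" "T0 * E.F l = E.F l * T0" "T1 * E.F l = E.F l * T1" "D.N j * E.F l = E.F l * D.N j"
proof -
  show "R * E.F l = E.F l * R"
    by (rule E.F_comm[OF R_cm(1) _ l]) (simp add: D.Q_Pr_comm(1)[OF cmD(2)])
  have N: "D.N j * E.F l = E.F l * D.N j" for j
    by (rule E.F_comm[OF R_cm(3) _ l]) (simp add: D.cmD(3)[OF cmD(2)])
  then show "D.N j * E.F l = E.F l * D.N j" .
  show "T0 * E.F l = E.F l * T0" "T1 * E.F l = E.F l * T1"
    using E.F_N[OF l] N by (intro T_comm; simp)+
qed

lemma Q_cm: "D.cm Q" "D.cm (E.N j)"
proof -
  show "D.cm (E.N j)" by (rule cmD(3))
  show "D.cm Q"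
    unfolding D.cm_def using cm_E(3)[OF cmE(1) n] cm_E(3)[OF cm_d_adj n] cm_E(3)[OF R_cm(3) n] by simp
qed

lemma T_DF:
  assumes l: "l < n"
  shows "Q * D.F l = D.F l * Q" "T0 * D.F l = D.F l * T0" "T1 * D.F l = D.F l * T1" "E.N j * D.F l = D.F l * E.N j"
proof -
  show "Q * D.F l = D.F l * Q"
    by (rule D.F_comm[OF Q_cm(1) _ l]) (simp add: E.Q_Pr_comm(1)[OF cmE(2)])
  have N: "E.N j * D.F l = D.F l * E.N j" for j
    by (rule D.F_comm[OF cmD(3) _ l]) (simp add: E.cmD(3)[OF cmE(2)])
  then show "E.N j * D.F l = D.F l * E.N j" .
  show "T0 * D.F l = D.F l * T0" "T1 * D.F l = D.F l * T1"
    using D.F_N[OF l] N by (intro T_comm; simp)+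
qed

sublocale eh: tower_conjugation levE n hE c \<beta> x R T1 T0
  by unfold_locales (simp_all add: D.Q_proj R_cm(1) T_E T T_alg Tc T_N T_EF)

text \<open>\<open>T0\<close> and \<open>T1\<close> are exchanged because \<open>d\<close> leads
  from \<open>T0\<close> to \<open>T1\<close>.\<close>

sublocale fh: tower_conjugation levD n hD d \<gamma> y Q T0 T1
  by unfold_locales (simp_all add: E.Q_proj Q_cm(1) T_E T T_alg Td T_N T_DF)

abbreviation e where "e \<equiv> eh.e"
abbreviation f' where "f' \<equiv> fh.e"

section \<open>The four partitions of unity and their relations\<close>

definition One where "One = Q * (R * T1) + (Q - E.N 0) * (R * T0)"

lemma QR: "R * Q = Q * R" "R * E.N j = E.N j * R" "Q * D.N j = D.N j * Q"
  using eh.R_E(1) E.cmD(3)[OF R_cm(1)] D.cmD(3)[OF Q_cm(1)] by simp_all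

lemma NQ: "Q * E.N 0 = E.N 0" "R * D.N 0 = D.N 0" "E.N 0 * Q = E.N 0" "D.N 0 * R = D.N 0"
  using E.QP_0(1) D.QP_0(1) E.Q_proj(3)[of 0] D.Q_proj(3)[of 0] by simp_all

text \<open>On \<open>T0\<close> both levels vanish together and on \<open>T1\<close> the second is
  never 0, so leaving out level 0 of either tower removes the same cell (0,0).\<close>

lemma One_alt: "One = (R - D.N 0) * (Q * T0) + (R - D.N 0) * (Q * T1)"
proof -
  have 1: "E.N 0 * (R * T0) = D.N 0 * (Q * T0)"
  proof -
    have "E.N 0 * (R * T0) = R * (D.N 0 * T0)"
      by (simp add: mult.assoc QR(2)[THEN amul] T00(1)[symmetric])
    also have "\<dots> = D.N 0 * T0" by (simp add: mult.assoc NQ(2)[THEN amul])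
    also have "\<dots> = Q * (E.N 0 * T0)" by (simp add: mult.assoc NQ(1)[THEN amul] T00(1)[symmetric])
    also have "\<dots> = D.N 0 * (Q * T0)" by (simp add: mult.assoc QR(3)[THEN amul] T00(1))
    finally show ?thesis .
  qed
  have 2: "D.N 0 * (Q * T1) = 0"
    by (simp add: mult.assoc QR(3)[of 0, symmetric, THEN amul] T00(2))
  have 3: "Q * (R * z) = R * (Q * z)" for z
    by (simp add: mult.assoc QR(1)[THEN amul])
  show ?thesis
    unfolding One_def left_diff_distrib 1 2 3 by simp
qed

text \<open>The starts differ: \<open>x 0\<close> is nonzero, so the first tower keeps its level 0
  in the \<open>T1\<close> block, whereas \<open>y 0 = 0\<close> removes level 0 from the
  \<open>T0\<close> block of \<open>sum_f'\<close>. The two sums coincide for this reason.\<close>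

lemma sum_e: "(\<Sum>k<n. e k) = One"
  unfolding eh.sum_e One_def using E.\<iota>0 x0 by simp

lemma sum_f': "(\<Sum>k<n. f' k) = One"
  unfolding fh.sum_e One_alt using y0 by simp

lemma pou_e: "pou n One e" and pou_f': "pou n One f'"
  unfolding pou_def by (simp_all add: sum_e sum_f' eh.e_adj fh.e_adj eh.e_mult fh.e_mult)

lemma One_proj: "adj One = One" "One * One = One"
proof -
  show a: "adj One = One"
    unfolding sum_e[symmetric] adj_sum by (simp add: eh.e_adj)
  have "(\<Sum>k<n. e k) * One = (\<Sum>k<n. e k)"
    unfolding sum_distrib_right by (intro sum.cong refl) (simp add: pouD(4)[OF pou_e])
  then show "One * One = One" by (simp add: sum_e)
qed

lemma One_comm: "l < n \<Longrightarrow> One * E.F l = E.F l * One" "l < n \<Longrightarrow> One * D.F l = D.F l * One"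
proof -
  have *: "E.N 0 * E.F l = E.F l * E.N 0" "D.N 0 * D.F l = D.F l * D.N 0" if "l < n"
    using E.F_N[OF that] D.F_N[OF that] by simp_all
  show "One * E.F l = E.F l * One" if l: "l < n"
    unfolding One_def
    by (simp add: distrib_left distrib_right left_diff_distrib right_diff_distrib mult.assoc T_EF[OF l] T_EF[OF l, THEN amul]
       E.F_Q[OF l, symmetric, THEN amul] *[OF l, THEN amul])
  show "One * D.F l = D.F l * One" if l: "l < n"
    unfolding One_alt
    by (simp add: distrib_left distrib_right left_diff_distrib right_diff_distrib mult.assoc T_DF[OF l] T_DF[OF l, THEN amul]
       D.F_Q[OF l, symmetric, THEN amul] *[OF l, THEN amul])
qed

definition f where "f l = E.F l * One"
definition g where "g l = D.F l * One"

lemma pou_cut: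
  assumes F: "pou n 1 F" and c: "\<And>l. l < n \<Longrightarrow> One * F l = F l * One"
  shows "pou n One (\<lambda>l. F l * One)"
  unfolding pou_def
proof (intro conjI allI impI)
  fix l assume l: "l < n"
  show "adj (F l * One) = F l * One"
    using pouD(1)[OF F l] One_proj c[OF l] by simp
  fix m assume m: "m < n"
  have "F l * One * (F m * One) = (F l * F m) * One"
    using c[OF m, THEN amul] One_proj by (simp add: mult.assoc)
  then show "F l * One * (F m * One) = (if l = m then F l * One else 0)"
    using pouD(2)[OF F l] pouD(3)[OF F l m] by (cases "l = m") simp_all
next
  show "(\<Sum>l<n. F l * One) = One"
    using pouD(6)[OF F n] by (simp flip: sum_distrib_right)
qed

lemma pou_f: "pou n One f" and pou_g: "pou n One g"
  using pou_cut[OF E.F One_comm(1)] pou_cut[OF D.F One_comm(2)] by (simp_all add: f_def[abs_def] g_def[abs_def])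

lemma inv_scalars:
  "E.io * ((1 - D.io) * T0) = (1 / of_nat n) *\<^sub>C T0" "E.io * ((1 - D.im) * T1) = (1 / of_nat n) *\<^sub>C T1"
  "D.io * ((1 - E.io) * T1) = (1 / of_nat n) *\<^sub>C T1"
  "D.io * ((1 - E.im) * ((1 - E.N 0) * T0)) = (1 / of_nat n) *\<^sub>C ((1 - E.N 0) * T0)"
  by (rule csc_inv[OF n scalars(1)] csc_inv[OF n scalars(2)] csc_inv[OF n scalars(3)] csc_inv[OF n scalars(4)])+

lemma DE_comm:
  assumes k: "k < n" and l: "l < n"
  shows "S l * P k = P k * S l" "S l * Q = Q * S l" "S l * E.io = E.io * S l" "S l * E.im = E.im * S l" "S l * E.N 0 = E.N 0 * S l"
    "D.io * P k = P k * D.io" "D.im * P k = P k * D.im" "R * P k = P k * R" "D.io * E.N 0 = E.N 0 * D.io"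
    "D.io * S l = S l * D.io" "D.im * S l = S l * D.im" "D.im * R = R * D.im" "E.io * P k = P k * E.io"
    "E.im * P k = P k * E.im" "E.im * Q = Q * E.im" "D.im * E.io = E.io * D.im" "E.im * E.N 0 = E.N 0 * E.im"
    "D.io * E.im = E.im * D.io"
proof -
  note 1 = R_cm(2)[OF l] and 2 = R_cm(4) and 3 = R_cm(5)
  show "S l * P k = P k * S l" "S l * Q = Q * S l" "S l * E.io = E.io * S l" "S l * E.im = E.im * S l" "S l * E.N 0 = E.N 0 * S l"
    by (rule cm_E[OF 1 k])+
  show "D.io * P k = P k * D.io" "D.im * P k = P k * D.im" "R * P k = P k * R"
    by (rule cm_E[OF 2 k] cm_E[OF 3 k] cm_E[OF R_cm(1) k])+
  show "D.io * E.N 0 = E.N 0 * D.io" "D.im * E.io = E.io * D.im" "D.io * E.im = E.im * D.io"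
    by (rule cm_E[OF 2 k] cm_E[OF 3 k])+
  show "D.io * S l = S l * D.io" "D.im * S l = S l * D.im" "D.im * R = R * D.im"
    by (rule D.io_comm[symmetric] D.im_comm[symmetric] D.Pr_proj(3)[OF l] D.Q_proj(3))+
  show "E.io * P k = P k * E.io" "E.im * P k = P k * E.im" "E.im * Q = Q * E.im"
    by (rule E.io_comm[symmetric] E.im_comm[symmetric] E.Pr_proj(3)[OF k] E.Q_proj(3))+
  show "E.im * E.N 0 = E.N 0 * E.im"
    by (simp add: E.im_N)
qed

lemma e_split: "k < n \<Longrightarrow> e k = (E.io * P k + Q * c k * sx) * (R * T1) + (adj (Q * c k * sx) + (1 - E.im) * (Q - P k)) * (R * T0)"
  by (simp add: eh.e_expand distrib_right E.Q_proj E.si_N mult.assoc)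

lemma f'_split: "l < n \<Longrightarrow> f' l = (D.io * S l + R * d l * sy) * (Q * T0) + (adj (R * d l * sy) + (1 - D.im) * (R - S l)) * (Q * T1)"
  by (simp add: fh.e_expand distrib_right D.Q_proj D.si_N mult.assoc)

lemma D_cm_mult: "D.cm a \<Longrightarrow> D.cm b \<Longrightarrow> D.cm (a * b)" "D.cm a \<Longrightarrow> D.cm b \<Longrightarrow> D.cm (a - b)"
  and E_cm_mult: "E.cm a \<Longrightarrow> E.cm b \<Longrightarrow> E.cm (a * b)" "E.cm a \<Longrightarrow> E.cm b \<Longrightarrow> E.cm (a - b)"
  and cm_1: "D.cm 1" "E.cm 1"
proof -
  have *: "a * b * x = x * (a * b)" "(a - b) * x = x * (a - b)" if "a * x = x * a" "b * x = x * b" for a b x :: "'a bop"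
    using that that(1)[THEN amul] by (simp_all add: mult.assoc algebra_simps)
  show "D.cm a \<Longrightarrow> D.cm b \<Longrightarrow> D.cm (a * b)" "D.cm a \<Longrightarrow> D.cm b \<Longrightarrow> D.cm (a - b)"
    "E.cm a \<Longrightarrow> E.cm b \<Longrightarrow> E.cm (a * b)" "E.cm a \<Longrightarrow> E.cm b \<Longrightarrow> E.cm (a - b)"
    unfolding D.cm_def E.cm_def by (simp_all add: *)
  show "D.cm 1" "E.cm 1"
    unfolding D.cm_def E.cm_def by simp_all
qed

lemma P_cm: "k < n \<Longrightarrow> D.cm (P k)" "D.cm E.io" "D.cm E.im" "D.cm sx"
  unfolding D.cm_def
  using cm_E(4)[OF cmE(1)] cm_E(4)[OF cm_d_adj] cm_E(4)[OF R_cm(3)]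
    cm_E(6)[OF cmE(1) n] cm_E(6)[OF cm_d_adj n] cm_E(6)[OF R_cm(3) n]
    cm_E(7)[OF cmE(1) n] cm_E(7)[OF cm_d_adj n] cm_E(7)[OF R_cm(3) n]
    cm_E(8)[OF cmE(1) n] cm_E(8)[OF cm_d_adj n] cm_E(8)[OF R_cm(3) n] by simp_all

text \<open>In each cell the two weights are products such as \<open>x j * (1 - y j)\<close>, equal
  to 1 / n by the choice of the parameters. So \<open>S l\<close> and \<open>R - S l\<close> receive
  the same coefficient and add up to \<open>R\<close>; the second relation works likewise with
  \<open>P k\<close> and \<open>Q - P k\<close>.\<close>

lemma unbiased_e_f':
  assumes k: "k < n" and l: "l < n"
  shows "unbiased (1 / of_nat n) (e k) (f' l)"
  unfolding unbiased_def
proof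
  note com = DE_comm[OF k l]
  show "e k * f' l * e k = (1 / of_nat n) *\<^sub>C e k"
  proof (rule eh.e_z_e[OF k _ _ _ f'_split[OF l]])
    show "E.cm (D.io * S l)" "E.cm (R * d l * sy)" "E.cm ((1 - D.im) * (R - S l))"
      by (intro E_cm_mult cm_1 R_cm cmE l)+
    show "T0 * (D.io * S l) = D.io * S l * T0" "T1 * (D.io * S l) = D.io * S l * T1"
      by (simp_all add: mult.assoc T_E(7,8)[OF l] T_E(15,16)[THEN amul])
    show "T1 * ((1 - D.im) * (R - S l)) = (1 - D.im) * (R - S l) * T1"
      by (simp add: mult.assoc left_diff_distrib right_diff_distrib T_E(6) T_E(8)[OF l] T_E(20)[THEN amul])
    show "T1 * (R * d l * sy) = R * d l * sy * T0"
      by (simp add: mult.assoc T_E(6)[THEN amul] Td[OF l, THEN amul] T_E(11))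
    have 1: "D.io * S l * ((1 - E.io) * (P k * T1)) = S l * (P k * (D.io * ((1 - E.io) * T1)))"
      by (simp add: mult.assoc left_diff_distrib right_diff_distrib com com[THEN amul])
    have 2: "(1 - D.im) * (R - S l) * (E.io * (P k * T1)) = (R - S l) * (P k * (E.io * ((1 - D.im) * T1)))"
      by (simp add: mult.assoc left_diff_distrib right_diff_distrib com[THEN amul])
    have 3: "S l * y + (R - S l) * y = R * y" for y
      by (simp add: left_diff_distrib)
    show "R * (D.io * S l * ((1 - E.io) * (P k * T1)) + (1 - D.im) * (R - S l) * (E.io * (P k * T1))) =
      (1 / of_nat n) *\<^sub>C (R * (P k * T1))"
      unfolding 1 2 inv_scalars 3 by (simp add: D.Q_proj(2)[THEN amul])
  qed
  show "f' l * e k * f' l = (1 / of_nat n) *\<^sub>C f' l"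
  proof (rule fh.e_z_e[OF l _ _ _ e_split[OF k]])
    show "D.cm (E.io * P k)" "D.cm (Q * c k * sx)" "D.cm ((1 - E.im) * (Q - P k))"
      by (intro D_cm_mult cm_1 P_cm Q_cm cmD k)+
    show "T1 * (E.io * P k) = E.io * P k * T1" "T0 * (E.io * P k) = E.io * P k * T0"
      by (simp_all add: mult.assoc T_E(3,4)[OF k] T_E(13,14)[THEN amul])
    show "T0 * ((1 - E.im) * (Q - P k)) = (1 - E.im) * (Q - P k) * T0"
      by (simp add: mult.assoc left_diff_distrib right_diff_distrib T_E(1) T_E(3)[OF k] T_E(17)[THEN amul])
    show "T0 * (Q * c k * sx) = Q * c k * sx * T1"
      by (simp add: mult.assoc T_E(1)[THEN amul] Tc[OF k, THEN amul] T_E(10))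
    have 1: "(Q - P k) * (1 - E.N 0) = Q - P k"
      using NQ(1) E.QP_0(2)[OF k] by (simp add: left_diff_distrib right_diff_distrib)
    have 2: "E.io * P k * ((1 - D.io) * (S l * T0)) = P k * (S l * (E.io * ((1 - D.io) * T0)))"
      by (simp add: mult.assoc left_diff_distrib right_diff_distrib com com[THEN amul])
    have 3: "(1 - E.im) * ((Q - P k) * (1 - E.N 0)) * (D.io * (S l * T0)) =
        (Q - P k) * (S l * (D.io * ((1 - E.im) * ((1 - E.N 0) * T0))))"
      by (simp add: mult.assoc left_diff_distrib right_diff_distrib com[THEN amul])
    have 4: "(Q - P k) * (S l * ((1 - E.N 0) * T0)) = (Q - P k) * (1 - E.N 0) * (S l * T0)"
      by (simp add: com(5)[THEN amul] mult.assoc left_diff_distrib right_diff_distrib)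
    have 5: "P k * y + (Q - P k) * y = Q * y" for y
      by (simp add: left_diff_distrib)
    have "Q * (E.io * P k * ((1 - D.io) * (S l * T0)) + (1 - E.im) * (Q - P k) * (D.io * (S l * T0))) =
      Q * (E.io * P k * ((1 - D.io) * (S l * T0)) + (1 - E.im) * ((Q - P k) * (1 - E.N 0)) * (D.io * (S l * T0)))"
      unfolding 1 ..
    also have "\<dots> = Q * (P k * ((1 / of_nat n) *\<^sub>C (S l * T0)) + (Q - P k) * (1 - E.N 0) * ((1 / of_nat n) *\<^sub>C (S l * T0)))"
      unfolding 2 3 inv_scalars using 4 by simp
    also have "\<dots> = (1 / of_nat n) *\<^sub>C (Q * (S l * T0))"
      unfolding 1 5 by (simp add: E.Q_proj(2)[THEN amul])
    finally show "Q * (E.io * P k * ((1 - D.io) * (S l * T0)) + (1 - E.im) * (Q - P k) * (D.io * (S l * T0))) =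
      (1 / of_nat n) *\<^sub>C (Q * (S l * T0))" .
  qed
qed

lemma F_cm: "i < n \<Longrightarrow> E.cm (D.F i)" "i < n \<Longrightarrow> D.cm (E.F i)"
proof -
  assume i: "i < n"
  show "E.cm (D.F i)"
    unfolding E.cm_def
    using D.F_comm[OF cmD(1) _ i] D.F_comm[OF cmD_adj_c _ i] T_DF(4)[OF i] E.cmD(1,2)[OF cmE(2)] by simp
  show "D.cm (E.F i)"
    unfolding D.cm_def
    using E.F_comm[OF cmE(1) _ i] E.F_comm[OF cm_d_adj _ i] T_EF(4)[OF i] D.cmD(1,2)[OF cmD(2)] by simp
qed

text \<open>Unbiasedness climbs one tower at a time: \<open>y_F_y\<close> and \<open>F_z_F\<close>
  pass from the pair \<open>\<beta>\<close>, \<open>\<gamma>\<close> to a pair with one full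
  partition, and then to both partitions \<open>F\<close>.\<close>

lemma F_F:
  assumes i: "i < n" and l: "l < n"
  shows "D.F i * E.F l * D.F i = (1 / of_nat n) *\<^sub>C D.F i" "E.F l * D.F i * E.F l = (1 / of_nat n) *\<^sub>C E.F l"
proof -
  have b: "\<beta> k * D.F i * \<beta> k = (1 / of_nat n) *\<^sub>C \<beta> k" if "k < n" for k
    by (rule D.y_F_y[OF cmD(2)[OF that] _ i]) (use \<beta>\<gamma>[OF that] in \<open>simp add: unbiased_def\<close>)
  show "E.F l * D.F i * E.F l = (1 / of_nat n) *\<^sub>C E.F l"
    by (rule E.F_z_F[OF F_cm(1)[OF i] b l])
  have g: "\<gamma> k * E.F l * \<gamma> k = (1 / of_nat n) *\<^sub>C \<gamma> k" if "k < n" for k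
    by (rule E.y_F_y[OF cmE(2)[OF that] _ l]) (use \<beta>\<gamma>[OF _ that] in \<open>simp add: unbiased_def\<close>)
  show "D.F i * E.F l * D.F i = (1 / of_nat n) *\<^sub>C D.F i"
    by (rule D.F_z_F[OF F_cm(2)[OF l] g i])
qed

text \<open>\<open>D.F i\<close> lies in the commutant of the first tower, and it commutes with the
  factors \<open>R\<close> and \<open>T1\<close> in \<open>e k\<close>.\<close>

lemma g_e:
  assumes i: "i < n" and k: "k < n"
  shows "g i * e k = e k * g i"
proof -
  note c = cm_E(1-4,6)[OF F_cm(1)[OF i] k] T_DF(3)[OF i, symmetric] D.F_Q[OF i]
  have "D.F i * e k = e k * D.F i"
    unfolding eh.e_def eh.adj_X[OF k] unfolding eh.X_eq[OF k]
    by (simp add: distrib_left distrib_right mult.assoc c c[THEN amul])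
  moreover have "One * e k = e k" "e k * One = e k"
    using pouD(4,5)[OF pou_e k] by simp_all
  ultimately show ?thesis
    unfolding g_def One_comm(2)[OF i, symmetric]
    by (simp add: mult.assoc) (simp add: mult.assoc[symmetric])
qed

lemma f'_f:
  assumes i: "i < n" and k: "k < n"
  shows "f' i * f k = f k * f' i"
proof -
  have D: "z * R = R * z" "z * S i = S i * z" "z * d i = d i * z" "z * adj (d i) = adj (d i) * z" "z * sy = sy * z"
    if "D.cm z" for z
    using D.cmD[OF that] D.Q_Pr_comm[OF that] D.si_comm[of z] i by simp_all
  note c = D[OF F_cm(2)[OF k]] T_EF(2)[OF k, symmetric] E.F_Q[OF k]
  have "E.F k * f' i = f' i * E.F k"
    unfolding fh.e_def fh.adj_X[OF i] unfolding fh.X_eq[OF i]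
    by (simp add: distrib_left distrib_right mult.assoc c c[THEN amul])
  moreover have "One * f' i = f' i" "f' i * One = f' i"
    using pouD(4,5)[OF pou_f' i] by simp_all
  ultimately show ?thesis
    unfolding f_def One_comm(1)[OF k, symmetric]
    by (simp add: mult.assoc) (simp add: mult.assoc[symmetric])
qed

lemma unbiased_g_f:
  assumes i: "i < n" and l: "l < n"
  shows "unbiased (1 / of_nat n) (g i) (f l)"
proof -
  have *: "a * One * (b * One) * (a * One) = a * b * a * One" if "One * a = a * One" "One * b = b * One" for a b
    using that One_proj(2) by (simp add: mult.assoc that(1)[THEN amul] that(2)[THEN amul])
  show ?thesis
    unfolding unbiased_def f_def g_def *[OF One_comm(2)[OF i] One_comm(1)[OF l]] *[OF One_comm(1)[OF l] One_comm(2)[OF i]] F_F[OF i l]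
    by simp
qed

text \<open>If one member of a covariant family vanishes, all do, and so does their sum
  \<open>One\<close>. But \<open>One\<close> is nonzero in the cell (0,1).\<close>

lemma e_nonzero:
  assumes nz: "D.N 0 * E.N 0 \<noteq> 0"
  shows "e 0 \<noteq> 0"
proof
  assume e0: "e 0 = 0"
  obtain Y where Y: "\<And>k. k < n \<Longrightarrow> e k = adj (E.U k) * Y * E.U k"
    using eh.cov_e by (metis E.covE)
  have "E.U 0 * e 0 * adj (E.U 0) = Y"
    using E.U_unitary[OF n] E.U_unitary(1)[OF n, THEN amul] by (simp add: Y[OF n] mult.assoc)
  then have "Y = 0" by (simp add: e0)
  then have "e k = 0" if "k < n" for k using Y[OF that] by simp
  then have "One = 0" unfolding sum_e[symmetric] by simp
  then have "0 = One * E.N 0 * D.N 1" by simp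
  also have "\<dots> = Q * (R * (T1 * E.N 0 * D.N 1)) + (Q - E.N 0) * (R * (T0 * E.N 0 * D.N 1))"
    by (simp add: One_def distrib_right mult.assoc)
  also have "\<dots> = Q * (R * (E.N 0 * D.N 1))"
    by (simp add: TN)
  also have "\<dots> = R * (D.N 1 * E.N 0)"
    by (simp add: mult.assoc QR(1)[symmetric, THEN amul] NQ(1)[THEN amul] NN)
  \<comment> \<open>Pulling the cell (0,1) back to (0,0) by \<open>d 0\<close> gives the weight
    \<open>1 - y 0\<close>, which is 1.\<close>
  finally have "0 = adj (d 0) * (R * (D.N 1 * E.N 0)) * d 0" by simp
  also have "\<dots> = adj (d 0) * R * d 0 * D.N 0 * E.N 0"
    using D.c_N[OF n, of 0, THEN amul] E.cmD(3)[OF cmE(1)[OF n], of 0] D.c_N[OF n, of 0] by (simp add: mult.assoc)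
  also have "\<dots> = (S 0 - D.io * S 0) * D.N 0 * E.N 0"
    using D.adj_c_Q_c[OF n n] D.Pr_proj(2)[OF n] by (simp add: mult.assoc)
  also have "\<dots> = D.N 0 * E.N 0"
    using D.QP_0(2)[OF n] D.io_N(1)[of 0] y0 by (simp add: left_diff_distrib mult.assoc)
  finally show False using nz by simp
qed

text \<open>The family that \<open>u\<close> is made of is the covariant one, so the dual statement
  \<open>cov_conj_const\<close> applies; its conjugate coefficients are why this tower runs on the
  conjugate of \<open>H\<close>.\<close>

lemma hpair_e:
  assumes H: "hmat n H" "\<And>l k. hE l k = cnj (H l k)"
  obtains W where "hpair n H One e f W"
proof -
  let ?u = "\<lambda>l. comb n (\<lambda>k. H l k) e"
  have u: "?u l * E.F l * adj (?u l) = ?u r * E.F r * adj (?u r)" if "l < n" "r < n" for l r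
    using E.cov_conj_const[OF eh.cov_e pou_e that] unfolding H(2) by simp
  have uO: "?u l * One = ?u l" for l
    unfolding comb_def sum_distrib_right using pouD(4)[OF pou_e] by (auto intro!: sum.cong)
  have "hpair n H One e f (?u 0 * E.F 0 * adj (?u 0))"
  proof (unfold_locales; (rule n H(1) pou_e pou_f)?)
    fix l assume l: "l < n"
    have "?u l * f l * adj (?u l) = ?u l * One * E.F l * adj (?u l)"
      unfolding f_def One_comm(1)[OF l, symmetric] by (simp add: mult.assoc)
    then show "(\<Sum>k<n. H l k *\<^sub>C e k) * f l * adj (\<Sum>k<n. H l k *\<^sub>C e k) = ?u 0 * E.F 0 * adj (?u 0)"
      using u[OF l n] uO[of l] by (simp add: comb_def)
  qed
  then show ?thesis by (rule that)
qed

text \<open>Here \<open>u\<close> is made of the partition \<open>F\<close> and coincides with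
  \<open>U\<close> cut down by \<open>One\<close>, so covariance is used directly.
  \<open>U k\<close> runs over a column, hence the transpose.\<close>

lemma hpair_f':
  assumes H: "hmat n H" "\<And>l k. hD l k = H k l"
  obtains W where "hpair n H One g f' W"
proof -
  obtain Y where Y: "\<And>k. k < n \<Longrightarrow> f' k = adj (D.U k) * Y * D.U k"
    using fh.cov_e by (metis D.covE)
  have "hpair n H One g f' Y"
  proof (unfold_locales; (rule n H(1) pou_g pou_f')?)
    fix l assume l: "l < n"
    have "(\<Sum>k<n. H l k *\<^sub>C g k) = D.U l * One"
      unfolding D.U_def D.uu_def comb_def sum_distrib_right g_def H(2) by simp
    then have "(\<Sum>k<n. H l k *\<^sub>C g k) * f' l * adj (\<Sum>k<n. H l k *\<^sub>C g k) = D.U l * (One * f' l * One) * adj (D.U l)"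
      by (simp add: One_proj mult.assoc)
    also have "One * f' l * One = f' l"
      by (simp add: pouD(4,5)[OF pou_f' l])
    also have "D.U l * f' l * adj (D.U l) = Y"
      unfolding Y[OF l] by (simp add: mult.assoc D.U_unitary[OF l] D.U_unitary(1)[OF l, THEN amul])
    finally show "(\<Sum>k<n. H l k *\<^sub>C g k) * f' l * adj (\<Sum>k<n. H l k *\<^sub>C g k) = Y" .
  qed
  then show ?thesis by (rule that)
qed

end

lemma weakly_quantum_equivalent_of_tower_pair:
  fixes levE :: "'a :: countable \<Rightarrow> nat"
  assumes sq: "tower_pair levE levD n (\<lambda>l k. cnj (H $$ (l, k))) (\<lambda>l k. H' $$ (k, l)) c d \<beta> \<gamma> x y T0 T1"
    and H: "hmat n (\<lambda>l k. H $$ (l, k))" "hmat n (\<lambda>l k. H' $$ (l, k))"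
    and nz: "levE a = 0" "levD a = 0"
  shows "weakly_quantum_equivalent n H H'"
proof -
  interpret tower_pair levE levD n "\<lambda>l k. cnj (H $$ (l, k))" "\<lambda>l k. H' $$ (k, l)" c d \<beta> \<gamma> x y T0 T1
    by fact
  obtain W where W: "hpair n (\<lambda>l k. H $$ (l, k)) One e f W"
    using hpair_e[OF H(1)] by blast
  obtain W' where W': "hpair n (\<lambda>l k. H' $$ (l, k)) One g f' W'"
    using hpair_f'[OF H(2)] by blast
  have "D.N 0 * E.N 0 \<noteq> 0"
  proof
    assume "D.N 0 * E.N 0 = 0"
    then have "Rep_ell2 (app (D.N 0 * E.N 0) x) a = 0" for x by simp
    then have "Rep_ell2 x a = 0" for x
      using nz by (simp add: D.N_def E.N_def)
    from this[of "ket a"] show False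
      by simp
  qed
  then show ?thesis
    by (intro weakly_quantum_equivalent_of_families[OF W W' g_e f'_f unbiased_e_f' unbiased_g_f e_nonzero])
qed

section \<open>Fock spaces for sizes at least four\<close>

lemma Rep_app_sum: "Rep_ell2 (app (\<Sum>k\<in>K. A k) x) i = (\<Sum>k\<in>K. Rep_ell2 (app (A k) x) i)"
  by (induction K rule: infinite_finite_induct) simp_all

text \<open>In the model, \<open>b l\<close> are diagonal matrix units, \<open>p\<close> projects
  onto the all-ones vector and \<open>g i\<close> onto column i of \<open>h\<close>. This supplies
  the second initial partition.\<close>

lemma (in tower) pou_conj:
  assumes p: "adj p = p" "p * p = p" "\<And>l. l < n \<Longrightarrow> p * b l * p = (1 / of_nat n) *\<^sub>C p"
    "\<And>l. l < n \<Longrightarrow> b l * p * b l = (1 / of_nat n) *\<^sub>C b l"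
  defines "g \<equiv> \<lambda>i. uu b i * p * adj (uu b i)"
  shows "pou n 1 g" "l < n \<Longrightarrow> i < n \<Longrightarrow> unbiased (1 / of_nat n) (b l) (g i)"
proof -
  have pup: "p * (adj (uu b i) * uu b j) * p = (if i = j then p else 0)" if "i < n" "j < n" for i j
  proof -
    have "p * (adj (uu b i) * uu b j) * p = (\<Sum>l<n. (cnj (h l i) * h l j) *\<^sub>C (p * b l * p))"
      unfolding uu(7)[OF b that] sum_distrib_left sum_distrib_right by simp
    also have "\<dots> = (\<Sum>l<n. h l j * cnj (h l i)) *\<^sub>C ((1 / of_nat n) *\<^sub>C p)"
      unfolding csc.scale_sum_left by (intro sum.cong refl) (simp add: p(3) mult.commute)
    finally show ?thesis
      using hmatD(5)[OF h that(2,1)] n by auto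
  qed
  show "pou n 1 g"
    unfolding pou_def
  proof (intro conjI allI impI)
    fix i assume i: "i < n"
    show "adj (g i) = g i" by (simp add: g_def p mult.assoc)
    fix j assume j: "j < n"
    have "g i * g j = uu b i * (p * (adj (uu b i) * uu b j) * p) * adj (uu b j)"
      by (simp add: g_def mult.assoc)
    then show "g i * g j = (if i = j then g i else 0)"
      unfolding pup[OF i j] by (simp add: g_def)
  next
    have "(\<Sum>i<n. g i) = of_nat n *\<^sub>C (\<Sum>l<n. b l * p * b l)"
      unfolding g_def by (rule sum_uu_conj[OF b])
    then show "(\<Sum>i<n. g i) = 1"
      using pouD(6)[OF b n] n by (simp add: p(4) csc.scale_sum_right[symmetric])
  qed
  show "unbiased (1 / of_nat n) (b l) (g i)" if l: "l < n" and i: "i < n"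
    unfolding unbiased_def
  proof
    have "b l * g i * b l = (b l * uu b i) * p * (adj (uu b i) * b l)"
      by (simp add: g_def mult.assoc)
    also have "\<dots> = (h l i * cnj (h l i)) *\<^sub>C (b l * p * b l)"
      by (simp add: uu[OF b i] l mult.commute)
    finally show "b l * g i * b l = (1 / of_nat n) *\<^sub>C b l"
      using hmatD(2)[OF h l i] by (simp add: p(4)[OF l])
    have "g i * b l * g i = uu b i * p * (adj (uu b i) * b l * uu b i) * p * adj (uu b i)"
      by (simp add: g_def mult.assoc)
    also have "adj (uu b i) * b l * uu b i = (h l i * cnj (h l i)) *\<^sub>C b l"
      by (simp add: uu[OF b i] l mult.commute)
    also have "uu b i * p * ((h l i * cnj (h l i)) *\<^sub>C b l) * p * adj (uu b i) = uu b i * (p * b l * p) * adj (uu b i)"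
      using hmatD(2)[OF h l i] by (simp add: mult.assoc)
    finally show "g i * b l * g i = (1 / of_nat n) *\<^sub>C g i"
      by (simp add: p(3)[OF l] g_def)
  qed
qed

locale fock_model =
  fixes n :: nat
  assumes n4: "4 \<le> n"
begin

section \<open>The interlaced parameters\<close>

primrec y :: "nat \<Rightarrow> real" where
  "y 0 = 0"
| "y (Suc j) = 1 / (n * (1 - 1 / (n * (1 - y j))))"

definition x :: "nat \<Rightarrow> real" where "x j = 1 / (n * (1 - y j))"

text \<open>For \<open>t\<close> up to 1/2 the denominator is at least 2 as soon as \<open>n\<close>
  is at least 4, so the interval from 0 to 1/2 is mapped into itself.\<close>

lemma xy_step: "0 \<le> t \<Longrightarrow> t \<le> 1 / 2 \<Longrightarrow> 0 < 1 / (n * (1 - t)) \<and> 1 / (n * (1 - t)) \<le> 1 / 2" for t :: real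
proof -
  assume t: "0 \<le> t" "t \<le> 1 / 2"
  have "4 * (1 / 2) \<le> real n * (1 - t)"
    using n4 t by (intro mult_mono) auto
  then show ?thesis by (simp add: divide_simps)
qed

lemma xy_bounds: "0 \<le> y j" "y j \<le> 1 / 2" "0 < x j" "x j \<le> 1 / 2"
proof -
  have *: "0 \<le> y j \<and> y j \<le> 1 / 2" for j
  proof (induction j)
    case (Suc j)
    then have "0 < x j \<and> x j \<le> 1 / 2" unfolding x_def by (intro xy_step) auto
    then show ?case using xy_step[of "x j"] by (auto simp: x_def)
  qed simp
  then show "0 \<le> y j" "y j \<le> 1 / 2" by auto
  show "0 < x j" "x j \<le> 1 / 2" unfolding x_def using xy_step[of "y j"] * by auto
qed

lemma y_Suc: "y (Suc j) = 1 / (n * (1 - x j))"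
  by (simp add: x_def)

declare y.simps(2) [simp del]

lemma xy: "n * x j * (1 - y j) = 1" "n * y (Suc j) * (1 - x j) = 1"
proof -
  show "n * x j * (1 - y j) = 1"
    using xy_bounds(2)[of j] n4 by (simp add: x_def)
  show "n * y (Suc j) * (1 - x j) = 1"
    unfolding y_Suc using xy_bounds(4)[of j] n4 by simp
qed

text \<open>Eliminating the other sequence from the two interlacing equations leaves exactly the
  recursion that each tower demands of its own parameters.\<close>

lemma xy_rec: "x (Suc j) * (n - 1 / (1 - x j)) = 1" "y (Suc j) * (n - 1 / (1 - y j)) = 1"
proof -
  have "1 - x j \<noteq> 0"
    using xy_bounds(4)[of j] by auto
  then have "1 / (1 - x j) = n * y (Suc j)"
    using xy(2)[of j] by (simp only: divide_eq_eq if_True simp_thms)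
  then have "n - 1 / (1 - x j) = n * (1 - y (Suc j))"
    by (simp add: right_diff_distrib)
  then show "x (Suc j) * (n - 1 / (1 - x j)) = 1"
    using xy(1)[of "Suc j"] by (simp add: mult_ac)
  have "1 - y j \<noteq> 0"
    using xy_bounds(2)[of j] by auto
  then have "1 / (1 - y j) = n * x j"
    using xy(1)[of j] by (simp only: divide_eq_eq if_True simp_thms)
  then have "n - 1 / (1 - y j) = n * (1 - x j)"
    by (simp add: right_diff_distrib)
  then show "y (Suc j) * (n - 1 / (1 - y j)) = 1"
    using xy(2)[of j] by (simp add: mult_ac)
qed

text \<open>Basis indices for two Fock spaces, an n-dimensional space and a multiplicity space: two
  words and a number, whose residue modulo n is the coordinate. Letters and number are unbounded
  since a type cannot depend on \<open>n\<close>.\<close>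

type_synonym pt = "nat list \<times> nat list \<times> nat"

definition levE :: "pt \<Rightarrow> nat" where "levE = (\<lambda>(as, bs, v). length as)"
definition levD :: "pt \<Rightarrow> nat" where "levD = (\<lambda>(as, bs, v). length bs)"

text \<open>The creation operator that puts the letter \<open>k\<close> in front. As
  \<open>part\<close> reads off coordinates at the target, the function removes that letter.\<close>

definition c :: "nat \<Rightarrow> pt bop" where
  "c k = part (\<lambda>(as, bs, v). case as of [] \<Rightarrow> None | a # as' \<Rightarrow> if a = k then Some (as', bs, v) else None)"
definition d :: "nat \<Rightarrow> pt bop" where
  "d k = part (\<lambda>(as, bs, v). case bs of [] \<Rightarrow> None | b # bs' \<Rightarrow> if b = k then Some (as, bs', v) else None)"
definition \<beta> :: "nat \<Rightarrow> pt bop" where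
  "\<beta> l = ind (\<lambda>(as, bs, v). v mod n = l)"
text \<open>A matrix unit acting inside every block of n consecutive numbers. Averaged over all
  positions, these give \<open>p\<close>, the projection onto vectors constant on the
  blocks.\<close>

definition \<epsilon> :: "nat \<Rightarrow> nat \<Rightarrow> pt bop" where
  "\<epsilon> l m = part (\<lambda>(as, bs, v). if v mod n = l then Some (as, bs, v div n * n + m) else None)"
definition p :: "pt bop" where
  "p = (1 / of_nat n) *\<^sub>C (\<Sum>l<n. \<Sum>m<n. \<epsilon> l m)"
definition T0 :: "pt bop" where "T0 = ind (\<lambda>(as, bs, v). length bs = length as)"
definition T1 :: "pt bop" where "T1 = ind (\<lambda>(as, bs, v). length bs = Suc (length as))"

lemma n: "n > 0" using n4 by simp

lemma Rep_c:
  "Rep_ell2 (app (c k) z) (as, bs, v) = (case as of [] \<Rightarrow> 0 | a # as' \<Rightarrow> if a = k then Rep_ell2 z (as', bs, v) else 0)"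
  "Rep_ell2 (app (adj (c k)) z) (as, bs, v) = Rep_ell2 z (k # as, bs, v)"
proof -
  let ?h = "\<lambda>(as, bs, v). Some (k # as, bs, v)"
  have gh: "(case i of (as, bs, v) \<Rightarrow> case as of [] \<Rightarrow> None | a # as' \<Rightarrow> if a = k then Some (as', bs, v) else None) = Some j
      \<longleftrightarrow> ?h j = Some i" for i j :: pt
    by (cases i; cases j) (auto split: list.splits)
  show "Rep_ell2 (app (c k) z) (as, bs, v) = (case as of [] \<Rightarrow> 0 | a # as' \<Rightarrow> if a = k then Rep_ell2 z (as', bs, v) else 0)"
    unfolding c_def part(1)[OF gh] by (simp split: list.splits)
  show "Rep_ell2 (app (adj (c k)) z) (as, bs, v) = Rep_ell2 z (k # as, bs, v)"
    unfolding c_def part(2)[OF gh] part(1)[OF gh[symmetric]] by simp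
qed

lemma Rep_d:
  "Rep_ell2 (app (d k) z) (as, bs, v) = (case bs of [] \<Rightarrow> 0 | b # bs' \<Rightarrow> if b = k then Rep_ell2 z (as, bs', v) else 0)"
  "Rep_ell2 (app (adj (d k)) z) (as, bs, v) = Rep_ell2 z (as, k # bs, v)"
proof -
  let ?h = "\<lambda>(as, bs, v). Some (as, k # bs, v)"
  have gh: "(case i of (as, bs, v) \<Rightarrow> case bs of [] \<Rightarrow> None | b # bs' \<Rightarrow> if b = k then Some (as, bs', v) else None) = Some j
      \<longleftrightarrow> ?h j = Some i" for i j :: pt
    by (cases i; cases j) (auto split: list.splits)
  show "Rep_ell2 (app (d k) z) (as, bs, v) = (case bs of [] \<Rightarrow> 0 | b # bs' \<Rightarrow> if b = k then Rep_ell2 z (as, bs', v) else 0)"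
    unfolding d_def part(1)[OF gh] by (simp split: list.splits)
  show "Rep_ell2 (app (adj (d k)) z) (as, bs, v) = Rep_ell2 z (as, k # bs, v)"
    unfolding d_def part(2)[OF gh] part(1)[OF gh[symmetric]] by simp
qed

lemma same_block: "u div n * n + v mod n = v" if "v div n * n + u mod n = u"
proof -
  have "(v div n * n + u mod n) div n = v div n"
    using n by simp
  then have "u div n = v div n" by (simp add: that)
  then show ?thesis by simp
qed

lemma \<epsilon>:
  assumes "l < n" "m < n"
  shows "Rep_ell2 (app (\<epsilon> l m) z) (as, bs, v) = (if v mod n = l then Rep_ell2 z (as, bs, v div n * n + m) else 0)"
    "adj (\<epsilon> l m) = \<epsilon> m l"
proof -
  have gh: "(case i of (as, bs, v) \<Rightarrow> if v mod n = l then Some (as, bs, v div n * n + m) else None) = Some j \<longleftrightarrow>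
     (case j of (as, bs, v) \<Rightarrow> if v mod n = m then Some (as, bs, v div n * n + l) else None) = Some i" for i j :: pt
    using assms by (cases i; cases j) (auto dest: same_block)
  show "Rep_ell2 (app (\<epsilon> l m) z) (as, bs, v) = (if v mod n = l then Rep_ell2 z (as, bs, v div n * n + m) else 0)"
    unfolding \<epsilon>_def part(1)[OF gh] by simp
  show "adj (\<epsilon> l m) = \<epsilon> m l"
    unfolding \<epsilon>_def part(2)[OF gh] ..
qed

lemma Rep_p: "Rep_ell2 (app p z) (as, bs, v) = (1 / of_nat n) * (\<Sum>m<n. Rep_ell2 z (as, bs, v div n * n + m))"
proof -
  have "(\<Sum>l<n. \<Sum>m<n. if v mod n = l then Rep_ell2 z (as, bs, v div n * n + m) else 0) =
      (\<Sum>l<n. if v mod n = l then \<Sum>m<n. Rep_ell2 z (as, bs, v div n * n + m) else 0)"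
    by (intro sum.cong) auto
  then show ?thesis
    using n by (simp add: p_def Rep_app_sum \<epsilon>)
qed

lemma bop_pt_eqI: "(\<And>z as bs v. Rep_ell2 (app A z) (as, bs, v) = Rep_ell2 (app B z) (as, bs, v)) \<Longrightarrow> A = (B :: pt bop)"
  by (rule bop_eqI, rule ell2_eqI) (metis prod_cases3)

lemma Rep_\<beta>: "Rep_ell2 (app (\<beta> l) z) (as, bs, v) = (if v mod n = l then Rep_ell2 z (as, bs, v) else 0)"
  by (simp add: \<beta>_def)

lemma p: "adj p = p" "p * p = p" "l < n \<Longrightarrow> p * \<beta> l * p = (1 / of_nat n) *\<^sub>C p" "l < n \<Longrightarrow> \<beta> l * p * \<beta> l = (1 / of_nat n) *\<^sub>C \<beta> l"
proof -
  have "adj p = (1 / of_nat n) *\<^sub>C (\<Sum>l<n. \<Sum>m<n. \<epsilon> m l)"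
    unfolding p_def by (simp add: \<epsilon>)
  then show "adj p = p"
    unfolding p_def by (subst (asm) sum.swap) simp
  show "p * p = p"
    using n by (intro bop_pt_eqI) (simp add: Rep_p)
  show "p * \<beta> l * p = (1 / of_nat n) *\<^sub>C p" if "l < n"
    using that by (intro bop_pt_eqI) (simp add: Rep_p Rep_\<beta>)
  show "\<beta> l * p * \<beta> l = (1 / of_nat n) *\<^sub>C \<beta> l" if "l < n"
  proof (rule bop_pt_eqI)
    fix z :: "pt ell2" and as bs v
    have "(\<Sum>m<n. if m = l then Rep_ell2 z (as, bs, v div n * n + m) else 0) = Rep_ell2 z (as, bs, v div n * n + l)"
      using that by simp
    moreover have "v div n * n + l = v" if "v mod n = l" using that by (metis div_mult_mod_eq)
    ultimately show "Rep_ell2 (app (\<beta> l * p * \<beta> l) z) (as, bs, v) = Rep_ell2 (app ((1 / of_nat n) *\<^sub>C \<beta> l) z) (as, bs, v)"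
      by (simp add: Rep_p Rep_\<beta>)
  qed
qed

interpretation GE: graded levE .
interpretation GD: graded levD .

lemma Rep_N: "Rep_ell2 (app (GE.N j) z) (as, bs, v) = (if length as = j then Rep_ell2 z (as, bs, v) else 0)"
  "Rep_ell2 (app (GD.N j) z) (as, bs, v) = (if length bs = j then Rep_ell2 z (as, bs, v) else 0)"
  unfolding GE.N_def GD.N_def by (simp_all add: levE_def levD_def)

lemmas Rep = Rep_c Rep_d Rep_p Rep_\<beta> Rep_N

lemma pou_\<beta>: "pou n 1 \<beta>"
proof -
  have "(\<Sum>l<n. \<beta> l) = 1"
    using n by (intro bop_pt_eqI) (simp add: Rep_app_sum Rep_\<beta>)
  moreover have "\<beta> l * \<beta> m = (if l = m then \<beta> l else 0)" for l m
    by (rule bop_pt_eqI) (simp add: Rep_\<beta>)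
  ultimately show ?thesis
    unfolding pou_def by (simp add: \<beta>_def ind)
qed

lemma tower_E: "hmat n h \<Longrightarrow> tower levE n h c \<beta>"
  by unfold_locales (use n pou_\<beta> in \<open>auto intro!: bop_pt_eqI simp: Rep split: list.splits\<close>)

lemma commute:
  "c k * d l = d l * c k" "c k * adj (d l) = adj (d l) * c k" "adj (c k) * d l = d l * adj (c k)" "adj (c k) * adj (d l) = adj (d l) * adj (c k)"
  "c k * GD.N j = GD.N j * c k" "adj (c k) * GD.N j = GD.N j * adj (c k)"
  "d l * GE.N j = GE.N j * d l" "adj (d l) * GE.N j = GE.N j * adj (d l)" "GE.N j * GD.N i = GD.N i * GE.N j"
  "\<beta> m * c k = c k * \<beta> m" "\<beta> m * adj (c k) = adj (c k) * \<beta> m" "\<beta> m * d l = d l * \<beta> m" "\<beta> m * adj (d l) = adj (d l) * \<beta> m"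
  "\<beta> m * GE.N j = GE.N j * \<beta> m" "\<beta> m * GD.N j = GD.N j * \<beta> m"
  "p * c k = c k * p" "p * adj (c k) = adj (c k) * p" "p * d l = d l * p" "p * adj (d l) = adj (d l) * p"
  "p * GE.N j = GE.N j * p" "p * GD.N j = GD.N j * p"
  by (rule bop_pt_eqI; simp add: Rep split: list.splits)+

lemma T:
  "T0 * GE.N j * GD.N i = (if i = j then GE.N j * GD.N i else 0)"
  "T1 * GE.N j * GD.N i = (if i = Suc j then GE.N j * GD.N i else 0)"
  "adj T0 = T0" "adj T1 = T1"
proof -
  have "Rep_ell2 (app T0 z) (as, bs, v) = (if length bs = length as then Rep_ell2 z (as, bs, v) else 0)"
    "Rep_ell2 (app T1 z) (as, bs, v) = (if length bs = Suc (length as) then Rep_ell2 z (as, bs, v) else 0)" for z as bs v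
    by (simp_all add: T0_def T1_def)
  then show "T0 * GE.N j * GD.N i = (if i = j then GE.N j * GD.N i else 0)"
    "T1 * GE.N j * GD.N i = (if i = Suc j then GE.N j * GD.N i else 0)"
    by (auto intro!: bop_pt_eqI simp: Rep_N)
qed (simp_all add: T0_def T1_def ind)

lemma tower_D: "hmat n h \<Longrightarrow> pou n 1 g \<Longrightarrow> (\<And>l k. l < n \<Longrightarrow> g l * d k = d k * g l) \<Longrightarrow> (\<And>l j. l < n \<Longrightarrow> g l * GD.N j = GD.N j * g l) \<Longrightarrow>
    tower levD n h d g"
  by unfold_locales (use n in \<open>auto intro!: bop_pt_eqI simp: Rep split: list.splits\<close>)

theorem weakly_quantum_equivalent_ge4:
  assumes H: "hadamard n H" "hadamard n H'"
  shows "weakly_quantum_equivalent n H H'"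
proof -
  let ?hE = "\<lambda>l k. cnj (H $$ (l, k))" and ?hD = "\<lambda>l k. H' $$ (k, l)"
  note hm = hadamard_hmat[OF H(1)] hadamard_hmat[OF H(2)]
  have hE: "hmat n ?hE"
    unfolding hmat_def
  proof (intro conjI allI impI)
    fix i j assume ij: "i < n" "j < n"
    show "cmod (?hE i j) = 1" using hmatD(1)[OF hm(1) ij] by simp
    show "(\<Sum>k<n. ?hE i k * cnj (?hE j k)) = (if i = j then of_nat n else 0)"
      "(\<Sum>k<n. ?hE k i * cnj (?hE k j)) = (if i = j then of_nat n else 0)"
      using hmatD(4,5)[OF hm(1) ij(2,1)] by (simp_all add: mult.commute)
  qed
  have hD: "hmat n ?hD"
    using hm(2) by (auto simp: hmat_def mult.commute)
  have x: "x 0 = 0 \<or> x 0 = 1 / n" by (simp add: x_def)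
  have b: "\<And>j. 0 \<le> x j" "\<And>j. x j < 1" "\<And>j. 0 \<le> y j" "\<And>j. y j < 1"
    using xy_bounds by (auto intro: less_imp_le le_less_trans[of _ "1/2"])
  have "qtower levE n ?hE c \<beta> x"
    by (intro qtower.intro tower_E[OF hE] qtower_axioms.intro x b xy_rec)
  then interpret E: qtower levE n ?hE c \<beta> x .
  \<comment> \<open>One of the two Hadamard matrices is put to use to produce a partition unbiased
    to \<open>\<beta>\<close>. It commutes with whatever commutes with \<open>\<beta>\<close> and
    \<open>p\<close>, in particular with both Fock factors.\<close>
  define g where "g i = E.uu \<beta> i * p * adj (E.uu \<beta> i)" for i
  note g = E.pou_conj[OF p, folded g_def]
  have zg: "z * g i = g i * z" if "\<And>l. z * \<beta> l = \<beta> l * z" "z * p = p * z" for z i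
  proof -
    note u = E.uu_comm[of z \<beta>, OF that(1) pouD(1)[OF pou_\<beta>], of i]
    show ?thesis
      by (simp add: g_def mult.assoc u(1)[THEN amul] that(2)[THEN amul] u(2))
  qed
  have "qtower levD n ?hD d g y"
    by (intro qtower.intro tower_D[OF hD] qtower_axioms.intro b xy_rec g(1) zg[symmetric]) (simp_all add: commute)
  then interpret D: qtower levD n ?hD d g y .
  have "tower_pair levE levD n ?hE ?hD c d \<beta> g x y T0 T1"
  proof
    show "\<And>k. k < n \<Longrightarrow> D.cm (c k)" "\<And>k. k < n \<Longrightarrow> D.cm (\<beta> k)" "\<And>j. D.cm (GE.N j)"
      unfolding D.cm_def by (simp_all add: commute)
    show "\<And>k. k < n \<Longrightarrow> E.cm (d k)"
      unfolding E.cm_def by (simp add: commute)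
    show "\<And>k. k < n \<Longrightarrow> E.cm (g k)"
      unfolding E.cm_def by (intro conjI allI impI zg[symmetric]) (simp_all add: commute)
  qed (use T xy xy_bounds(3)[of 0] g(2) in auto)
  then show ?thesis
    by (rule weakly_quantum_equivalent_of_tower_pair[OF _ hm, of _ _ _ _ _ _ _ _ _ _ "([], [], 0)"]) (simp_all add: levE_def levD_def)
qed

end

section \<open>Sizes at most three\<close>

lemma proj_1: "proj (1 :: nat bop)"
  by unfold_locales simp_all

text \<open>Here \<open>p\<close> is diagonal and \<open>q\<close> a permutation matrix with phases,
  all entries being multiples of the unit. Involutions are general enough: the identity and one
  transposition will do.\<close>

lemma weakly_quantum_equivalent_of_monomial:
  fixes \<sigma> \<rho> :: "nat \<Rightarrow> nat" and r s :: "nat \<Rightarrow> complex"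
  assumes \<sigma>: "\<And>k. k < n \<Longrightarrow> \<sigma> k < n" "\<And>k. k < n \<Longrightarrow> \<sigma> (\<sigma> k) = k"
    and rs: "\<And>i. i < n \<Longrightarrow> cmod (r i) = 1" "\<And>i. i < n \<Longrightarrow> cmod (s i) = 1"
    and eq: "\<And>i k. i < n \<Longrightarrow> k < n \<Longrightarrow> r i * H $$ (i, \<sigma> k) = s k * H' $$ (i, k)"
  shows "weakly_quantum_equivalent n H H'"
proof -
  interpret proj "1 :: nat bop" by (rule proj_1)
  define U :: "(nat \<Rightarrow> nat) \<Rightarrow> (nat \<Rightarrow> complex) \<Rightarrow> nat \<Rightarrow> nat \<Rightarrow> nat bop" where
    "U \<tau> t i k = (if k = \<tau> i then t i else 0) *\<^sub>C 1" for \<tau> t i k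
  have fqr: "\<forall>i<n. \<forall>j<n.
        (\<Sum>k<n. U \<tau> t i k * adj (U \<tau> t j k)) = (if i = j then 1 else 0) \<and>
        (\<Sum>k<n. adj (U \<tau> t k i) * U \<tau> t k j) = (if i = j then 1 else 0) \<and>
        (\<Sum>k<n. adj (U \<tau> t i k) * U \<tau> t j k) = (if i = j then 1 else 0) \<and>
        (\<Sum>k<n. U \<tau> t k i * adj (U \<tau> t k j)) = (if i = j then 1 else 0) \<and>
        (\<forall>k<n. i \<noteq> j \<longrightarrow> U \<tau> t i k * adj (U \<tau> t j k) = 0 \<and> U \<tau> t k i * adj (U \<tau> t k j) = 0)"
    if \<tau>: "\<And>k. k < n \<Longrightarrow> \<tau> k < n" "\<And>k. k < n \<Longrightarrow> \<tau> (\<tau> k) = k" and t: "\<And>i. i < n \<Longrightarrow> cmod (t i) = 1" for \<tau> t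
  proof (intro allI impI)
    fix i j assume i: "i < n" and j: "j < n"
    have inj: "\<tau> i = \<tau> j \<longleftrightarrow> i = j" using \<tau>(2)[OF i] \<tau>(2)[OF j] by metis
    have tt: "t k * cnj (t k) = 1" if "k < n" for k
      using t[OF that] by (simp add: complex_norm_square[symmetric])
    have row: "U \<tau> t i k * adj (U \<tau> t j k) = (if k = \<tau> i then if i = j then 1 else 0 else 0)"
      "adj (U \<tau> t i k) * U \<tau> t j k = (if k = \<tau> i then if i = j then 1 else 0 else 0)" for k
      using inj tt[OF i] by (auto simp: U_def mult.commute)
    have col: "adj (U \<tau> t k i) * U \<tau> t k j = (if k = \<tau> i then if i = j then 1 else 0 else 0)"
      "U \<tau> t k i * adj (U \<tau> t k j) = (if k = \<tau> i then if i = j then 1 else 0 else 0)" if "k < n" for k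
    proof -
      have "i = \<tau> k \<longleftrightarrow> k = \<tau> i" using \<tau>(2)[OF i] \<tau>(2)[OF that] by metis
      then show "adj (U \<tau> t k i) * U \<tau> t k j = (if k = \<tau> i then if i = j then 1 else 0 else 0)"
        "U \<tau> t k i * adj (U \<tau> t k j) = (if k = \<tau> i then if i = j then 1 else 0 else 0)"
        using tt[OF that] by (auto simp: U_def mult.commute)
    qed
    have S: "(\<Sum>k<n. if k = \<tau> i then if i = j then 1 else 0 else 0) = (if i = j then 1 else (0 :: nat bop))"
      using \<tau>(1)[OF i] by simp
    show "(\<Sum>k<n. U \<tau> t i k * adj (U \<tau> t j k)) = (if i = j then 1 else 0) \<and>
        (\<Sum>k<n. adj (U \<tau> t k i) * U \<tau> t k j) = (if i = j then 1 else 0) \<and>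
        (\<Sum>k<n. adj (U \<tau> t i k) * U \<tau> t j k) = (if i = j then 1 else 0) \<and>
        (\<Sum>k<n. U \<tau> t k i * adj (U \<tau> t k j)) = (if i = j then 1 else 0) \<and>
        (\<forall>k<n. i \<noteq> j \<longrightarrow> U \<tau> t i k * adj (U \<tau> t j k) = 0 \<and> U \<tau> t k i * adj (U \<tau> t k j) = 0)"
      unfolding row using col S by simp
  qed
  show ?thesis
  proof (rule weakly_quantum_equivalentI[of n "U id r" "U \<sigma> s"])
    fix i j assume ij: "i < n" "j < n"
    have "(\<Sum>k<n. H' $$ (i, k) *\<^sub>C U \<sigma> s k j) = (\<Sum>k<n. if k = \<sigma> j then (s k * H' $$ (i, k)) *\<^sub>C 1 else 0)"
    proof (intro sum.cong refl)
      fix k assume "k \<in> {..<n}"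
      then have "j = \<sigma> k \<longleftrightarrow> k = \<sigma> j" using \<sigma>(2)[OF ij(2)] \<sigma>(2)[of k] by auto
      then show "H' $$ (i, k) *\<^sub>C U \<sigma> s k j = (if k = \<sigma> j then (s k * H' $$ (i, k)) *\<^sub>C 1 else 0)"
        by (auto simp: U_def mult.commute)
    qed
    also have "\<dots> = (r i * H $$ (i, j)) *\<^sub>C 1"
      using \<sigma>[OF ij(2)] eq[OF ij(1) \<sigma>(1)[OF ij(2)]] by simp
    also have "\<dots> = (\<Sum>k<n. if k = i then (r i * H $$ (i, j)) *\<^sub>C 1 else 0)"
      using ij by simp
    also have "\<dots> = (\<Sum>k<n. H $$ (k, j) *\<^sub>C U id r i k)"
      by (intro sum.cong) (auto simp: U_def mult.commute)
    finally show "(\<Sum>k<n. H' $$ (i, k) *\<^sub>C U \<sigma> s k j) = (\<Sum>k<n. H $$ (k, j) *\<^sub>C U id r i k)" .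
  qed (use fqr[of id r] fqr[of \<sigma> s] \<sigma> rs in \<open>auto simp: sub_def\<close>)
qed

text \<open>The normal form in which row 0 and column 0 consist of ones, reached by multiplying rows
  and columns by phases.\<close>

definition dephased :: "(nat \<Rightarrow> nat \<Rightarrow> complex) \<Rightarrow> nat \<Rightarrow> nat \<Rightarrow> complex" where
  "dephased h i k = h i k * cnj (h i 0) * cnj (h 0 k) * h 0 0"

lemma dephased:
  assumes h: "hmat n h" and n: "0 < n"
  shows "k < n \<Longrightarrow> dephased h 0 k = 1" "i < n \<Longrightarrow> dephased h i 0 = 1" "i < n \<Longrightarrow> k < n \<Longrightarrow> cmod (dephased h i k) = 1"
    "0 < i \<Longrightarrow> i < n \<Longrightarrow> (\<Sum>k<n. dephased h i k) = 0" "0 < k \<Longrightarrow> k < n \<Longrightarrow> (\<Sum>i<n. dephased h i k) = 0"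
    "i < n \<Longrightarrow> k < n \<Longrightarrow> h i k = dephased h i k * h i 0 * h 0 k * cnj (h 0 0)"
proof -
  note D = hmatD[OF h]
  have "dephased h 0 k = (h 0 k * cnj (h 0 k)) * (h 0 0 * cnj (h 0 0))" "dephased h i 0 = (h i 0 * cnj (h i 0)) * (h 0 0 * cnj (h 0 0))"
    by (simp_all add: dephased_def mult_ac)
  then show "k < n \<Longrightarrow> dephased h 0 k = 1" "i < n \<Longrightarrow> dephased h i 0 = 1"
    using n D(2) by simp_all
  show "i < n \<Longrightarrow> k < n \<Longrightarrow> cmod (dephased h i k) = 1"
    using n D(1) by (simp add: dephased_def norm_mult)
  have "dephased h i k * h i 0 * h 0 k * cnj (h 0 0) = h i k * (h i 0 * cnj (h i 0)) * (h 0 k * cnj (h 0 k)) * (h 0 0 * cnj (h 0 0))"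
    by (simp add: dephased_def mult_ac)
  then show "i < n \<Longrightarrow> k < n \<Longrightarrow> h i k = dephased h i k * h i 0 * h 0 k * cnj (h 0 0)"
    using n D(2) by simp
  show "(\<Sum>k<n. dephased h i k) = 0" if "0 < i" "i < n"
  proof -
    have "(\<Sum>k<n. dephased h i k) = (\<Sum>k<n. h i k * cnj (h 0 k)) * (cnj (h i 0) * h 0 0)"
      unfolding sum_distrib_right dephased_def by (intro sum.cong) (simp_all add: mult_ac)
    then show ?thesis using D(4)[OF that(2) n] that by simp
  qed
  show "(\<Sum>i<n. dephased h i k) = 0" if "0 < k" "k < n"
  proof -
    have "(\<Sum>i<n. dephased h i k) = (\<Sum>i<n. h i k * cnj (h i 0)) * (cnj (h 0 k) * h 0 0)"
      unfolding sum_distrib_right dephased_def by (intro sum.cong) (simp_all add: mult_ac)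
    then show ?thesis using D(5)[OF that(2) n] that by simp
  qed
qed

lemma eq_minus_one_minus: "v = - 1 - u" if "u + v + 1 = 0" for u v :: complex
proof -
  have "v = (u + v + 1) - 1 - u" by simp
  then show ?thesis unfolding that by simp
qed

text \<open>Rows and columns other than the first sum to 0. For size 3 this leaves one unknown
  \<open>a\<close> such that \<open>a\<close> and \<open>- 1 - a\<close> both have modulus one, that
  is, a primitive cube root of unity.\<close>

lemma dephased_small:
  assumes h: "hmat n h"
  shows "n = 2 \<Longrightarrow> dephased h 1 1 = -1"
    "n = 3 \<Longrightarrow> dephased h 1 2 = - 1 - dephased h 1 1 \<and> dephased h 2 1 = - 1 - dephased h 1 1 \<and>
      dephased h 2 2 = dephased h 1 1 \<and> (dephased h 1 1)\<^sup>2 + dephased h 1 1 + 1 = 0"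
proof -
  have add0: "b = - 1 - a" if "1 + a + b = 0" for a b :: complex
    using that by (intro eq_minus_one_minus) (simp only: add_ac)
  show "dephased h 1 1 = -1" if "n = 2"
  proof -
    have "1 + 0 + dephased h 1 1 = 0"
      using dephased(2,4)[OF h, of 1] that by (simp add: numeral_2_eq_2)
    from add0[OF this] show ?thesis by simp
  qed
  assume n: "n = 3"
  let ?a = "dephased h 1 1"
  have r: "1 + dephased h i 1 + dephased h i 2 = 0" if "i = 1 \<or> i = 2" for i
    using dephased(2,4)[OF h, of i] that n by (auto simp: numeral_3_eq_3 numeral_2_eq_2)
  have c: "1 + dephased h 1 k + dephased h 2 k = 0" if "k = 1 \<or> k = 2" for k
    using dephased(1,5)[OF h, of k] that n by (auto simp: numeral_3_eq_3 numeral_2_eq_2)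
  have 12: "dephased h 1 2 = - 1 - ?a" and 21: "dephased h 2 1 = - 1 - ?a"
    by (rule add0, rule r, simp) (rule add0, rule c, simp)
  have 22: "dephased h 2 2 = ?a"
    using add0[OF r[of 2]] unfolding 21 by simp
  have "cmod ?a = 1" "cmod (dephased h 1 2) = 1"
    using dephased(3)[OF h] n by simp_all
  then have 1: "?a * cnj ?a = 1" "(- 1 - ?a) * cnj (- 1 - ?a) = 1"
    unfolding 12 complex_norm_square[symmetric] by simp_all
  \<comment> \<open>The second modulus condition, expanded and simplified by the first.\<close>
  then have "?a + cnj ?a + 1 = 0"
    by (simp add: algebra_simps)
  then have "?a * (?a + cnj ?a + 1) = 0"
    by simp
  then have "?a\<^sup>2 + ?a + 1 = 0"
    using 1(1) by (simp add: distrib_left power2_eq_square add_ac)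
  then show "dephased h 1 2 = - 1 - ?a \<and> dephased h 2 1 = - 1 - ?a \<and> dephased h 2 2 = ?a \<and> ?a\<^sup>2 + ?a + 1 = 0"
    using 12 21 22 by simp
qed

text \<open>The phases \<open>r\<close> and \<open>s\<close> undo the normalisation of one matrix
  and perform that of the other; \<open>\<sigma>\<close> fixes column 0, by which the rows are
  normalised.\<close>

lemma weakly_quantum_equivalent_of_dephased:
  assumes H: "hadamard n H" "hadamard n H'" and n: "0 < n"
    and \<sigma>: "\<sigma> 0 = 0" "\<And>k. k < n \<Longrightarrow> \<sigma> k < n" "\<And>k. k < n \<Longrightarrow> \<sigma> (\<sigma> k) = k"
    and eq: "\<And>i k. 0 < i \<Longrightarrow> i < n \<Longrightarrow> 0 < k \<Longrightarrow> k < n \<Longrightarrow> dephased (\<lambda>i j. H $$ (i, j)) i (\<sigma> k) = dephased (\<lambda>i j. H' $$ (i, j)) i k"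
  shows "weakly_quantum_equivalent n H H'"
proof -
  let ?h = "\<lambda>i j. H $$ (i, j)" and ?h' = "\<lambda>i j. H' $$ (i, j)"
  note h = hadamard_hmat[OF H(1)] and h' = hadamard_hmat[OF H(2)]
  have eq': "dephased ?h i (\<sigma> k) = dephased ?h' i k" if "i < n" "k < n" for i k
    using eq[of i k] that \<sigma> dephased(1,2)[OF h n] dephased(1,2)[OF h' n] by (cases "i = 0"; cases "k = 0") auto
  define r where "r i = cnj (?h i 0) * ?h' i 0" for i
  define s where "s k = ?h 0 (\<sigma> k) * cnj (?h 0 0) * cnj (?h' 0 k) * ?h' 0 0" for k
  note c = hmatD(1)[OF h] hmatD(1)[OF h']
  show ?thesis
  proof (rule weakly_quantum_equivalent_of_monomial[of n \<sigma> r s, OF \<sigma>(2,3)])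
    show "cmod (r i) = 1" "cmod (s i) = 1" if "i < n" for i
      using c that n \<sigma> by (simp_all add: r_def s_def norm_mult)
    fix i k assume ik: "i < n" "k < n"
    have "r i * ?h i (\<sigma> k) = r i * (dephased ?h i (\<sigma> k) * ?h i 0 * ?h 0 (\<sigma> k) * cnj (?h 0 0))"
      using dephased(6)[OF h n ik(1) \<sigma>(2)[OF ik(2)]] by simp
    also have "\<dots> = ?h' i 0 * dephased ?h i (\<sigma> k) * ?h 0 (\<sigma> k) * cnj (?h 0 0) * (?h i 0 * cnj (?h i 0))"
      by (simp add: r_def mult_ac)
    also have "\<dots> = ?h' i 0 * dephased ?h i (\<sigma> k) * ?h 0 (\<sigma> k) * cnj (?h 0 0)"
      using hmatD(2)[OF h ik(1) n] by simp
    also have "\<dots> = ?h' i 0 * dephased ?h i (\<sigma> k) * ?h 0 (\<sigma> k) * cnj (?h 0 0) * (?h' 0 k * cnj (?h' 0 k)) * (?h' 0 0 * cnj (?h' 0 0))"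
      using hmatD(2)[OF h' n ik(2)] hmatD(2)[OF h' n n] by simp
    also have "\<dots> = s k * (dephased ?h' i k * ?h' i 0 * ?h' 0 k * cnj (?h' 0 0))"
      unfolding eq'[OF ik] by (simp add: s_def mult_ac)
    also have "\<dots> = s k * ?h' i k"
      using dephased(6)[OF h' n ik] by simp
    finally show "r i * ?h i (\<sigma> k) = s k * ?h' i k" .
  qed
qed

lemma weakly_quantum_equivalent_le3:
  assumes H: "hadamard n H" "hadamard n H'" and n: "n \<le> 3"
  shows "weakly_quantum_equivalent n H H'"
proof -
  let ?A = "dephased (\<lambda>i j. H $$ (i, j))" and ?A' = "dephased (\<lambda>i j. H' $$ (i, j))"
  note h = hadamard_hmat[OF H(1)] and h' = hadamard_hmat[OF H(2)]
  consider "n = 0" | "n = 1" | "n = 2" | "n = 3" using n by linarith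
  then show ?thesis
  proof cases
    case 1
    then show ?thesis
      by (intro weakly_quantum_equivalent_of_monomial[of n id "\<lambda>_. 1" "\<lambda>_. 1"]) simp_all
  next
    case 2
    then show ?thesis
      by (intro weakly_quantum_equivalent_of_dephased[OF H, of id]) simp_all
  next
    case 3
    have "?A i k = ?A' i k" if "0 < i" "i < n" "0 < k" "k < n" for i k
    proof -
      have "i = 1" "k = 1" using that 3 by auto
      then show ?thesis using dephased_small(1)[OF h 3] dephased_small(1)[OF h' 3] by simp
    qed
    then show ?thesis
      using 3 by (intro weakly_quantum_equivalent_of_dephased[OF H, of id]) simp_all
  next
    case 4
    let ?a = "?A 1 1" and ?a' = "?A' 1 1"
    note s = dephased_small(2)[OF h 4] dephased_small(2)[OF h' 4]
    have two: "i = 1 \<or> i = 2" if "0 < i" "i < n" for i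
      using that 4 by auto
    \<comment> \<open>Both entries are roots of the same quadratic polynomial, whose roots add up to
      -1. So they are equal or the two different roots.\<close>
    have "(?a - ?a') * (?a + ?a' + 1) = (?a\<^sup>2 + ?a + 1) - (?a'\<^sup>2 + ?a' + 1)"
      by (simp add: algebra_simps power2_eq_square)
    also have "\<dots> = 0"
      unfolding s[THEN conjunct2, THEN conjunct2, THEN conjunct2] by simp
    finally have "(?a - ?a') * (?a + ?a' + 1) = 0" .
    then have "?a - ?a' = 0 \<or> ?a + ?a' + 1 = 0"
      by (simp only: mult_eq_0_iff)
    then consider "?a' = ?a" | "?a' = - 1 - ?a"
      using eq_minus_one_minus[of ?a ?a'] by fastforce
    then show ?thesis
    proof cases
      case 1
      have "?A i k = ?A' i k" if "0 < i" "i < n" "0 < k" "k < n" for i k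
        using two[OF that(1,2)] two[OF that(3,4)] s 1 by auto
      then show ?thesis
        using 4 by (intro weakly_quantum_equivalent_of_dephased[OF H, of id]) simp_all
    next
      case 2
      \<comment> \<open>The other root is the entry in the other column, so the transposition of
        columns 1 and 2 carries one normal form to the other.\<close>
      have "?A i (if k = 0 then 0 else 3 - k) = ?A' i k" if "0 < i" "i < n" "0 < k" "k < n" for i k
        using two[OF that(1,2)] two[OF that(3,4)] s 2 by auto
      then show ?thesis
        using 4 by (intro weakly_quantum_equivalent_of_dephased[OF H, of "\<lambda>k. if k = 0 then 0 else 3 - k"]) auto
    qed
  qed
qed

theorem theorem1:
  fixes n :: nat and H H' :: "complex mat"
  assumes "hadamard n H" and "hadamard n H'"
  shows "weakly_quantum_equivalent n H H'"
proof (cases "n \<le> 3")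
  case True
  then show ?thesis by (rule weakly_quantum_equivalent_le3[OF assms])
next
  case False
  then interpret fock_model n by unfold_locales simp
  show ?thesis by (rule weakly_quantum_equivalent_ge4[OF assms])
qed

end
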